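(* Let $\mathbb X$ be a reflexive real Banach space, $\mathbb Y$ a real Banach space, $C\subseteq\mathbb Y$ a closed convex cone with $\{0\}\neq C\neq\mathbb Y$, $K\subseteq\mathbb X$ a nonempty closed set and $f:\mathbb X\times\mathbb X\to\mathbb Y$. Let $\mathcal{SE}=\{\bar x\in K:\ f(\bar x,x)\in C\ \ \forall x\in K\}$, $\nu(x)=\sup_{z\in K}\mathrm{dist}(f(x,z),C)\in[0,+\infty]$ and $\nu_{+K}(x)=\nu(x)+\mathrm{dist}(x,K)$ for $x\in\mathbb X$. Suppose that: (i) $K$ is convex; (ii) for every $z\in K$ the function $x\mapsto f(x,z)$ is $C$-u.s.c. on $\mathbb X$; (iii) there exists $x_0\in K$ such that $f(x_0,K)=\{f(x_0,z):z\in K\}$ is $C$-bounded; (iv) there exists $\gamma>0$ such that $$\left[\partial_{\rm M}\nu(x)+\widehat B^*_K(x)\right]\cap\gamma\mathbb B^*=\varnothing,\qquad\forall x\in\mathbb X\setminus\mathcal{SE}.$$ Then $\mathcal{SE}$ is nonempty and closed, and $$\mathrm{dist}(x,\mathcal{SE})\le\frac{\nu_{+K}(x)}{\gamma},\qquad\forall x\in\mathbb X.$$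
   Context: $\mathbb B$ is the closed unit ball, $\mathbb B^*,\mathbb S^*$ the closed unit ball and unit sphere of $\mathbb X^*$. $\mathrm{dist}(x,S)=\inf_{s\in S}\|x-s\|$, with $\mathrm{dist}(x,\varnothing)=+\infty$. A mapping $g:\mathbb X\to\mathbb Y$ is $C$-u.s.c. at $x_0$ if for every neighbourhood $V$ of $g(x_0)$ there is a neighbourhood $U$ of $x_0$ with $g(x)\in V-C$ for all $x\in U$, and $C$-u.s.c. on $\mathbb X$ if so at each point. A set $S\subseteq\mathbb Y$ is $C$-bounded if there is $m\ge0$ with $S\setminus C\subseteq m\mathbb B$. For $\varphi:\mathbb X\to\mathbb R\cup\{\pm\infty\}$ and $x$ with $\varphi(x)\in\mathbb R$, the Fréchet subdifferential is $\widehat\partial\varphi(x)=\{x^*\in\mathbb X^*:\liminf_{v\to0}\frac{\varphi(x+v)-\varphi(x)-\langle x^*,v\rangle}{\|v\|}\ge0\}$. For $\varphi$ l.s.c. around $\bar x$ (reflexive spaces are Asplund), the Mordukhovich subdifferential $\partial_{\rm M}\varphi(\bar x)$ is the (sequential) Painlevé–Kuratowski upper limit of $\widehat\partial\varphi(x)$ as $x\to\bar x$, $\varphi(x)\to\varphi(\bar x)$: the set of $x^*\in\mathbb X^*$ for which there are $x_n\to\bar x$ in norm with $\varphi(x_n)\to\varphi(\bar x)$ and $x_n^*\in\widehat\partial\varphi(x_n)$ with $x_n^*\to x^*$ weak$^*$. Both subdifferentials are empty at points where $\varphi$ is not finite. For $K$ closed convex, let $\Pi(x;K)=\{w\in K:\|x-w\|=\mathrm{dist}(x,K)\}$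 (nonempty by reflexivity) and $\mathrm N(w;K)=\{x^*\in\mathbb X^*:\langle x^*,y-w\rangle\le0\ \forall y\in K\}$. Define $\widehat B^*_K(x)=\mathrm N(x;K)\cap\mathbb B^*$ if $x\in K$, and $\widehat B^*_K(x)=\bigcap_{w\in\Pi(x;K)}\mathrm N(w;K)\cap\mathbb S^*$ if $x\notin K$. *)

theory Defs
  imports "HOL-Analysis.Analysis"
begin

text \<open>The dual of a real normed space \<^typ>\<open>'a\<close> is \<open>'a \<Rightarrow>\<^sub>L real\<close> with its operator norm.
  Being reflexive means that the canonical embedding into the bidual is onto.\<close>

definition reflexive_space :: "'a::real_normed_vector itself \<Rightarrow> bool" where
  "reflexive_space _ \<longleftrightarrow>
    (\<forall>\<Phi> :: ('a \<Rightarrow>\<^sub>L real) \<Rightarrow>\<^sub>L real. \<exists>x::'a. \<forall>xs. blinfun_apply \<Phi> xs = blinfun_apply xs x)"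

text \<open>Distance with the convention \<open>dist x {} = \<infinity>\<close> (the library's \<^const>\<open>infdist\<close>
  has value 0 there).\<close>

definition edist :: "'a::real_normed_vector \<Rightarrow> 'a set \<Rightarrow> ereal" where
  "edist x S = (INF s\<in>S. ereal (norm (x - s)))"

text \<open>\<open>V - C\<close> is the Minkowski difference, written out because \<open>-\<close> on sets is set difference.\<close>

definition cone_usc_at :: "'b::real_normed_vector set \<Rightarrow> ('a::topological_space \<Rightarrow> 'b) \<Rightarrow> 'a \<Rightarrow> bool" where
  "cone_usc_at C g x0 \<longleftrightarrow>
    (\<forall>V. open V \<and> g x0 \<in> V \<longrightarrow>
      (\<exists>U. open U \<and> x0 \<in> U \<and> (\<forall>x\<in>U. g x \<in> {v - c |v c. v \<in> V \<and> c \<in> C})))"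

definition cone_usc :: "'b::real_normed_vector set \<Rightarrow> ('a::topological_space \<Rightarrow> 'b) \<Rightarrow> bool" where
  "cone_usc C g \<longleftrightarrow> (\<forall>x. cone_usc_at C g x)"

definition cone_bounded :: "'b::real_normed_vector set \<Rightarrow> 'b set \<Rightarrow> bool" where
  "cone_bounded C S \<longleftrightarrow> (\<exists>m\<ge>0. S - C \<subseteq> cball 0 m)"

definition frechet_subdiff :: "('a::real_normed_vector \<Rightarrow> ereal) \<Rightarrow> 'a \<Rightarrow> ('a \<Rightarrow>\<^sub>L real) set" where
  "frechet_subdiff \<phi> x =
    {xs. \<bar>\<phi> x\<bar> \<noteq> \<infinity> \<and>
      0 \<le> Liminf (at 0) (\<lambda>v. (\<phi> (x + v) - \<phi> x - ereal (blinfun_apply xs v)) / ereal (norm v))}"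

text \<open>The convergence of the functionals \<open>xsn n\<close> is weak* (pointwise) convergence.\<close>

definition mordukhovich_subdiff :: "('a::real_normed_vector \<Rightarrow> ereal) \<Rightarrow> 'a \<Rightarrow> ('a \<Rightarrow>\<^sub>L real) set" where
  "mordukhovich_subdiff \<phi> x =
    {xs. \<bar>\<phi> x\<bar> \<noteq> \<infinity> \<and>
      (\<exists>xn xsn. xn \<longlonglongrightarrow> x \<and> (\<lambda>n. \<phi> (xn n)) \<longlonglongrightarrow> \<phi> x \<and>
        (\<forall>n. xsn n \<in> frechet_subdiff \<phi> (xn n)) \<and>
        (\<forall>v. (\<lambda>n. blinfun_apply (xsn n) v) \<longlonglongrightarrow> blinfun_apply xs v))}"

definition metric_proj :: "'a::real_normed_vector \<Rightarrow> 'a set \<Rightarrow> 'a set" where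
  "metric_proj x K = {w \<in> K. ereal (norm (x - w)) = edist x K}"

definition normal_cone :: "'a::real_normed_vector \<Rightarrow> 'a set \<Rightarrow> ('a \<Rightarrow>\<^sub>L real) set" where
  "normal_cone w K = {xs. \<forall>y\<in>K. blinfun_apply xs (y - w) \<le> 0}"

definition hatB :: "'a::real_normed_vector set \<Rightarrow> 'a \<Rightarrow> ('a \<Rightarrow>\<^sub>L real) set" where
  "hatB K x =
    (if x \<in> K then normal_cone x K \<inter> cball 0 1
     else (\<Inter>w\<in>metric_proj x K. normal_cone w K \<inter> sphere 0 1))"

definition strong_equilibria :: "'b set \<Rightarrow> 'a set \<Rightarrow> ('a \<Rightarrow> 'a \<Rightarrow> 'b) \<Rightarrow> 'a set" where
  "strong_equilibria C K f = {xbar \<in> K. \<forall>x\<in>K. f xbar x \<in> C}"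

definition merit ::
    "'b::real_normed_vector set \<Rightarrow> 'a set \<Rightarrow> ('a \<Rightarrow> 'a \<Rightarrow> 'b) \<Rightarrow> 'a \<Rightarrow> ereal" where
  "merit C K f x = (SUP z\<in>K. edist (f x z) C)"

definition merit_plus ::
    "'b::real_normed_vector set \<Rightarrow> 'a::real_normed_vector set \<Rightarrow> ('a \<Rightarrow> 'a \<Rightarrow> 'b) \<Rightarrow> 'a \<Rightarrow> ereal" where
  "merit_plus C K f x = merit C K f x + edist x K"

end

theory Submission
  imports Defs "HOL-Library.Diagonal_Subsequence"
begin

text \<open>If the estimate fails at \<open>x\<close>, Ekeland's principle gives a point \<open>xh\<close> outside the solution set
  that minimizes \<open>\<nu> + k\<close>, where \<open>k y = dist(y, K) + \<gamma>' |y - xh|\<close> is convex and \<open>\<gamma>' < \<gamma>\<close>. The limiting sum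
  rule yields \<open>u\<close> in the Mordukhovich subdifferential of \<open>\<nu>\<close> at \<open>xh\<close> with \<open>-u\<close> in the convex
  subdifferential of \<open>k\<close>; splitting the latter gives \<open>v\<close> in \<open>hatB K xh\<close> with \<open>|u + v| \<le> \<gamma>'\<close>, against (iv).

  The sum rule is proved without an equivalent smooth norm and without separable reduction.
  A convex Lipschitz function \<open>b\<close> is approximated by the supremum of its affine minorants
  \<open>z + \<beta>\<close>, penalized by \<open>H z = \<Sum>m. c m * |z - e m|^2\<close>. By a midpoint estimate the maximizing sequences
  at a point converge in norm, hence the approximation is Frechet differentiable there, as
  soon as some maximizer is a limit of the \<open>e m\<close>. The \<open>e m\<close> are therefore chosen
  along a smooth variational principle: they are dense in the convex hull of the
  near-maximizers met at the approximate minimizers \<open>x n\<close>, and by reflexivity this closed hull contains a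
  maximizer at the limit of the \<open>x n\<close>.\<close>

section \<open>Sublinear functionals and subgradients\<close>

text \<open>A norm perturbation is not differentiable, so minimality under it gives no Frechet
  subgradient of \<open>\<nu>\<close>; every perturbation has to be smoothed. The midpoint estimate
  is effective only at maximizers in the closure of the centers \<open>e m\<close>, and a
  nonseparable dual ball has no countable dense set of centers. So the centers must follow a
  maximizer at the limit of the \<open>x n\<close>, while the \<open>x n\<close> themselves depend
  on the penalties. This circle is broken by adding penalties one at a time. The \<open>n\<close>-th
  one is at most \<open>weight n\<close> on the relevant ball, hence moves each smoothing by at most
  that much, and the weights decay so fast that the new term \<open>rate n * |y - x n|\<close> still
  forces \<open>x\<close> to converge. The near-maximizers recorded on the way need not converge in
  norm, but near-maximizers form convex sets, so a point of all closed tail hulls is a norm limit of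
  near-maximizers. An upper Frechet estimate of the smoothings suffices: at a minimum of a sum it
  becomes a lower estimate for the other summand.\<close>

definition sublinear :: "('a::real_vector \<Rightarrow> real) \<Rightarrow> bool" where
  "sublinear p \<longleftrightarrow> (\<forall>x y. p (x + y) \<le> p x + p y) \<and> (\<forall>c x. c > 0 \<longrightarrow> p (c *\<^sub>R x) = c * p x)"

lemma sublinearI:
  assumes "\<And>x y. p (x + y) \<le> p x + p y" "\<And>c x. c > 0 \<Longrightarrow> p (c *\<^sub>R x) \<le> c * p x"
  shows "sublinear p"
proof -
  have "c * p x \<le> p (c *\<^sub>R x)" if "c > 0" for c x
    using assms(2)[of "inverse c" "c *\<^sub>R x"] that by (simp add: field_simps)
  then show ?thesis
    unfolding sublinear_def using assms by (simp add: order_antisym)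
qed

lemma sublinear_add: "sublinear p \<Longrightarrow> p (x + y) \<le> p x + p y"
  and sublinear_scale: "sublinear p \<Longrightarrow> c > 0 \<Longrightarrow> p (c *\<^sub>R x) = c * p x"
  by (simp_all add: sublinear_def)

lemma sublinear_zero: "sublinear p \<Longrightarrow> p 0 = 0"
  using sublinear_scale[of p 2 0] by simp

lemma sublinear_neg: "sublinear p \<Longrightarrow> - p (- x) \<le> p x"
  using sublinear_add[of p x "-x"] sublinear_zero[of p] by simp

text \<open>The infimum over the ray of \<open>a\<close> lowers \<open>p\<close> in the direction
  \<open>-a\<close>: \<open>t = 0\<close> gives \<open>q \<le> p\<close>, and \<open>t = 1\<close>
  at \<open>-a\<close> gives \<open>p 0 - p a\<close>. It serves twice: to fix the value at a
  prescribed vector, and to see that a minimal sublinear functional is odd.\<close>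

lemma sublinear_shift:
  assumes "sublinear p"
  obtains q where "sublinear q" "q \<le> p" "q (- a) \<le> - p a"
proof
  define q where "q v = (INF t\<in>{0..}. p (v + t *\<^sub>R a) - t * p a)" for v
  have bdd: "bdd_below ((\<lambda>t. p (v + t *\<^sub>R a) - t * p a) ` {0..})" for v
  proof (rule bdd_belowI2[where m = "- p (- v)"])
    fix t :: real assume "t \<in> {0..}"
    then have "t * p a = p (t *\<^sub>R a)"
      using sublinear_scale[OF assms] sublinear_zero[OF assms] by (cases "t = 0") auto
    also have "\<dots> \<le> p (v + t *\<^sub>R a) + p (- v)"
      using sublinear_add[OF assms, of "v + t *\<^sub>R a" "- v"] by simp
    finally show "- p (- v) \<le> p (v + t *\<^sub>R a) - t * p a" by simp
  qed
  have le: "q v \<le> p (v + t *\<^sub>R a) - t * p a" if "t \<ge> 0" for v t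
    unfolding q_def by (rule cINF_lower[OF bdd]) (use that in auto)
  have ge: "c \<le> q v" if "\<And>t. t \<ge> 0 \<Longrightarrow> c \<le> p (v + t *\<^sub>R a) - t * p a" for c v
    unfolding q_def by (rule cINF_greatest) (use that in auto)
  show "q \<le> p"
    using le[of 0] by (auto simp: le_fun_def)
  show "q (- a) \<le> - p a"
    using le[of 1 "-a"] sublinear_zero[OF assms] by simp
  show "sublinear q"
  proof (rule sublinearI)
    fix x y
    have "q (x + y) - (p (y + s *\<^sub>R a) - s * p a) \<le> p (x + t *\<^sub>R a) - t * p a" if "t \<ge> 0" "s \<ge> 0" for s t
      using le[of "s + t" "x + y"] that sublinear_add[OF assms, of "x + t *\<^sub>R a" "y + s *\<^sub>R a"]
      by (simp add: algebra_simps)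
    then have "q (x + y) - (p (y + s *\<^sub>R a) - s * p a) \<le> q x" if "s \<ge> 0" for s
      using ge that by blast
    then have "q (x + y) - q x \<le> p (y + s *\<^sub>R a) - s * p a" if "s \<ge> 0" for s
      using that by (smt (verit))
    then have "q (x + y) - q x \<le> q y"
      using ge by blast
    then show "q (x + y) \<le> q x + q y" by simp
  next
    fix c :: real and x assume c: "c > 0"
    have "q (c *\<^sub>R x) / c \<le> p (x + t *\<^sub>R a) - t * p a" if "t \<ge> 0" for t
      using le[of "c * t" "c *\<^sub>R x"] that c sublinear_scale[OF assms, of c "x + t *\<^sub>R a"]
      by (simp add: field_simps)
    then have "q (c *\<^sub>R x) / c \<le> q x" using ge by blast
    then show "q (c *\<^sub>R x) \<le> c * q x" using c by (simp add: field_simps)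
  qed
qed

text \<open>A minimal sublinear functional is linear, since \<open>sublinear_shift\<close> cannot decrease it.\<close>

theorem hahn_banach_dominated:
  fixes p :: "'a::real_vector \<Rightarrow> real"
  assumes "sublinear p"
  obtains L where "linear L" "\<And>v. L v \<le> p v" "L a = p a"
proof -
  \<comment> \<open>A linear functional below \<open>p'\<close> is at most \<open>- p a\<close> at
    \<open>-a\<close>, hence at least \<open>p a\<close> at \<open>a\<close>. The value at
    \<open>a\<close> is thus fixed before minimizing.\<close>
  obtain p' where p': "sublinear p'" "p' \<le> p" "p' (- a) \<le> - p a"
    using sublinear_shift[OF assms] by blast
  define A where "A = {q. sublinear q \<and> q \<le> p'}"
  \<comment> \<open>The order is reversed, so that a maximal element from Zorn's lemma is a minimal
    functional.\<close>
  define r where "r = relation_of (\<lambda>q q'. q' \<le> q) A"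
  have po: "partial_order_on A r"
    unfolding r_def by (rule partial_order_on_relation_ofI) auto
  have "\<exists>u\<in>A. \<forall>q\<in>Ch. u \<le> q" if Ch: "Ch \<in> Chains r" for Ch
  proof (cases "Ch = {}")
    case True
    then show ?thesis using p' by (auto simp: A_def)
  next
    case False
    have ChA: "q \<in> A" if "q \<in> Ch" for q
      using Chains_relation_of[OF Ch[unfolded r_def]] that by auto
    have tot: "q \<le> q' \<or> q' \<le> q" if "q \<in> Ch" "q' \<in> Ch" for q q'
      using Ch that by (auto simp: Chains_def r_def relation_of_def)
    define u where "u v = (INF q\<in>Ch. q v)" for v
    have bdd: "bdd_below ((\<lambda>q. q v) ` Ch)" for v
    proof (rule bdd_belowI2[where m = "- p' (- v)"])
      fix q assume "q \<in> Ch"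
      then have "sublinear q" "q (- v) \<le> p' (- v)" using ChA by (auto simp: A_def le_fun_def)
      then show "- p' (- v) \<le> q v" using sublinear_neg[of q v] by linarith
    qed
    have le: "u v \<le> q v" if "q \<in> Ch" for q v
      unfolding u_def by (rule cINF_lower[OF bdd that])
    have ge: "c \<le> u v" if "\<And>q. q \<in> Ch \<Longrightarrow> c \<le> q v" for c v
      unfolding u_def by (rule cINF_greatest[OF False that])
    have "sublinear u"
    proof (rule sublinearI)
      fix x y
      have "u (x + y) - q' y \<le> q x" if q: "q \<in> Ch" "q' \<in> Ch" for q q'
      proof -
        obtain q'' where "q'' \<in> Ch" "q'' \<le> q" "q'' \<le> q'"
          using tot[OF q] q by blast
        then show ?thesis
          using le[of q'' "x + y"] ChA[of q''] sublinear_add[of q'' x y]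
          by (fastforce simp: A_def le_fun_def dest: spec[of _ x] spec[of _ y])
      qed
      then have "u (x + y) - q' y \<le> u x" if "q' \<in> Ch" for q'
        using ge that by blast
      then have "u (x + y) - u x \<le> q' y" if "q' \<in> Ch" for q'
        using that by (smt (verit))
      then have "u (x + y) - u x \<le> u y" using ge by blast
      then show "u (x + y) \<le> u x + u y" by simp
    next
      fix c :: real and x assume c: "c > 0"
      have "u (c *\<^sub>R x) / c \<le> q x" if "q \<in> Ch" for q
        using le[OF that, of "c *\<^sub>R x"] ChA[OF that] sublinear_scale[of q c x] c
        by (simp add: A_def field_simps)
      then have "u (c *\<^sub>R x) / c \<le> u x" using ge by blast
      then show "u (c *\<^sub>R x) \<le> c * u x" using c by (simp add: field_simps)
    qed
    moreover have "u \<le> p'"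
      using False le ChA by (fastforce simp: A_def le_fun_def intro: order_trans)
    ultimately show ?thesis using le by (auto simp: A_def le_fun_def)
  qed
  then obtain m where m: "m \<in> A" "\<And>q. q \<in> A \<Longrightarrow> q \<le> m \<Longrightarrow> q = m"
    using predicate_Zorn[OF po[unfolded r_def]] unfolding r_def by metis
  have sm: "sublinear m" and mp: "m \<le> p'" using m by (auto simp: A_def)
  have neg: "m (- v) = - m v" for v
  proof -
    obtain q where "sublinear q" "q \<le> m" "q (- v) \<le> - m v"
      using sublinear_shift[OF sm] by blast
    then have "q = m" using m(2)[of q] mp by (auto simp: A_def)
    then have "m (- v) \<le> - m v" using \<open>q (- v) \<le> - m v\<close> by simp
    then show ?thesis using sublinear_neg[OF sm, of v] by simp
  qed
  show ?thesis
  proof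
    show "linear m"
    proof (rule linearI)
      fix x y
      show "m (x + y) = m x + m y"
        using sublinear_add[OF sm, of x y] sublinear_add[OF sm, of "- x" "- y"] neg[of x] neg[of y] neg[of "x + y"]
        by simp
    next
      fix c :: real and x
      show "m (c *\<^sub>R x) = c *\<^sub>R m x"
      proof (cases c "0::real" rule: linorder_cases)
        case less
        then show ?thesis
          using sublinear_scale[OF sm, of "- c" x] neg[of "c *\<^sub>R x"] by simp
      qed (use sublinear_scale[OF sm, of c x] sublinear_zero[OF sm] in auto)
    qed
    show "m v \<le> p v" for v
      using mp p'(2) by (auto simp: le_fun_def intro: order_trans)
    have "m (- a) \<le> - p a"
      using mp p'(3) by (auto simp: le_fun_def intro: order_trans)
    then show "m a = p a"
      using neg[of a] \<open>m a \<le> p a\<close> by simp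
  qed
qed

text \<open>The subgradient is a linear functional below the one-sided directional derivative \<open>p\<close> at \<open>x\<close>.\<close>

lemma convex_subgradient:
  fixes b :: "'a::real_vector \<Rightarrow> real"
  assumes "convex_on UNIV b"
  obtains L where "linear L" "\<And>y. b x + L (y - x) \<le> b y"
proof -
  define d where "d v t = (b (x + t *\<^sub>R v) - b x) / t" for v and t :: real
  define p where "p v = (INF t\<in>{0<..}. d v t)" for v
  have cv: "b ((s / (s + t)) *\<^sub>R y + (t / (s + t)) *\<^sub>R z) \<le> (s / (s + t)) * b y + (t / (s + t)) * b z"
    if "s > 0" "t > 0" for s t y z
  proof -
    have "1 - t / (s + t) = s / (s + t)" using that by (simp add: field_simps)
    then show ?thesis
      using convex_onD[OF assms, of "t / (s + t)" y z] that by simp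
  qed
  \<comment> \<open>The step \<open>s * t / (s + t)\<close> makes
    \<open>x + (s * t / (s + t)) (v + w)\<close> a convex combination of \<open>x + t v\<close> and
    \<open>x + s w\<close>, with weights \<open>s / (s + t)\<close> and \<open>t / (s + t)\<close>.
    For \<open>w = -v\<close> the estimate bounds the difference quotients from below; in general it
    is the subadditivity of \<open>p\<close>.\<close>
  have two: "0 \<le> d v t + d w s - (b (x + ((s * t) / (s + t)) *\<^sub>R (v + w)) - b x) * ((s + t) / (s * t))"
    if st: "s > 0" "t > 0" for s t v w
  proof -
    have "b (x + ((s * t) / (s + t)) *\<^sub>R (v + w)) =
        b ((s / (s + t)) *\<^sub>R (x + t *\<^sub>R v) + (t / (s + t)) *\<^sub>R (x + s *\<^sub>R w))"
    proof -
      define a c where "a = s / (s + t)" and "c = t / (s + t)"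
      have eq: "a + c = 1" "(s * t) / (s + t) = a * t" "(s * t) / (s + t) = c * s"
        using st by (simp_all add: a_def c_def add_divide_distrib[symmetric])
      have "a *\<^sub>R (x + t *\<^sub>R v) + c *\<^sub>R (x + s *\<^sub>R w) = (a + c) *\<^sub>R x + ((a * t) *\<^sub>R v + (c * s) *\<^sub>R w)"
        by (simp add: scaleR_add_right scaleR_add_left)
      also have "\<dots> = x + ((s * t) / (s + t)) *\<^sub>R (v + w)"
        by (simp only: eq(1) eq(2)[symmetric] eq(3)[symmetric] scaleR_add_right scaleR_one)
      finally show ?thesis by (simp only: a_def c_def)
    qed
    also have "\<dots> \<le> (s / (s + t)) * b (x + t *\<^sub>R v) + (t / (s + t)) * b (x + s *\<^sub>R w)"
      by (rule cv) (use st in auto)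
    finally have "(b (x + ((s * t) / (s + t)) *\<^sub>R (v + w)) - b x) * ((s + t) / (s * t))
       \<le> ((s / (s + t)) * b (x + t *\<^sub>R v) + (t / (s + t)) * b (x + s *\<^sub>R w) - b x) * ((s + t) / (s * t))"
      using st by (intro mult_right_mono) auto
    also have "\<dots> = d v t + d w s"
      using st unfolding d_def by (simp add: divide_simps) (simp add: algebra_simps)
    finally show ?thesis by simp
  qed
  have bdd: "bdd_below (d v ` {0<..})" for v
  proof (rule bdd_belowI2[where m = "- d (- v) 1"])
    fix t :: real assume "t \<in> {0<..}"
    then show "- d (- v) 1 \<le> d v t" using two[of 1 t v "-v"] by simp
  qed
  have le: "p v \<le> d v t" if "t > 0" for v t
    unfolding p_def by (rule cINF_lower[OF bdd]) (use that in auto)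
  have ge: "c \<le> p v" if "\<And>t. t > 0 \<Longrightarrow> c \<le> d v t" for c v
    unfolding p_def by (rule cINF_greatest) (use that in auto)
  have "sublinear p"
  proof (rule sublinearI)
    fix v w
    have *: "p (v + w) - d w s \<le> d v t" if "s > 0" "t > 0" for s t
      using le[of "(s * t) / (s + t)" "v + w"] two[OF that, of v w] that by (simp add: d_def)
    have "p (v + w) - d w s \<le> p v" if "s > 0" for s
      using ge *[OF that] by blast
    then have "p (v + w) - p v \<le> d w s" if "s > 0" for s
      using that by (smt (verit))
    then have "p (v + w) - p v \<le> p w" using ge by blast
    then show "p (v + w) \<le> p v + p w" by simp
  next
    fix c :: real and v assume c: "c > 0"
    have "p (c *\<^sub>R v) / c \<le> d v t" if "t > 0" for t
      using le[of "t / c" "c *\<^sub>R v"] that c by (simp add: d_def field_simps)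
    then have "p (c *\<^sub>R v) / c \<le> p v" using ge by blast
    then show "p (c *\<^sub>R v) \<le> c * p v" using c by (simp add: field_simps)
  qed
  then obtain L where L: "linear L" "\<And>v. L v \<le> p v" using hahn_banach_dominated by blast
  have "b x + L (y - x) \<le> b y" for y
    using L(2)[of "y - x"] le[of 1 "y - x"] by (simp add: d_def)
  with L(1) show ?thesis using that by blast
qed

lemma blinfun_of_linear:
  fixes L :: "'a::real_normed_vector \<Rightarrow> real"
  assumes "linear L" "\<And>v. L v \<le> R * norm v" "0 \<le> R"
  obtains l :: "'a \<Rightarrow>\<^sub>L real" where "blinfun_apply l = L" "norm l \<le> R"
proof -
  have abs: "norm (L v) \<le> norm v * R" for v
    using assms(2)[of v] assms(2)[of "-v"] linear_neg[OF assms(1), of v] by (simp add: mult.commute)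
  have bl: "bounded_linear L"
    using assms(1) abs by (intro bounded_linear_intro[where K = R]) (auto simp: linear_add linear_scale)
  show ?thesis
    by (rule that[of "Blinfun L"])
      (use bl abs assms(3) in \<open>auto simp: bounded_linear_Blinfun_apply mult.commute intro!: norm_blinfun_bound\<close>)
qed

section \<open>The dual of a reflexive space\<close>

lemma infdist_less_obtain:
  assumes "S \<noteq> {}" "infdist x S < c"
  obtains u where "u \<in> S" "dist x u < c"
  using cInf_lessD[of "dist x ` S" c] assms by (auto simp: infdist_def)

lemma convex_on_infdist:
  fixes S :: "'a::real_normed_vector set"
  assumes "convex S" "S \<noteq> {}"
  shows "convex_on UNIV (\<lambda>x. infdist x S)"
proof (rule convex_onI)
  fix t :: real and x y :: 'a assume t: "0 < t" "t < 1"
  show "infdist ((1 - t) *\<^sub>R x + t *\<^sub>R y) S \<le> (1 - t) * infdist x S + t * infdist y S"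
  proof (rule field_le_epsilon)
    fix e :: real assume e: "0 < e"
    obtain u where u: "u \<in> S" "dist x u < infdist x S + e"
      using infdist_less_obtain[OF assms(2), of x "infdist x S + e"] e by auto
    obtain v where v: "v \<in> S" "dist y v < infdist y S + e"
      using infdist_less_obtain[OF assms(2), of y "infdist y S + e"] e by auto
    have "(1 - t) *\<^sub>R u + t *\<^sub>R v \<in> S"
      using assms(1) u v t by (simp add: convexD)
    then have "infdist ((1 - t) *\<^sub>R x + t *\<^sub>R y) S \<le> dist ((1 - t) *\<^sub>R x + t *\<^sub>R y) ((1 - t) *\<^sub>R u + t *\<^sub>R v)"
      by (rule infdist_le)
    also have "\<dots> = norm ((1 - t) *\<^sub>R (x - u) + t *\<^sub>R (y - v))"
      by (simp add: dist_norm algebra_simps)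
    also have "\<dots> \<le> (1 - t) * dist x u + t * dist y v"
      using t norm_triangle_ineq[of "(1 - t) *\<^sub>R (x - u)" "t *\<^sub>R (y - v)"] by (simp add: dist_norm)
    also have "\<dots> \<le> (1 - t) * (infdist x S + e) + t * (infdist y S + e)"
      using t u v by (intro add_mono mult_left_mono) auto
    also have "\<dots> = (1 - t) * infdist x S + t * infdist y S + e"
      by (simp add: algebra_simps)
    finally show "infdist ((1 - t) *\<^sub>R x + t *\<^sub>R y) S \<le> (1 - t) * infdist x S + t * infdist y S + e" .
  qed
qed simp

lemma lipschitz_convex_subgradient:
  fixes b :: "'a::real_normed_vector \<Rightarrow> real"
  assumes "convex_on UNIV b" and lip: "\<And>x y. b x - b y \<le> R * norm (x - y)" and "0 \<le> R"
  obtains z :: "'a \<Rightarrow>\<^sub>L real" where "norm z \<le> R" "\<And>y. b x + blinfun_apply z (y - x) \<le> b y"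
proof -
  obtain L where L: "linear L" "\<And>y. b x + L (y - x) \<le> b y"
    using convex_subgradient[OF assms(1)] by blast
  have "L v \<le> R * norm v" for v
    using L(2)[of "x + v"] lip[of "x + v" x] by simp
  then obtain z :: "'a \<Rightarrow>\<^sub>L real" where "blinfun_apply z = L" "norm z \<le> R"
    using blinfun_of_linear[OF L(1) _ assms(3)] by blast
  then show ?thesis using that L(2) by auto
qed

text \<open>The separating functional is a subgradient at \<open>z0\<close> of the distance to
  \<open>S\<close>, which is convex, 1-Lipschitz and positive at \<open>z0\<close>. It lives in the
  bidual, and reflexivity makes it evaluation at a point of the space.\<close>

lemma reflexive_separation:
  fixes S :: "('a::real_normed_vector \<Rightarrow>\<^sub>L real) set"
  assumes "reflexive_space TYPE('a)" "convex S" "z0 \<notin> closure S"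
  obtains x c where "\<And>z. z \<in> S \<Longrightarrow> blinfun_apply z x \<le> c" "c < blinfun_apply z0 x"
proof (cases "S = {}")
  case True
  then show ?thesis using that[of 0 "-1"] by simp
next
  case False
  have lip: "infdist z S - infdist z' S \<le> 1 * norm (z - z')" for z z'
    using infdist_triangle[of z S z'] by (simp add: dist_norm)
  obtain \<Phi> :: "('a \<Rightarrow>\<^sub>L real) \<Rightarrow>\<^sub>L real"
    where \<Phi>: "\<And>z. infdist z0 S + blinfun_apply \<Phi> (z - z0) \<le> infdist z S"
    using lipschitz_convex_subgradient[OF convex_on_infdist[OF assms(2) False] lip, of z0] by auto
  obtain x where x: "\<And>z. blinfun_apply \<Phi> z = blinfun_apply z x"
    using assms(1) unfolding reflexive_space_def by blast
  have pos: "infdist z0 S > 0"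
    using assms(3) False by (simp add: in_closure_iff_infdist_zero infdist_nonneg order_less_le)
  show ?thesis
  proof
    fix z assume "z \<in> S"
    then show "blinfun_apply z x \<le> blinfun_apply z0 x - infdist z0 S"
      using \<Phi>[of z] by (simp add: x blinfun.diff_left)
  qed (use pos in simp)
qed

text \<open>Weak compactness obtained from Hahn-Banach rather than from a topology: the infimum
  \<open>p\<close> of the decreasing support functions is sublinear, and a linear functional below
  \<open>p\<close> respects the support function of every \<open>S n\<close>, so
  \<open>reflexive_separation\<close> keeps it in every closure.\<close>

lemma reflexive_nested_convex:
  fixes S :: "nat \<Rightarrow> ('a::real_normed_vector \<Rightarrow>\<^sub>L real) set"
  assumes refl: "reflexive_space TYPE('a)"
    and S: "\<And>n. convex (S n)" "\<And>n. S n \<noteq> {}" "\<And>n. S (Suc n) \<subseteq> S n"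
    and bd: "\<And>z. z \<in> S 0 \<Longrightarrow> norm z \<le> R"
  obtains z where "\<And>n. z \<in> closure (S n)"
proof -
  have dec: "S m \<subseteq> S n" if "n \<le> m" for m n
    using S(3) lift_Suc_antimono_le[of S n m] that by auto
  have bdn: "norm z \<le> R" if "z \<in> S n" for z n
    using bd dec[of 0 n] that by auto
  have R0: "R \<ge> 0" using S(2)[of 0] bd norm_ge_zero order_trans by blast
  have app: "\<bar>blinfun_apply z v\<bar> \<le> R * norm v" if "z \<in> S n" for z n v
    using norm_blinfun[of z v] mult_right_mono[OF bdn[OF that] norm_ge_zero[of v]] by simp
  define s where "s n v = (SUP z\<in>S n. blinfun_apply z v)" for n v
  define p where "p v = (INF n. s n v)" for v
  have bdd: "bdd_above ((\<lambda>z. blinfun_apply z v) ` S n)" for n v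
    by (rule bdd_aboveI2[where M = "R * norm v"]) (use app abs_le_D1 in blast)
  have s_ge: "blinfun_apply z v \<le> s n v" if "z \<in> S n" for z n v
    unfolding s_def by (rule cSUP_upper[OF that bdd])
  have s_le: "s n v \<le> c" if "\<And>z. z \<in> S n \<Longrightarrow> blinfun_apply z v \<le> c" for n v c
    unfolding s_def by (rule cSUP_least[OF S(2) that])
  have s_bd: "\<bar>s n v\<bar> \<le> R * norm v" for n v
  proof -
    obtain z where "z \<in> S n" using S(2) by blast
    then have "- (R * norm v) \<le> s n v"
      using s_ge[of z n v] app[of z n v] by linarith
    moreover have "s n v \<le> R * norm v"
      by (rule s_le) (use app abs_le_D1 in blast)
    ultimately show ?thesis by simp
  qed
  have s_dec: "s m v \<le> s n v" if "n \<le> m" for n m v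
    by (rule s_le) (use s_ge dec[OF that] in blast)
  have bddp: "bdd_below (range (\<lambda>n. s n v))" for v
    by (rule bdd_belowI2[where m = "- (R * norm v)"]) (use s_bd abs_le_iff in \<open>simp add: abs_le_iff minus_le_iff\<close>)
  have p_le: "p v \<le> s n v" for n v
    unfolding p_def by (rule cINF_lower[OF bddp]) simp
  have p_ge: "c \<le> p v" if "\<And>n. c \<le> s n v" for c v
    unfolding p_def by (rule cINF_greatest) (use that in auto)
  have "sublinear p"
  proof (rule sublinearI)
    fix x y
    have "p (x + y) - s m y \<le> s n x" for n m
    proof -
      have "s (max n m) (x + y) \<le> s (max n m) x + s (max n m) y"
        by (rule s_le) (auto simp: blinfun.add_right intro!: add_mono s_ge)
      then show ?thesis
        using p_le[of "x + y" "max n m"] s_dec[of n "max n m" x] s_dec[of m "max n m" y] by simp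
    qed
    then have "p (x + y) - s m y \<le> p x" for m using p_ge by blast
    then have "p (x + y) - p x \<le> s m y" for m by (smt (verit))
    then have "p (x + y) - p x \<le> p y" using p_ge by blast
    then show "p (x + y) \<le> p x + p y" by simp
  next
    fix c :: real and x assume c: "c > 0"
    have "p (c *\<^sub>R x) / c \<le> s n x" for n
    proof -
      have "s n (c *\<^sub>R x) \<le> c * s n x"
        by (rule s_le) (use c in \<open>auto simp: blinfun.scaleR_right intro!: s_ge\<close>)
      then show ?thesis using p_le[of "c *\<^sub>R x" n] c by (simp add: field_simps)
    qed
    then have "p (c *\<^sub>R x) / c \<le> p x" using p_ge by blast
    then show "p (c *\<^sub>R x) \<le> c * p x" using c by (simp add: field_simps)
  qed
  then obtain L where L: "linear L" "\<And>v. L v \<le> p v" using hahn_banach_dominated by blast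
  have "L v \<le> R * norm v" for v
    using L(2)[of v] p_le[of v 0] s_bd[of 0 v] by simp
  then obtain z :: "'a \<Rightarrow>\<^sub>L real" where z: "blinfun_apply z = L"
    using blinfun_of_linear[OF L(1) _ R0] by blast
  have "z \<in> closure (S n)" for n
  proof (rule ccontr)
    assume "z \<notin> closure (S n)"
    then obtain x c where "\<And>z. z \<in> S n \<Longrightarrow> blinfun_apply z x \<le> c" "c < blinfun_apply z x"
      using reflexive_separation[OF refl S(1)[of n]] by blast
    then show False using s_le[of n x c] L(2)[of x] p_le[of x n] by (simp add: z)
  qed
  then show ?thesis using that by blast
qed

text \<open>A substitute for a weak cluster point of \<open>u\<close>, since closed convex sets are
  weakly closed. By \<open>tail_hull_limit\<close> it has the right value at every vector where
  \<open>u\<close> converges.\<close>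

lemma reflexive_tail_hull:
  fixes u :: "nat \<Rightarrow> ('a::real_normed_vector \<Rightarrow>\<^sub>L real)"
  assumes "reflexive_space TYPE('a)" "\<And>n. norm (u n) \<le> R"
  obtains z where "\<And>n. z \<in> closure (convex hull (u ` {n..}))"
proof -
  have "convex hull (u ` {0..}) \<subseteq> cball 0 R"
    by (rule hull_minimal) (use assms in auto)
  then have bd: "norm z \<le> R" if "z \<in> convex hull (u ` {0..})" for z
    using that by (auto simp: subset_iff)
  have dec: "convex hull (u ` {Suc n..}) \<subseteq> convex hull (u ` {n..})" for n
    by (intro hull_mono image_mono) auto
  show ?thesis
  proof (rule reflexive_nested_convex[OF assms(1), of "\<lambda>n. convex hull (u ` {n..})" R])
    fix z assume "\<And>n. z \<in> closure (convex hull (u ` {n..}))"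
    then show thesis by (rule that)
  qed (use bd dec in \<open>auto simp: convex_hull_eq_empty\<close>)
qed

text \<open>The functionals whose value at \<open>v\<close> is within \<open>e\<close> of
  \<open>a\<close> form a closed convex slab, which contains a tail of \<open>u\<close> and
  therefore the closed hull of that tail.\<close>

lemma tail_hull_limit:
  assumes "\<And>n. z \<in> closure (convex hull (u ` {n..}))" "(\<lambda>n. blinfun_apply (u n) v) \<longlonglongrightarrow> (a::real)"
  shows "blinfun_apply z v = a"
proof -
  have "dist (blinfun_apply z v) a \<le> e" if "e > 0" for e
  proof -
    obtain N where N: "\<And>n. n \<ge> N \<Longrightarrow> dist (blinfun_apply (u n) v) a < e"
      using assms(2) \<open>e > 0\<close> unfolding lim_sequentially by blast
    have cl: "closed ((\<lambda>z. blinfun_apply z v) -` cball a e)"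
      by (intro continuous_closed_vimage) (auto intro!: continuous_intros)
    have "convex ((\<lambda>z. blinfun_apply z v) -` cball a e)"
      by (intro convex_linear_vimage) (auto intro!: linearI simp: blinfun.add_left blinfun.scaleR_left)
    then have "convex hull (u ` {N..}) \<subseteq> (\<lambda>z. blinfun_apply z v) -` cball a e"
      by (intro hull_minimal) (use N in \<open>auto simp: dist_commute less_imp_le\<close>)
    then have "closure (convex hull (u ` {N..})) \<subseteq> (\<lambda>z. blinfun_apply z v) -` cball a e"
      using cl by (rule closure_minimal)
    then show ?thesis using assms(1)[of N] by (auto simp: dist_commute)
  qed
  then have "dist (blinfun_apply z v) a \<le> 0" by (rule field_le_epsilon[of _ 0, simplified]) 
  then show ?thesis by simp
qed

lemma convex_hull_incseq:
  fixes A :: "nat \<Rightarrow> 'a::real_vector set"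
  assumes "incseq A"
  shows "convex hull (\<Union>n. A n) = (\<Union>n. convex hull (A n))"
proof
  show "convex hull (\<Union>n. A n) \<subseteq> (\<Union>n. convex hull (A n))"
  proof (rule hull_minimal)
    show "convex (\<Union>n. convex hull (A n))"
    proof (rule convexI)
      fix x y and u v :: real
      assume xy: "x \<in> (\<Union>n. convex hull (A n))" "y \<in> (\<Union>n. convex hull (A n))"
        and uv: "0 \<le> u" "0 \<le> v" "u + v = 1"
      then obtain m n where "x \<in> convex hull (A m)" "y \<in> convex hull (A n)" by blast
      moreover have "A m \<subseteq> A (max m n)" "A n \<subseteq> A (max m n)"
        using assms by (auto simp: incseq_def le_fun_def)
      ultimately have "x \<in> convex hull (A (max m n))" "y \<in> convex hull (A (max m n))"
        by (meson hull_mono subsetD)+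
      then have "u *\<^sub>R x + v *\<^sub>R y \<in> convex hull (A (max m n))"
        using uv by (simp add: convexD)
      then show "u *\<^sub>R x + v *\<^sub>R y \<in> (\<Union>n. convex hull (A n))" by blast
    qed
  qed (auto intro: hull_inc)
qed (auto intro: hull_mono[THEN subsetD])

lemma finite_hull_net:
  fixes A :: "'a::real_normed_vector set"
  assumes "finite A" "e > 0"
  obtains F where "finite F" "F \<subseteq> convex hull A" "\<And>z. z \<in> convex hull A \<Longrightarrow> \<exists>y\<in>F. dist z y < e"
proof -
  have "compact (convex hull A)" by (rule finite_imp_compact_convex_hull[OF assms(1)])
  moreover have "convex hull A \<subseteq> (\<Union>x\<in>convex hull A. ball x e)" using assms(2) by auto
  ultimately obtain F where "finite F" "F \<subseteq> convex hull A" "convex hull A \<subseteq> (\<Union>x\<in>F. ball x e)"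
    by (elim compactE_image) auto
  then show ?thesis by (intro that[of F]) (fastforce simp: dist_commute)+
qed

lemma norming_point:
  fixes z :: "'a::real_normed_vector \<Rightarrow>\<^sub>L real"
  obtains s where "norm s \<le> 1" "norm z \<le> 2 * blinfun_apply z s"
proof (cases "z = 0")
  case True
  then show ?thesis using that[of 0] by simp
next
  case False
  have "\<not> (\<forall>x. \<bar>blinfun_apply z x\<bar> \<le> (norm z / 2) * norm x)"
  proof
    assume "\<forall>x. \<bar>blinfun_apply z x\<bar> \<le> (norm z / 2) * norm x"
    then have "norm z \<le> norm z / 2" by (intro norm_blinfun_bound) (auto simp: mult.commute)
    then show False using False by simp
  qed
  then obtain x where x: "\<bar>blinfun_apply z x\<bar> > (norm z / 2) * norm x" by (auto simp: not_le)
  then have x0: "norm x > 0" by auto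
  define s where "s = (sgn (blinfun_apply z x) / norm x) *\<^sub>R x"
  have "blinfun_apply z s = \<bar>blinfun_apply z x\<bar> / norm x"
    by (simp add: s_def blinfun.scaleR_right abs_sgn mult.commute)
  moreover from calculation have "norm z / 2 < \<bar>blinfun_apply z x\<bar> / norm x" using x x0 by (simp add: pos_less_divide_eq)
  ultimately have "norm z \<le> 2 * blinfun_apply z s" by linarith
  moreover have "norm s \<le> 1" using x0 by (simp add: s_def abs_sgn_eq)
  ultimately show ?thesis using that by blast
qed

theorem reflexive_weak_star_subsequence:
  fixes u :: "nat \<Rightarrow> ('a::real_normed_vector \<Rightarrow>\<^sub>L real)"
  assumes refl: "reflexive_space TYPE('a)" and bd: "\<And>n. norm (u n) \<le> R"
  obtains r z where "strict_mono r" "\<And>v. (\<lambda>n. blinfun_apply (u (r n)) v) \<longlonglongrightarrow> blinfun_apply z v"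
proof -
  let ?Z = "closure (convex hull (range u))"
  have "\<exists>F. finite F \<and> (\<forall>z\<in>convex hull (u ` {..n}). \<exists>y\<in>F. dist z y < 1 / real (Suc n))" for n
    by (rule finite_hull_net[of "u ` {..n}" "1 / real (Suc n)"]) auto
  then obtain F where F: "\<And>n. finite (F n)"
    "\<And>n z. z \<in> convex hull (u ` {..n}) \<Longrightarrow> \<exists>y\<in>F n. dist z y < 1 / real (Suc n)"
    by metis
  define E where "E = (\<Union>n. F n)"
  have cE: "countable E" using F(1) by (auto simp: E_def countable_finite)
  have dense: "\<exists>y\<in>E. dist z y < e" if z: "z \<in> ?Z" and e: "e > 0" for z e
  proof -
    obtain z' where z': "z' \<in> convex hull (range u)" "dist z z' < e / 2"
      using z e by (metis closure_approachable dist_commute half_gt_zero)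
    have "range u = (\<Union>n. u ` {..n})" by auto
    moreover have "incseq (\<lambda>n. u ` {..n})" by (auto simp: incseq_def)
    ultimately obtain m where m: "z' \<in> convex hull (u ` {..m})"
      using z'(1) convex_hull_incseq[of "\<lambda>n. u ` {..n}"] by auto
    obtain n0 where "1 / real (Suc n0) < e / 2" using e nat_approx_posE[of "e / 2"] by auto
    define n where "n = max m n0"
    have "z' \<in> convex hull (u ` {..n})"
      using m hull_mono[of "u ` {..m}" "u ` {..n}" convex] by (auto simp: n_def image_subset_iff)
    then obtain y where y: "y \<in> F n" "dist z' y < 1 / real (Suc n)" using F(2) by blast
    have "1 / real (Suc n) \<le> 1 / real (Suc n0)" by (intro divide_left_mono) (auto simp: n_def)
    then have "dist z y < e"
      using dist_triangle[of z y z'] y z' \<open>1 / real (Suc n0) < e / 2\<close> by simp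
    then show ?thesis using y by (auto simp: E_def)
  qed
  have "\<exists>x. norm x \<le> 1 \<and> norm w \<le> 2 * blinfun_apply w x" for w :: "'a \<Rightarrow>\<^sub>L real"
    by (rule norming_point[of w]) blast
  then obtain \<sigma> :: "('a \<Rightarrow>\<^sub>L real) \<Rightarrow> 'a"
    where \<sigma>: "\<And>w. norm (\<sigma> w) \<le> 1 \<and> norm w \<le> 2 * blinfun_apply w (\<sigma> w)"
    by metis
  define s where "s z z' = \<sigma> (z - z')" for z z'
  have s: "norm (s z z') \<le> 1" "norm (z - z') \<le> 2 * blinfun_apply (z - z') (s z z')" for z z'
    using \<sigma> by (simp_all add: s_def)
  \<comment> \<open>The budget \<open>e\<close> consists of two approximations below
    \<open>e / 6\<close> and of \<open>|y - y'| < 2 * e / 3\<close>: the norming vector sees at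
    least half of the norm, and its value is below \<open>e / 3\<close>.\<close>
  have sep: "z = z'" if z: "z \<in> ?Z" "z' \<in> ?Z"
    and eq: "\<And>y y'. y \<in> E \<Longrightarrow> y' \<in> E \<Longrightarrow> blinfun_apply z (s y y') = blinfun_apply z' (s y y')" for z z'
  proof -
    have "norm (z - z') \<le> e" if "e > 0" for e
    proof -
      have e6: "e / 6 > 0" using that by simp
      obtain y y' where y: "y \<in> E" "dist z y < e / 6" "y' \<in> E" "dist z' y' < e / 6"
        using dense[OF z(1) e6] dense[OF z(2) e6] by blast
      let ?s = "s y y'"
      have a: "\<bar>blinfun_apply w ?s\<bar> \<le> norm w" for w :: "'a \<Rightarrow>\<^sub>L real"
        using norm_blinfun[of w ?s] mult_left_mono[OF s(1)[of y y'], of "norm w"] by simp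
      have "blinfun_apply (y - y') ?s = blinfun_apply (y - z) ?s + blinfun_apply (z' - y') ?s"
        using eq[OF y(1,3)] by (simp add: blinfun.diff_left)
      also have "\<dots> \<le> norm (y - z) + norm (z' - y')"
        using a[of "y - z"] a[of "z' - y'"] by simp
      also have "\<dots> < e / 3" using y by (simp add: dist_norm norm_minus_commute)
      finally have "norm (y - y') < 2 * e / 3" using s(2)[of y y'] by simp
      moreover have "norm (z - z') \<le> norm (z - y) + norm (y - y') + norm (y' - z')"
        using norm_triangle_ineq[of "z - y" "y - z'"] norm_triangle_ineq[of "y - y'" "y' - z'"] by simp
      ultimately show ?thesis using y by (simp add: dist_norm norm_minus_commute)
    qed
    then have "norm (z - z') \<le> 0" using field_le_epsilon[of "norm (z - z')" 0] by simp
    then show ?thesis by simp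
  qed
  define A where "A n = (\<lambda>(y, y'). s y y') (from_nat_into (E \<times> E) n)" for n
  have A: "\<exists>n. s y y' = A n" if y: "y \<in> E" "y' \<in> E" for y y'
  proof -
    obtain n where "from_nat_into (E \<times> E) n = (y, y')"
      using from_nat_into_surj[of "E \<times> E" "(y, y')"] cE y by auto
    then show ?thesis by (metis A_def case_prod_conv)
  qed
  have bdv: "bounded (range (\<lambda>n. blinfun_apply (u (t n)) v))" for t :: "nat \<Rightarrow> nat" and v
  proof (rule boundedI[where B = "R * norm v"])
    fix y assume "y \<in> range (\<lambda>n. blinfun_apply (u (t n)) v)"
    then obtain n where "y = blinfun_apply (u (t n)) v" by blast
    then show "norm y \<le> R * norm v"
      using norm_blinfun[of "u (t n)" v] mult_right_mono[OF bd[of "t n"] norm_ge_zero[of v]] by simp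
  qed
  interpret D: subseqs "\<lambda>n t. convergent (\<lambda>k. blinfun_apply (u (t k)) (A n))"
  proof
    fix n and t :: "nat \<Rightarrow> nat" assume "strict_mono t"
    obtain l r' where "strict_mono r'" "((\<lambda>k. blinfun_apply (u (t k)) (A n)) \<circ> r') \<longlonglongrightarrow> l"
      using bounded_imp_convergent_subsequence[OF bdv[of t "A n"]] by blast
    then show "\<exists>r'. strict_mono r' \<and> convergent (\<lambda>k. blinfun_apply (u ((t \<circ> r') k)) (A n))"
      by (auto simp: convergent_def o_def)
  qed
  define r where "r = D.diagseq"
  have r: "strict_mono r" unfolding r_def by (rule D.subseq_diagseq)
  have conv: "convergent (\<lambda>k. blinfun_apply (u (r k)) (A n))" for n
  proof -
    have "convergent (\<lambda>k. blinfun_apply (u ((D.diagseq \<circ> (+) (Suc n)) k)) (A n))"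
    proof (rule D.diagseq_holds)
      fix t s' :: "nat \<Rightarrow> nat" and m
      assume "strict_mono t" "convergent (\<lambda>k. blinfun_apply (u (s' k)) (A m))"
      then show "convergent (\<lambda>k. blinfun_apply (u ((s' \<circ> t) k)) (A m))"
        using convergent_subseq_convergent by (fastforce simp: o_def)
    qed
    then show ?thesis
      unfolding r_def o_def using convergent_ignore_initial_segment[of "\<lambda>k. blinfun_apply (u (D.diagseq k)) (A n)" "Suc n"]
      by (simp add: add.commute)
  qed
  have inZ: "z \<in> ?Z" if "\<And>n. z \<in> closure (convex hull ((\<lambda>k. u (t k)) ` {n..}))" for z and t :: "nat \<Rightarrow> nat"
    using that[of 0] closure_mono[OF hull_mono[of "(\<lambda>k. u (t k)) ` {0..}" "range u"]] by auto
  obtain z where z: "\<And>n. z \<in> closure (convex hull ((\<lambda>k. u (r k)) ` {n..}))"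
    using reflexive_tail_hull[OF refl, of "\<lambda>k. u (r k)" R] bd by auto
  have "(\<lambda>n. blinfun_apply (u (r n)) v) \<longlonglongrightarrow> blinfun_apply z v" for v
  proof (rule ccontr)
    assume "\<not> ?thesis"
    \<comment> \<open>If convergence fails at \<open>v\<close>, a further subsequence stays away
      from the value of \<open>z\<close> there and converges to some \<open>l\<close>. Its own tail
      hulls give a \<open>z'\<close> that agrees with \<open>z\<close> on all norming vectors but
      has the value \<open>l\<close> at \<open>v\<close>.\<close>
    then obtain e where e: "e > 0" "\<And>N. \<exists>n\<ge>N. \<not> dist (blinfun_apply (u (r n)) v) (blinfun_apply z v) < e"
      unfolding lim_sequentially by blast
    then have inf: "infinite {n. \<not> dist (blinfun_apply (u (r n)) v) (blinfun_apply z v) < e}"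
      unfolding infinite_nat_iff_unbounded_le by auto
    obtain t :: "nat \<Rightarrow> nat" where t: "strict_mono t"
      "\<And>n. \<not> dist (blinfun_apply (u (r (t n))) v) (blinfun_apply z v) < e"
      using infinite_enumerate[OF inf] by auto
    obtain l t' where t': "strict_mono t'" "((\<lambda>k. blinfun_apply (u (r (t k))) v) \<circ> t') \<longlonglongrightarrow> l"
      using bounded_imp_convergent_subsequence[OF bdv[of "r \<circ> t" v]] by (auto simp: o_def)
    have lim: "(\<lambda>k. blinfun_apply (u (r (t (t' k)))) v) \<longlonglongrightarrow> l" using t'(2) by (simp add: o_def)
    obtain z' where z': "\<And>n. z' \<in> closure (convex hull ((\<lambda>k. u (r (t (t' k)))) ` {n..}))"
      using reflexive_tail_hull[OF refl, of "\<lambda>k. u (r (t (t' k)))" R] bd by auto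
    have "z = z'"
    proof (rule sep)
      show "z \<in> ?Z" by (rule inZ[OF z])
      show "z' \<in> ?Z" by (rule inZ[of _ "\<lambda>k. r (t (t' k))", OF z'])
      fix y y' assume "y \<in> E" "y' \<in> E"
      then obtain n where n: "s y y' = A n" using A by blast
      obtain a where a: "(\<lambda>k. blinfun_apply (u (r k)) (A n)) \<longlonglongrightarrow> a"
        using conv[of n] by (auto simp: convergent_def)
      have "(\<lambda>k. blinfun_apply (u (r (t (t' k)))) (A n)) \<longlonglongrightarrow> a"
        using LIMSEQ_subseq_LIMSEQ[OF a strict_mono_o[OF t(1) t'(1)]] by (simp add: o_def)
      then show "blinfun_apply z (s y y') = blinfun_apply z' (s y y')"
        using tail_hull_limit[OF z a] tail_hull_limit[OF z'] n by simp
    qed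
    then have "blinfun_apply z v = l" using tail_hull_limit[OF z' lim] by simp
    then have "\<exists>k. dist (blinfun_apply (u (r (t (t' k)))) v) (blinfun_apply z v) < e"
      using lim e(1) unfolding lim_sequentially by blast
    then show False using t(2) by blast
  qed
  with r show ?thesis using that by blast
qed

text \<open>The hypothesis \<open>min\<close> says that \<open>x\<close> minimizes \<open>d\<close>
  plus the sublinear \<open>N\<close> moved to \<open>x\<close>. The function \<open>p\<close> is an
  infimal convolution coupling the two, and one subgradient of it at 0 serves both:
  \<open>w = y - x\<close> gives the inequality for \<open>d\<close>, and the choice
  \<open>y = x\<close> in the infimum gives the norm bound.\<close>

lemma convex_sum_rule:
  fixes d :: "'a::real_normed_vector \<Rightarrow> real" and u :: "'a \<Rightarrow>\<^sub>L real"
  assumes conv: "convex_on UNIV d" and g0: "0 \<le> g"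
    and min: "\<And>y. d x \<le> d y + g * norm (y - x) + blinfun_apply u (y - x)"
  obtains v :: "'a \<Rightarrow>\<^sub>L real"
  where "\<And>y. d x + blinfun_apply v (y - x) \<le> d y" "norm (u + v) \<le> g"
proof -
  define N where "N w = g * norm w + blinfun_apply u w" for w
  have N_add: "N (v + w) \<le> N v + N w" for v w
    using mult_left_mono[OF norm_triangle_ineq[of v w] g0]
    by (simp add: N_def blinfun.add_right distrib_left)
  have N_scale: "N (t *\<^sub>R w) = t * N w" if "t \<ge> 0" for t w
    using that by (simp add: N_def blinfun.scaleR_right algebra_simps)
  define p where "p w = (INF y. d y - d x + N (y - x - w))" for w
  have low: "- N w \<le> d y - d x + N (y - x - w)" for w y
    using min[of y] N_add[of "y - x - w" w] by (simp add: N_def)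
  have p_le: "p w \<le> d y - d x + N (y - x - w)" for w y
    unfolding p_def by (rule cINF_lower) (use low in \<open>auto intro!: bdd_belowI2\<close>)
  have p_ge: "c \<le> p w" if "\<And>y. c \<le> d y - d x + N (y - x - w)" for c w
    unfolding p_def by (rule cINF_greatest) (use that in auto)
  have "convex_on UNIV p"
  proof (rule convex_onI)
    fix t :: real and v w :: 'a assume t: "0 < t" "t < 1"
    have main: "p ((1 - t) *\<^sub>R v + t *\<^sub>R w) \<le> (1 - t) * (d y - d x + N (y - x - v)) + t * (d y' - d x + N (y' - x - w))"
      for y y'
    proof -
      let ?y = "(1 - t) *\<^sub>R y + t *\<^sub>R y'"
      have "?y - x - ((1 - t) *\<^sub>R v + t *\<^sub>R w) = (1 - t) *\<^sub>R (y - x - v) + t *\<^sub>R (y' - x - w)"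
        by (simp add: algebra_simps)
      then have "N (?y - x - ((1 - t) *\<^sub>R v + t *\<^sub>R w)) \<le> (1 - t) * N (y - x - v) + t * N (y' - x - w)"
        using N_add[of "(1 - t) *\<^sub>R (y - x - v)" "t *\<^sub>R (y' - x - w)"] t by (simp add: N_scale)
      moreover have "d ?y \<le> (1 - t) * d y + t * d y'"
        using convex_onD[OF conv, of t y y'] t by simp
      ultimately show ?thesis
        using p_le[of "(1 - t) *\<^sub>R v + t *\<^sub>R w" ?y] by (simp add: algebra_simps)
    qed
    define q where "q = p ((1 - t) *\<^sub>R v + t *\<^sub>R w)"
    have *: "(q - (1 - t) * (d y - d x + N (y - x - v))) / t \<le> p w" for y
    proof (rule p_ge)
      fix y'
      show "(q - (1 - t) * (d y - d x + N (y - x - v))) / t \<le> d y' - d x + N (y' - x - w)"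
        using main[of y y'] t unfolding q_def[symmetric] by (subst pos_divide_le_eq) (auto simp: mult.commute)
    qed
    have "(q - t * p w) / (1 - t) \<le> d y - d x + N (y - x - v)" for y
    proof -
      have "q - (1 - t) * (d y - d x + N (y - x - v)) \<le> t * p w"
        using *[of y] t by (simp add: pos_divide_le_eq mult.commute)
      then show ?thesis using t by (subst pos_divide_le_eq) (auto simp: mult.commute)
    qed
    then have "(q - t * p w) / (1 - t) \<le> p v"
      by (rule p_ge)
    then have "q - t * p w \<le> (1 - t) * p v" using t by (simp add: pos_divide_le_eq mult.commute)
    then show "p ((1 - t) *\<^sub>R v + t *\<^sub>R w) \<le> (1 - t) * p v + t * p w"
      by (simp add: q_def)
  qed simp
  then obtain L where L: "linear L" "\<And>w. p 0 + L (w - 0) \<le> p w"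
    using convex_subgradient by blast
  have "0 \<le> p 0" by (rule p_ge) (use low[of 0] in \<open>simp add: N_def\<close>)
  then have Lp: "L w \<le> p w" for w using L(2)[of w] by simp
  have LN: "L w \<le> g * norm w - blinfun_apply u w" for w
    using Lp[of w] p_le[of w x] by (simp add: N_def blinfun.minus_right)
  have "L w \<le> (g + norm u) * norm w" for w
    using LN[of w] norm_blinfun[of u w] by (simp add: algebra_simps)
  then obtain v :: "'a \<Rightarrow>\<^sub>L real" where v: "blinfun_apply v = L"
    using blinfun_of_linear[OF L(1)] g0 by (metis add_nonneg_nonneg norm_ge_zero)
  show ?thesis
  proof
    show "d x + blinfun_apply v (y - x) \<le> d y" for y
      using Lp[of "y - x"] p_le[of "y - x" y] by (simp add: v N_def)
    show "norm (u + v) \<le> g"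
    proof (rule norm_blinfun_bound[OF g0])
      fix w
      show "norm (blinfun_apply (u + v) w) \<le> g * norm w"
        using LN[of w] LN[of "- w"] by (simp add: blinfun.add_left v blinfun.minus_right linear_neg[OF L(1)] abs_le_iff)
    qed
  qed
qed

section \<open>Smoothing by penalized conjugates\<close>

lemma norm_le_of_affine_bound:
  fixes z :: "'a::real_normed_vector \<Rightarrow>\<^sub>L real"
  assumes "0 \<le> A" "\<And>y. blinfun_apply z y \<le> A * norm y + B"
  shows "norm z \<le> A"
proof (rule norm_blinfun_bound[OF assms(1)])
  have *: "blinfun_apply z y \<le> A * norm y" for y
  proof (rule ccontr)
    define d where "d = blinfun_apply z y - A * norm y"
    assume "\<not> ?thesis"
    then have d: "d > 0" by (simp add: d_def)
    define t where "t = (\<bar>B\<bar> + 1) / d"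
    have t: "t > 0" "t * d > B" using d by (simp_all add: t_def)
    have "t * d \<le> B" using assms(2)[of "t *\<^sub>R y"] t(1) by (simp add: d_def blinfun.scaleR_right algebra_simps)
    then show False using t by simp
  qed
  show "norm (blinfun_apply z y) \<le> A * norm y" for y
    using *[of y] *[of "- y"] by (simp add: blinfun.minus_right abs_le_iff)
qed

text \<open>The pairs with \<open>\<beta>\<close> at most \<open>- b* z\<close>, that is, the
  hypograph of \<open>- b*\<close>. A free coordinate \<open>\<beta>\<close> avoids a conjugate with
  infinite values.\<close>

definition minorants :: "('a::real_normed_vector \<Rightarrow> real) \<Rightarrow> (('a \<Rightarrow>\<^sub>L real) \<times> real) set" where
  "minorants b = {(z, \<beta>). \<forall>y. blinfun_apply z y + \<beta> \<le> b y}"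

definition smoothing :: "('a::real_normed_vector \<Rightarrow> real) \<Rightarrow> (('a \<Rightarrow>\<^sub>L real) \<Rightarrow> real) \<Rightarrow> 'a \<Rightarrow> real" where
  "smoothing b H x = (SUP (z, \<beta>)\<in>minorants b. blinfun_apply z x + \<beta> - H z)"

definition near_max :: "('a::real_normed_vector \<Rightarrow> real) \<Rightarrow> (('a \<Rightarrow>\<^sub>L real) \<Rightarrow> real) \<Rightarrow> 'a \<Rightarrow> real \<Rightarrow> ('a \<Rightarrow>\<^sub>L real) set"
  where "near_max b H x e =
    {z. \<exists>\<beta>. (z, \<beta>) \<in> minorants b \<and> smoothing b H x - e \<le> blinfun_apply z x + \<beta> - H z}"

text \<open>\<open>smoothing b H\<close> is the convex conjugate of \<open>b* + H\<close>. Making \<open>H\<close> suitably strictly convex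
  makes it Frechet differentiable.\<close>

locale conjugate_smoothing =
  fixes b :: "'a::real_normed_vector \<Rightarrow> real" and R W :: real and H :: "('a \<Rightarrow>\<^sub>L real) \<Rightarrow> real"
  assumes convex_b: "convex_on UNIV b" and lip: "\<And>x y. b x - b y \<le> R * norm (x - y)" and R0: "0 \<le> R"
    and H_nonneg: "\<And>z. norm z \<le> R \<Longrightarrow> 0 \<le> H z" and H_le: "\<And>z. norm z \<le> R \<Longrightarrow> H z \<le> W"
begin

text \<open>All competitors in the supremum lie in the ball of radius \<open>R\<close>, which is why
  bounds, convexity and continuity of \<open>H\<close> are asked for only there.\<close>

lemma minorant_norm:
  assumes "(z, \<beta>) \<in> minorants b"
  shows "norm z \<le> R"
proof (rule norm_le_of_affine_bound[OF R0])
  show "blinfun_apply z y \<le> R * norm y + (b 0 - \<beta>)" for y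
    using assms lip[of y 0] by (auto simp: minorants_def dest: spec[of _ y])
qed

lemma minorant_at: "\<exists>z \<beta>. (z, \<beta>) \<in> minorants b \<and> blinfun_apply z x + \<beta> = b x"
proof -
  obtain z :: "'a \<Rightarrow>\<^sub>L real" where "\<And>y. b x + blinfun_apply z (y - x) \<le> b y"
    using lipschitz_convex_subgradient[OF convex_b lip R0] by blast
  then show ?thesis
    by (intro exI[of _ z] exI[of _ "b x - blinfun_apply z x"]) (auto simp: minorants_def blinfun.diff_right algebra_simps)
qed

lemma minorant_value:
  assumes "(z, \<beta>) \<in> minorants b"
  shows "blinfun_apply z x + \<beta> - H z \<le> b x"
  using H_nonneg[OF minorant_norm[OF assms]] assms by (auto simp: minorants_def dest: spec[of _ x])

lemma bdd_minorants: "bdd_above ((\<lambda>(z, \<beta>). blinfun_apply z x + \<beta> - H z) ` minorants b)"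
  by (rule bdd_aboveI2[where M = "b x"]) (use minorant_value in auto)

lemma minorants_nonempty: "minorants b \<noteq> {}"
  using minorant_at by blast

lemma smoothing_upper: "(z, \<beta>) \<in> minorants b \<Longrightarrow> blinfun_apply z x + \<beta> - H z \<le> smoothing b H x"
  unfolding smoothing_def using cSUP_upper[OF _ bdd_minorants, of "(z, \<beta>)" x] by simp

lemma smoothing_least:
  assumes "\<And>z \<beta>. (z, \<beta>) \<in> minorants b \<Longrightarrow> blinfun_apply z x + \<beta> - H z \<le> c"
  shows "smoothing b H x \<le> c"
  unfolding smoothing_def by (rule cSUP_least[OF minorants_nonempty]) (use assms in auto)

lemma smoothing_le: "smoothing b H x \<le> b x"
  by (rule smoothing_least) (rule minorant_value)

lemma smoothing_ge: "b x - W \<le> smoothing b H x"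
proof -
  obtain z \<beta> where z: "(z, \<beta>) \<in> minorants b" "blinfun_apply z x + \<beta> = b x"
    using minorant_at by blast
  then show ?thesis
    using smoothing_upper[OF z(1), of x] H_le[OF minorant_norm[OF z(1)]] by simp
qed

lemma minorant_lip:
  assumes "(z, \<beta>) \<in> minorants b"
  shows "blinfun_apply z v \<le> R * norm v"
  using norm_blinfun[of z v] mult_right_mono[OF minorant_norm[OF assms] norm_ge_zero[of v]] by simp

lemma smoothing_lip: "smoothing b H x - smoothing b H y \<le> R * norm (x - y)"
proof -
  have "smoothing b H x \<le> smoothing b H y + R * norm (x - y)"
  proof (rule smoothing_least)
    fix z \<beta> assume z: "(z, \<beta>) \<in> minorants b"
    show "blinfun_apply z x + \<beta> - H z \<le> smoothing b H y + R * norm (x - y)"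
      using smoothing_upper[OF z, of y] minorant_lip[OF z, of "x - y"] by (simp add: blinfun.diff_right)
  qed
  then show ?thesis by simp
qed

lemma smoothing_approx:
  assumes "e > 0"
  obtains z \<beta> where "(z, \<beta>) \<in> minorants b" "smoothing b H x - e \<le> blinfun_apply z x + \<beta> - H z"
proof -
  have "\<exists>z \<beta>. (z, \<beta>) \<in> minorants b \<and> smoothing b H x - e \<le> blinfun_apply z x + \<beta> - H z"
  proof (rule ccontr)
    assume "\<not> ?thesis"
    then have "smoothing b H x \<le> smoothing b H x - e"
      by (intro smoothing_least) force
    then show False using assms by simp
  qed
  then show ?thesis using that by blast
qed

lemma smoothing_mono:
  assumes "conjugate_smoothing b R W' H'" "\<And>z. norm z \<le> R \<Longrightarrow> H z \<le> H' z + w"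
  shows "smoothing b H' x - w \<le> smoothing b H x"
proof -
  interpret H': conjugate_smoothing b R W' H' by fact
  have "smoothing b H' x \<le> smoothing b H x + w"
  proof (rule H'.smoothing_least)
    fix z \<beta> assume z: "(z, \<beta>) \<in> minorants b"
    show "blinfun_apply z x + \<beta> - H' z \<le> smoothing b H x + w"
      using smoothing_upper[OF z, of x] assms(2)[OF minorant_norm[OF z]] by simp
  qed
  then show ?thesis by simp
qed

text \<open>The maximized quantity is concave in the pair \<open>(z, \<beta>)\<close>, so its
  superlevel sets in the convex set \<open>minorants b\<close> are convex, and so are their
  projections to \<open>z\<close>.\<close>

lemma convex_near_max:
  assumes "convex_on (cball 0 R) H"
  shows "convex (near_max b H x e)"
proof (rule convexI)
  fix z z' and s t :: real
  assume zz: "z \<in> near_max b H x e" "z' \<in> near_max b H x e" and st: "0 \<le> s" "0 \<le> t" "s + t = 1"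
  obtain \<beta> \<beta>' where B: "(z, \<beta>) \<in> minorants b" "smoothing b H x - e \<le> blinfun_apply z x + \<beta> - H z"
    "(z', \<beta>') \<in> minorants b" "smoothing b H x - e \<le> blinfun_apply z' x + \<beta>' - H z'"
    using zz by (auto simp: near_max_def)
  have s: "s = 1 - t" using st by simp
  have Hc: "H (s *\<^sub>R z + t *\<^sub>R z') \<le> s * H z + t * H z'"
    using convex_onD[OF assms, of t z z'] minorant_norm[OF B(1)] minorant_norm[OF B(3)] st unfolding s by simp
  have "(s *\<^sub>R z + t *\<^sub>R z', s * \<beta> + t * \<beta>') \<in> minorants b"
  proof -
    have "blinfun_apply (s *\<^sub>R z + t *\<^sub>R z') y + (s * \<beta> + t * \<beta>') \<le> b y" for y
    proof -
      have "s * (blinfun_apply z y + \<beta>) + t * (blinfun_apply z' y + \<beta>') \<le> s * b y + t * b y"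
        using B st by (intro add_mono mult_left_mono) (auto simp: minorants_def)
      also have "\<dots> = b y" by (simp add: s algebra_simps)
      finally show ?thesis by (simp add: blinfun.add_left blinfun.scaleR_left algebra_simps)
    qed
    then show ?thesis by (simp add: minorants_def)
  qed
  moreover have "smoothing b H x - e \<le> blinfun_apply (s *\<^sub>R z + t *\<^sub>R z') x + (s * \<beta> + t * \<beta>') - H (s *\<^sub>R z + t *\<^sub>R z')"
  proof -
    have "smoothing b H x - e = s * (smoothing b H x - e) + t * (smoothing b H x - e)"
      by (simp add: s algebra_simps)
    also have "\<dots> \<le> s * (blinfun_apply z x + \<beta> - H z) + t * (blinfun_apply z' x + \<beta>' - H z')"
      using B st by (intro add_mono mult_left_mono) auto
    finally show ?thesis using Hc by (simp add: blinfun.add_left blinfun.scaleR_left algebra_simps)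
  qed
  ultimately show "s *\<^sub>R z + t *\<^sub>R z' \<in> near_max b H x e" by (auto simp: near_max_def)
qed

lemma near_max_limit:
  assumes cont: "continuous_on (cball 0 R) H"
    and zn: "\<And>n. zn n \<in> near_max b H x (e n)" and lim: "zn \<longlonglongrightarrow> z" and e: "e \<longlonglongrightarrow> 0"
  shows "z \<in> near_max b H x 0"
proof -
  obtain \<beta> where \<beta>: "\<And>n. (zn n, \<beta> n) \<in> minorants b"
    "\<And>n. smoothing b H x - e n \<le> blinfun_apply (zn n) x + \<beta> n - H (zn n)"
    using zn by (auto simp: near_max_def) metis
  have nz: "norm (zn n) \<le> R" for n using minorant_norm[OF \<beta>(1)] .
  have nzl: "norm z \<le> R"
    using Lim_bounded[OF tendsto_norm[OF lim]] nz by blast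
  obtain B where B: "\<And>n. \<bar>e n\<bar> \<le> B" using convergent_imp_Bseq[of e] e unfolding convergent_def Bseq_def by force
  \<comment> \<open>The offsets need not converge. They are bounded above by \<open>b 0\<close> and
    below by near-maximality, so a subsequence does.\<close>
  have "bounded (range \<beta>)"
  proof (rule boundedI)
    fix y assume "y \<in> range \<beta>"
    then obtain n where y: "y = \<beta> n" by blast
    have "\<beta> n \<le> b 0" using \<beta>(1)[of n] by (auto simp: minorants_def dest: spec[of _ 0])
    moreover have "smoothing b H x - B - R * norm x \<le> \<beta> n"
      using \<beta>(2)[of n] B[of n] H_nonneg[OF nz[of n]] minorant_lip[OF \<beta>(1)[of n], of x] by simp
    ultimately show "norm y \<le> \<bar>b 0\<bar> + \<bar>smoothing b H x - B - R * norm x\<bar>" by (simp add: y)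
  qed
  then obtain l r where r: "strict_mono r" "(\<beta> \<circ> r) \<longlonglongrightarrow> l"
    using bounded_imp_convergent_subsequence by blast
  have zr: "(\<lambda>n. zn (r n)) \<longlonglongrightarrow> z" using LIMSEQ_subseq_LIMSEQ[OF lim r(1)] by (simp add: o_def)
  have er: "(\<lambda>n. e (r n)) \<longlonglongrightarrow> 0" using LIMSEQ_subseq_LIMSEQ[OF e r(1)] by (simp add: o_def)
  have br: "(\<lambda>n. \<beta> (r n)) \<longlonglongrightarrow> l" using r(2) by (simp add: o_def)
  have ap: "(\<lambda>n. blinfun_apply (zn (r n)) y) \<longlonglongrightarrow> blinfun_apply z y" for y
    by (intro tendsto_intros zr)
  have Hr: "(\<lambda>n. H (zn (r n))) \<longlonglongrightarrow> H z"
    using continuous_on_tendsto_compose[OF cont zr] nz nzl by simp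
  have "blinfun_apply z y + l \<le> b y" for y
    by (rule LIMSEQ_le_const2[OF tendsto_add[OF ap br]]) (use \<beta>(1) in \<open>auto simp: minorants_def\<close>)
  moreover have "smoothing b H x - 0 \<le> blinfun_apply z x + l - H z"
    by (rule LIMSEQ_le[OF tendsto_diff[OF tendsto_const er] tendsto_diff[OF tendsto_add[OF ap br] Hr]])
      (use \<beta>(2) in auto)
  ultimately show ?thesis by (auto simp: near_max_def minorants_def)
qed

text \<open>Late tail hulls consist of near-maximizers by convexity of \<open>near_max\<close>, so
  \<open>z\<close>, by origin a weak limit, is approached by near-maximizers in norm and
  \<open>near_max_limit\<close> applies. The conclusion keeps \<open>z\<close> in the closed hulls
  because these are what the penalty centers approximate.\<close>

lemma maximizer_in_tail_hulls:
  assumes refl: "reflexive_space TYPE('a)"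
    and conv: "convex_on (cball 0 R) H" and cont: "continuous_on (cball 0 R) H"
    and bd: "\<And>n. norm (\<zeta> n) \<le> R"
    and near: "\<And>e. e > 0 \<Longrightarrow> \<forall>\<^sub>F n in sequentially. \<zeta> n \<in> near_max b H x e"
  obtains z where "z \<in> near_max b H x 0" "\<And>n. z \<in> closure (convex hull (\<zeta> ` {n..}))"
proof -
  obtain z where z: "\<And>n. z \<in> closure (convex hull (\<zeta> ` {n..}))"
    by (rule reflexive_tail_hull[OF refl, of \<zeta> R]) (use bd in auto)
  have "\<exists>z'. z' \<in> near_max b H x (1 / real (Suc n)) \<and> dist z' z < 1 / real (Suc n)" for n
  proof -
    have pos: "1 / real (Suc n) > 0" by simp
    obtain N where N: "\<And>m. m \<ge> N \<Longrightarrow> \<zeta> m \<in> near_max b H x (1 / real (Suc n))"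
      using near[OF pos] unfolding eventually_sequentially by blast
    have "convex hull (\<zeta> ` {N..}) \<subseteq> near_max b H x (1 / real (Suc n))"
      by (rule hull_minimal) (use N convex_near_max[OF conv] in auto)
    moreover obtain z' where "z' \<in> convex hull (\<zeta> ` {N..})" "dist z' z < 1 / real (Suc n)"
      using z[of N] pos unfolding closure_approachable by blast
    ultimately show ?thesis by blast
  qed
  then obtain zn where zn: "\<And>n. zn n \<in> near_max b H x (1 / real (Suc n))"
    "\<And>n. dist (zn n) z < 1 / real (Suc n)" by metis
  have lim0: "(\<lambda>n. 1 / real (Suc n)) \<longlonglongrightarrow> 0" by (rule LIMSEQ_Suc[OF lim_1_over_n])
  have "(\<lambda>n. dist (zn n) z) \<longlonglongrightarrow> 0"
    by (rule tendsto_sandwich[OF _ _ tendsto_const lim0]) (use zn(2) in \<open>auto intro!: always_eventually less_imp_le\<close>)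
  then have "zn \<longlonglongrightarrow> z" using tendsto_dist_iff by blast
  then have "z \<in> near_max b H x 0" using near_max_limit[OF cont zn(1) _ lim0] by blast
  then show ?thesis using that z by blast
qed

text \<open>At a point \<open>y\<close> of \<open>E\<close> close to \<open>z\<close>, the gap forces \<open>|z' - y|\<close> to be nearly \<open>|z - y|\<close>, hence small.\<close>

lemma strong_maximizer:
  assumes z: "z \<in> near_max b H x 0" and cl: "z \<in> closure E"
    and gap: "\<And>y. y \<in> E \<Longrightarrow> \<exists>a>0. \<forall>z z'. norm z \<le> R \<longrightarrow> norm z' \<le> R \<longrightarrow>
      H ((1/2) *\<^sub>R (z + z')) \<le> (H z + H z') / 2 - a * (norm (z - y) - norm (z' - y))\<^sup>2"
    and e: "e > 0"
  obtains d where "d > 0" "\<And>z'. z' \<in> near_max b H x d \<Longrightarrow> norm (z' - z) < e"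
proof -
  obtain y where y: "y \<in> E" "norm (z - y) < e / 4"
    using cl e unfolding closure_approachable by (metis dist_commute dist_norm divide_pos_pos zero_less_numeral)
  obtain a where a: "a > 0" "\<And>z z'. norm z \<le> R \<Longrightarrow> norm z' \<le> R \<Longrightarrow>
      H ((1/2) *\<^sub>R (z + z')) \<le> (H z + H z') / 2 - a * (norm (z - y) - norm (z' - y))\<^sup>2"
    using gap[OF y(1)] by blast
  \<comment> \<open>The midpoint competitor limits the gap to \<open>d / 2\<close>. With this
    \<open>d\<close> the distances of \<open>z'\<close> and \<open>z\<close> to \<open>y\<close>
    differ by less than \<open>e / 4\<close>, and since \<open>z\<close> is within
    \<open>e / 4\<close> of \<open>y\<close>, the distance of \<open>z'\<close> to \<open>z\<close>
    stays below \<open>3 * e / 4\<close>.\<close>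
  define d where "d = a * (e / 4)\<^sup>2"
  have d: "d > 0" using a e by (simp add: d_def)
  have "norm (z' - z) < e" if z': "z' \<in> near_max b H x d" for z'
  proof -
    obtain \<beta> \<beta>' where B: "(z, \<beta>) \<in> minorants b" "smoothing b H x \<le> blinfun_apply z x + \<beta> - H z"
      "(z', \<beta>') \<in> minorants b" "smoothing b H x - d \<le> blinfun_apply z' x + \<beta>' - H z'"
      using z z' by (auto simp: near_max_def)
    have "blinfun_apply ((1/2) *\<^sub>R (z + z')) u + (1/2) * (\<beta> + \<beta>') \<le> b u" for u
    proof -
      have "blinfun_apply z u + \<beta> \<le> b u" "blinfun_apply z' u + \<beta>' \<le> b u"
        using B by (auto simp: minorants_def)
      then have "(blinfun_apply z u + \<beta>) / 2 + (blinfun_apply z' u + \<beta>') / 2 \<le> b u" by argo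
      then show ?thesis by (simp add: blinfun.add_left blinfun.scaleR_left add_divide_distrib)
    qed
    then have "((1/2) *\<^sub>R (z + z'), (1/2) * (\<beta> + \<beta>')) \<in> minorants b" by (simp add: minorants_def)
    from smoothing_upper[OF this, of x]
    have "(blinfun_apply z x + \<beta>) / 2 + (blinfun_apply z' x + \<beta>') / 2 - H ((1/2) *\<^sub>R (z + z')) \<le> smoothing b H x"
      by (simp add: blinfun.add_left blinfun.scaleR_left add_divide_distrib)
    then have "a * (norm (z - y) - norm (z' - y))\<^sup>2 \<le> d / 2"
      using a(2)[OF minorant_norm[OF B(1)] minorant_norm[OF B(3)]] B(2,4) by (simp add: field_simps)
    then have "a * (norm (z - y) - norm (z' - y))\<^sup>2 < a * (e / 4)\<^sup>2"
      using d unfolding d_def by linarith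
    then have "(norm (z' - y) - norm (z - y))\<^sup>2 < (e / 4)\<^sup>2" using a(1) by (simp add: power2_commute)
    then have "norm (z' - y) - norm (z - y) < e / 4"
      by (rule power2_less_imp_less) (use e in simp)
    moreover have "norm (z' - z) \<le> norm (z' - y) + norm (z - y)"
      using norm_triangle_ineq4[of "z' - y" "z - y"] by simp
    ultimately show ?thesis using y e by simp
  qed
  then show ?thesis using that d by blast
qed

lemma smoothing_frechet_upper:
  assumes strong: "\<And>e. e > 0 \<Longrightarrow> \<exists>d>0. \<forall>z'\<in>near_max b H x d. norm (z' - z) < e" and e: "e > 0"
  obtains d where "d > 0"
    "\<And>v. norm v < d \<Longrightarrow> smoothing b H (x + v) \<le> smoothing b H x + blinfun_apply z v + e * norm v"
proof -
  have e2: "e / 2 > 0" using e by simp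
  obtain d0 where d0: "d0 > 0" "\<And>z'. z' \<in> near_max b H x d0 \<Longrightarrow> norm (z' - z) < e / 2"
    using strong[OF e2] by blast
  \<comment> \<open>A maximizer at \<open>x + v\<close> up to \<open>(e / 2) |v|\<close> is used at
    \<open>x\<close>: its slope costs \<open>R |v|\<close> and the change of the smoothing another
    \<open>R |v|\<close>. The total is at most \<open>(2 * R + e) |v|\<close>, hence at most
    \<open>d0\<close>, so its slope is close to \<open>z\<close>.\<close>
  define d where "d = d0 / (2 * R + e)"
  have d: "d > 0" using d0 R0 e by (simp add: d_def)
  have "smoothing b H (x + v) \<le> smoothing b H x + blinfun_apply z v + e * norm v" if v: "norm v < d" for v
  proof (cases "v = 0")
    case False
    then have "(e / 2) * norm v > 0" using e by simp
    then obtain z' \<beta> where z': "(z', \<beta>) \<in> minorants b"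
      "smoothing b H (x + v) - (e / 2) * norm v \<le> blinfun_apply z' (x + v) + \<beta> - H z'"
      using smoothing_approx by blast
    have "(2 * R + e) * norm v \<le> d0"
      using v R0 e by (simp add: d_def pos_less_divide_eq mult.commute)
    moreover have "smoothing b H x - smoothing b H (x + v) \<le> R * norm v"
      using smoothing_lip[of x "x + v"] by simp
    moreover have "0 \<le> e * norm v" using e by simp
    ultimately have "smoothing b H x - d0 \<le> blinfun_apply z' x + \<beta> - H z'"
      using z'(2) minorant_lip[OF z'(1), of v] by (simp add: blinfun.add_right algebra_simps)
    then have "z' \<in> near_max b H x d0" using z'(1) by (auto simp: near_max_def)
    then have "norm (z' - z) < e / 2" by (rule d0(2))
    then have "blinfun_apply (z' - z) v \<le> (e / 2) * norm v"
      using norm_blinfun[of "z' - z" v] mult_right_mono[of "norm (z' - z)" "e / 2" "norm v"] by simp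
    then show ?thesis
      using z'(2) smoothing_upper[OF z'(1), of x] by (simp add: blinfun.add_right blinfun.diff_left algebra_simps)
  qed (use e in simp)
  then show ?thesis using that d by blast
qed

end

section \<open>Quadratic penalties centered at finite nets\<close>

definition net_penalty :: "real \<Rightarrow> real \<Rightarrow> 'a::real_normed_vector set \<Rightarrow> 'a \<Rightarrow> real" where
  "net_penalty R w F z = w / (4 * R\<^sup>2 * real (card F)) * (\<Sum>e\<in>F. (norm (z - e))\<^sup>2)"

text \<open>The smoothing of the \<open>i\<close>-th perturbation uses only the penalties from index \<open>i\<close> on, so that its
  error stays small compared with the size of that perturbation.\<close>

definition delayed_penalty ::
    "real \<Rightarrow> (nat \<Rightarrow> real) \<Rightarrow> (nat \<Rightarrow> 'a::real_normed_vector set) \<Rightarrow> nat \<Rightarrow> nat \<Rightarrow> 'a \<Rightarrow> real" where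
  "delayed_penalty R w F i m z = (if i \<le> m then net_penalty R (w m) (F m) z else 0)"

text \<open>The triangle inequality reduces this to an identity for the squares of the two numbers
  \<open>|z - e|\<close> and \<open>|z' - e|\<close>. So the gap is available in every norm, without
  uniform convexity, but it sees only the difference of the distances to \<open>e\<close>. This is
  why centers close to the maximizer are needed.\<close>

lemma square_midpoint:
  fixes z z' e :: "'a::real_normed_vector"
  shows "(norm ((1/2) *\<^sub>R (z + z') - e))\<^sup>2 \<le> ((norm (z - e))\<^sup>2 + (norm (z' - e))\<^sup>2) / 2 - (norm (z - e) - norm (z' - e))\<^sup>2 / 4"
proof -
  have "(1/2) *\<^sub>R (z + z') - e = (1/2) *\<^sub>R ((z - e) + (z' - e))"
    by (simp add: algebra_simps) (metis scaleR_add_left scaleR_one field_sum_of_halves)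
  then have "norm ((1/2) *\<^sub>R (z + z') - e) \<le> (norm (z - e) + norm (z' - e)) / 2"
    using norm_triangle_ineq[of "z - e" "z' - e"] by simp
  then have "(norm ((1/2) *\<^sub>R (z + z') - e))\<^sup>2 \<le> ((norm (z - e) + norm (z' - e)) / 2)\<^sup>2"
    by (rule power_mono) simp
  also have "\<dots> = ((norm (z - e))\<^sup>2 + (norm (z' - e))\<^sup>2) / 2 - (norm (z - e) - norm (z' - e))\<^sup>2 / 4"
    by (simp add: power2_eq_square field_simps)
  finally show ?thesis .
qed

lemma convex_on_norm_square:
  fixes e :: "'a::real_normed_vector"
  assumes "convex S"
  shows "convex_on S (\<lambda>z. (norm (z - e))\<^sup>2)"
proof (rule convex_onI[OF _ assms])
  fix t :: real and x y :: 'a assume t: "0 < t" "t < 1"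
  have "(1 - t) *\<^sub>R x + t *\<^sub>R y - e = (1 - t) *\<^sub>R (x - e) + t *\<^sub>R (y - e)" by (simp add: algebra_simps)
  then have "norm ((1 - t) *\<^sub>R x + t *\<^sub>R y - e) \<le> (1 - t) * norm (x - e) + t * norm (y - e)"
    using norm_triangle_ineq[of "(1 - t) *\<^sub>R (x - e)" "t *\<^sub>R (y - e)"] t by simp
  then have "(norm ((1 - t) *\<^sub>R x + t *\<^sub>R y - e))\<^sup>2 \<le> ((1 - t) * norm (x - e) + t * norm (y - e))\<^sup>2"
    by (rule power_mono) simp
  also have "\<dots> = (1 - t) * (norm (x - e))\<^sup>2 + t * (norm (y - e))\<^sup>2 - t * (1 - t) * (norm (x - e) - norm (y - e))\<^sup>2"
    by (simp add: power2_eq_square algebra_simps)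
  also have "\<dots> \<le> (1 - t) * (norm (x - e))\<^sup>2 + t * (norm (y - e))\<^sup>2" using t by simp
  finally show "(norm ((1 - t) *\<^sub>R x + t *\<^sub>R y - e))\<^sup>2 \<le> (1 - t) * (norm (x - e))\<^sup>2 + t * (norm (y - e))\<^sup>2" .
qed

locale net_penalties =
  fixes R :: real and w :: "nat \<Rightarrow> real" and F :: "nat \<Rightarrow> 'a::real_normed_vector set"
  assumes R: "R > 0" and w: "\<And>m. w m > 0" "summable w"
    and F: "\<And>m. finite (F m)" "\<And>m. F m \<noteq> {}" "\<And>m. F m \<subseteq> cball 0 R"
begin

definition coef where "coef m = w m / (4 * R\<^sup>2 * real (card (F m)))"

text \<open>Two points of the ball are at most \<open>2 * R\<close> apart, so this normalization
  makes \<open>w m\<close> a bound for the \<open>m\<close>-th penalty on the ball, whatever the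
  size of its net.\<close>

lemma coef: "coef m > 0" "coef m * real (card (F m)) * (2 * R)\<^sup>2 = w m"
  using w(1)[of m] R F[of m] by (simp_all add: coef_def card_gt_0_iff power2_eq_square)

abbreviation penalty :: "nat \<Rightarrow> nat \<Rightarrow> 'a \<Rightarrow> real" where
  "penalty \<equiv> delayed_penalty R w F"

definition tail_penalty :: "nat \<Rightarrow> 'a \<Rightarrow> real" where
  "tail_penalty i z = (\<Sum>m. penalty i m z)"

lemma penalty_nonneg: "0 \<le> penalty i m z"
  using coef(1)[of m] unfolding delayed_penalty_def net_penalty_def coef_def[symmetric]
  by (auto intro!: mult_nonneg_nonneg sum_nonneg)

lemma penalty_le:
  assumes "norm z \<le> R"
  shows "penalty i m z \<le> w m"
proof -
  have "(\<Sum>e\<in>F m. (norm (z - e))\<^sup>2) \<le> (\<Sum>e\<in>F m. (2 * R)\<^sup>2)"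
  proof (intro sum_mono power_mono)
    fix e assume "e \<in> F m"
    then have "norm e \<le> R" using F(3)[of m] by auto
    then show "norm (z - e) \<le> 2 * R" using norm_triangle_ineq4[of z e] assms by simp
  qed simp
  then have "coef m * (\<Sum>e\<in>F m. (norm (z - e))\<^sup>2) \<le> coef m * (\<Sum>e\<in>F m. (2 * R)\<^sup>2)"
    by (rule mult_left_mono) (use coef(1)[of m] in simp)
  also have "\<dots> = w m" using coef(2)[of m] by simp
  finally show ?thesis
    using w(1)[of m] by (auto simp: delayed_penalty_def net_penalty_def coef_def[symmetric])
qed

lemma summable_penalty:
  assumes "norm z \<le> R"
  shows "summable (\<lambda>m. penalty i m z)"
  by (rule summable_comparison_test'[OF w(2), of 0])
    (use penalty_nonneg penalty_le[OF assms] in auto)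

lemma penalty_lipschitz:
  assumes "norm z \<le> R" "norm z' \<le> R"
  shows "\<bar>penalty i m z - penalty i m z'\<bar> \<le> w m / R * norm (z - z')"
proof (cases "i \<le> m")
  case True
  have "\<bar>(norm (z - e))\<^sup>2 - (norm (z' - e))\<^sup>2\<bar> \<le> 4 * R * norm (z - z')" if "e \<in> F m" for e
  proof -
    have e: "norm e \<le> R" using that F(3)[of m] by auto
    have "(norm (z - e))\<^sup>2 - (norm (z' - e))\<^sup>2 = (norm (z - e) + norm (z' - e)) * (norm (z - e) - norm (z' - e))"
      by (simp add: power2_eq_square algebra_simps)
    then have "\<bar>(norm (z - e))\<^sup>2 - (norm (z' - e))\<^sup>2\<bar> = (norm (z - e) + norm (z' - e)) * \<bar>norm (z - e) - norm (z' - e)\<bar>"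
      by (simp add: abs_mult)
    also have "\<dots> \<le> (4 * R) * norm (z - z')"
      using norm_triangle_ineq4[of z e] norm_triangle_ineq4[of z' e] norm_triangle_ineq3[of "z - e" "z' - e"] assms e R
      by (intro mult_mono) auto
    finally show ?thesis .
  qed
  then have "(\<Sum>e\<in>F m. \<bar>(norm (z - e))\<^sup>2 - (norm (z' - e))\<^sup>2\<bar>) \<le> (\<Sum>e\<in>F m. 4 * R * norm (z - z'))"
    by (rule sum_mono)
  then have "\<bar>\<Sum>e\<in>F m. (norm (z - e))\<^sup>2 - (norm (z' - e))\<^sup>2\<bar> \<le> real (card (F m)) * (4 * R * norm (z - z'))"
    using order_trans[OF sum_abs] by simp
  then have "coef m * \<bar>\<Sum>e\<in>F m. (norm (z - e))\<^sup>2 - (norm (z' - e))\<^sup>2\<bar> \<le> coef m * (real (card (F m)) * (4 * R * norm (z - z')))"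
    by (rule mult_left_mono) (use coef(1)[of m] in simp)
  moreover have "coef m * (real (card (F m)) * (4 * R * norm (z - z'))) = w m / R * norm (z - z')"
    unfolding coef(2)[of m, symmetric] using R by (simp add: power2_eq_square field_simps)
  moreover have "penalty i m z - penalty i m z' = coef m * (\<Sum>e\<in>F m. (norm (z - e))\<^sup>2 - (norm (z' - e))\<^sup>2)"
    using True by (simp add: delayed_penalty_def net_penalty_def coef_def[symmetric] sum_subtractf right_diff_distrib)
  ultimately show ?thesis using coef(1)[of m] by (simp add: abs_mult)
next
  case False
  then show ?thesis using w(1)[of m] R by (simp add: delayed_penalty_def)
qed

lemma penalty_midpoint:
  "penalty i m ((1/2) *\<^sub>R (z + z')) \<le> (penalty i m z + penalty i m z') / 2"
  "i \<le> m \<Longrightarrow> e \<in> F m \<Longrightarrow> penalty i m ((1/2) *\<^sub>R (z + z')) \<le>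
     (penalty i m z + penalty i m z') / 2 - coef m / 4 * (norm (z - e) - norm (z' - e))\<^sup>2"
proof -
  let ?g = "\<lambda>e. (norm (z - e) - norm (z' - e))\<^sup>2 / 4"
  have "(\<Sum>e\<in>F m. (norm ((1/2) *\<^sub>R (z + z') - e))\<^sup>2) \<le>
    (\<Sum>e\<in>F m. ((norm (z - e))\<^sup>2 + (norm (z' - e))\<^sup>2) / 2 - ?g e)"
    by (rule sum_mono) (rule square_midpoint)
  then have "coef m * (\<Sum>e\<in>F m. (norm ((1/2) *\<^sub>R (z + z') - e))\<^sup>2) \<le>
    coef m * (\<Sum>e\<in>F m. ((norm (z - e))\<^sup>2 + (norm (z' - e))\<^sup>2) / 2 - ?g e)"
    by (rule mult_left_mono) (use coef(1)[of m] in simp)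
  then have main: "penalty i m ((1/2) *\<^sub>R (z + z')) \<le> (penalty i m z + penalty i m z') / 2 - coef m * (\<Sum>e\<in>F m. ?g e)"
    if "i \<le> m"
    using that by (simp add: delayed_penalty_def net_penalty_def coef_def[symmetric] sum_subtractf sum.distrib
        sum_divide_distrib[symmetric] right_diff_distrib distrib_left)
  show "penalty i m ((1/2) *\<^sub>R (z + z')) \<le> (penalty i m z + penalty i m z') / 2"
  proof (cases "i \<le> m")
    case True
    moreover have "0 \<le> coef m * (\<Sum>e\<in>F m. ?g e)"
      using coef(1)[of m] by (intro mult_nonneg_nonneg sum_nonneg) auto
    ultimately show ?thesis using main by linarith
  qed (simp add: delayed_penalty_def)
  assume im: "i \<le> m" and e: "e \<in> F m"
  have "?g e \<le> (\<Sum>e\<in>F m. ?g e)"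
    by (rule member_le_sum[OF e _ F(1)]) simp
  then have "coef m * ?g e \<le> coef m * (\<Sum>e\<in>F m. ?g e)"
    by (rule mult_left_mono) (use coef(1)[of m] in simp)
  then show "penalty i m ((1/2) *\<^sub>R (z + z')) \<le>
     (penalty i m z + penalty i m z') / 2 - coef m / 4 * (norm (z - e) - norm (z' - e))\<^sup>2"
    using main[OF im] by simp
qed

lemma convex_on_penalty: "convex S \<Longrightarrow> convex_on S (penalty i m)"
proof -
  assume S: "convex S"
  have "convex_on S (\<lambda>z. \<Sum>e\<in>G. (norm (z - e))\<^sup>2)" if "finite G" for G
    using that
    by induction (auto intro!: convex_on_add convex_on_norm_square S simp: convex_on_const)
  from this[OF F(1)[of m]] have "convex_on S (\<lambda>z. coef m * (\<Sum>e\<in>F m. (norm (z - e))\<^sup>2))"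
    using coef(1)[of m] by (intro convex_on_cmul) auto
  then show ?thesis
    using S by (cases "i \<le> m") (simp_all add: delayed_penalty_def[abs_def] net_penalty_def coef_def[symmetric] convex_on_const)
qed

lemma convex_on_tail_penalty: "convex_on (cball 0 R) (tail_penalty i)"
proof (rule convex_onI)
  fix t :: real and x y :: 'a assume t: "0 < t" "t < 1" and xy: "x \<in> cball 0 R" "y \<in> cball 0 R"
  have "(1 - t) *\<^sub>R x + t *\<^sub>R y \<in> cball 0 R"
    using convexD[OF convex_cball xy, of "1 - t" t] t by simp
  then have s: "summable (\<lambda>m. penalty i m x)" "summable (\<lambda>m. penalty i m y)"
    "summable (\<lambda>m. penalty i m ((1 - t) *\<^sub>R x + t *\<^sub>R y))"
    using xy by (auto intro!: summable_penalty)
  have "tail_penalty i ((1 - t) *\<^sub>R x + t *\<^sub>R y) \<le> (\<Sum>m. (1 - t) * penalty i m x + t * penalty i m y)"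
    unfolding tail_penalty_def using s t xy convex_onD[OF convex_on_penalty[OF convex_cball], of t x 0 R y i]
    by (intro suminf_le summable_add summable_mult) auto
  also have "\<dots> = (1 - t) * tail_penalty i x + t * tail_penalty i y"
    unfolding tail_penalty_def using s
    by (simp add: suminf_add[symmetric] suminf_mult summable_mult)
  finally show "tail_penalty i ((1 - t) *\<^sub>R x + t *\<^sub>R y) \<le> (1 - t) * tail_penalty i x + t * tail_penalty i y" .
qed simp

lemma continuous_on_tail_penalty: "continuous_on (cball 0 R) (tail_penalty i)"
proof -
  have "(suminf w / R)-lipschitz_on (cball 0 R) (tail_penalty i)"
  proof (rule lipschitz_onI)
    fix x y :: 'a assume "x \<in> cball 0 R" "y \<in> cball 0 R"
    then have xy: "norm x \<le> R" "norm y \<le> R" by auto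
    have sw: "summable (\<lambda>m. w m / R * norm (x - y))"
      using w(2) by (intro summable_mult2 summable_divide)
    have sa: "summable (\<lambda>m. \<bar>penalty i m x - penalty i m y\<bar>)"
      by (rule summable_comparison_test'[OF sw, of 0]) (use penalty_lipschitz[OF xy] in auto)
    have "\<bar>tail_penalty i x - tail_penalty i y\<bar> = \<bar>\<Sum>m. penalty i m x - penalty i m y\<bar>"
      unfolding tail_penalty_def using xy by (simp add: suminf_diff summable_penalty)
    also have "\<dots> \<le> (\<Sum>m. \<bar>penalty i m x - penalty i m y\<bar>)"
      by (rule summable_rabs[OF sa])
    also have "\<dots> \<le> (\<Sum>m. w m / R * norm (x - y))"
      by (intro suminf_le sa sw penalty_lipschitz xy)
    also have "\<dots> = suminf w / R * norm (x - y)"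
      using suminf_mult2[OF summable_divide[OF w(2), of R], of "norm (x - y)"] suminf_divide[OF w(2), of R] by simp
    finally show "dist (tail_penalty i x) (tail_penalty i y) \<le> suminf w / R * dist x y"
      by (simp add: dist_norm dist_real_def)
  qed (use R w in \<open>simp add: suminf_nonneg less_imp_le\<close>)
  then show ?thesis by (rule lipschitz_on_continuous_on)
qed

text \<open>Every summand has a nonnegative midpoint gap, so the gap of the series is at least that
  of the single penalty whose net contains \<open>e\<close>. For \<open>m < i\<close> the
  \<open>i\<close>-th smoothing does not contain that penalty.\<close>

lemma tail_penalty_gap:
  assumes im: "i \<le> m" and e: "e \<in> F m"
  shows "\<exists>a>0. \<forall>z z'. norm z \<le> R \<longrightarrow> norm z' \<le> R \<longrightarrow>
    tail_penalty i ((1/2) *\<^sub>R (z + z')) \<le> (tail_penalty i z + tail_penalty i z') / 2 - a * (norm (z - e) - norm (z' - e))\<^sup>2"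
proof (intro exI[of _ "coef m / 4"] conjI allI impI)
  fix z z' :: 'a assume z: "norm z \<le> R" "norm z' \<le> R"
  have mid: "norm ((1/2) *\<^sub>R (z + z')) \<le> R"
    using norm_triangle_ineq[of z z'] z by simp
  let ?h = "\<lambda>m. (penalty i m z + penalty i m z') / 2 - penalty i m ((1/2) *\<^sub>R (z + z'))"
  have s: "summable ?h"
    by (intro summable_diff summable_divide summable_add summable_penalty z mid)
  have "coef m / 4 * (norm (z - e) - norm (z' - e))\<^sup>2 \<le> ?h m"
    using penalty_midpoint(2)[OF im e, of z z'] by linarith
  also have "\<dots> = sum ?h {m}" by simp
  also have "\<dots> \<le> suminf ?h"
    by (rule sum_le_suminf[OF s]) (use penalty_midpoint(1)[of i _ z z'] in auto)
  also have "\<dots> = (tail_penalty i z + tail_penalty i z') / 2 - tail_penalty i ((1/2) *\<^sub>R (z + z'))"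
    unfolding tail_penalty_def using z mid
    by (simp add: suminf_diff[symmetric] suminf_add suminf_divide summable_penalty summable_add summable_divide)
  finally show "tail_penalty i ((1/2) *\<^sub>R (z + z')) \<le>
    (tail_penalty i z + tail_penalty i z') / 2 - coef m / 4 * (norm (z - e) - norm (z' - e))\<^sup>2"
    by linarith
qed (use coef(1)[of m] in simp)

lemma partial_penalty_bounds:
  assumes "norm z \<le> R"
  shows "0 \<le> (\<Sum>m<n. penalty i m z)" "(\<Sum>m<n. penalty i m z) \<le> tail_penalty i z"
    "tail_penalty i z \<le> (\<Sum>m<n. penalty i m z) + (\<Sum>m. w (m + n))"
proof -
  note s = summable_penalty[OF assms]
  show "0 \<le> (\<Sum>m<n. penalty i m z)" by (intro sum_nonneg penalty_nonneg)
  show "(\<Sum>m<n. penalty i m z) \<le> tail_penalty i z"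
    unfolding tail_penalty_def by (rule sum_le_suminf[OF s]) (auto intro: penalty_nonneg)
  have "tail_penalty i z = (\<Sum>m. penalty i (m + n) z) + (\<Sum>m<n. penalty i m z)"
    unfolding tail_penalty_def by (rule suminf_split_initial_segment[OF s])
  moreover have "(\<Sum>m. penalty i (m + n) z) \<le> (\<Sum>m. w (m + n))"
    by (intro suminf_le penalty_le assms summable_ignore_initial_segment s w(2))
  ultimately show "tail_penalty i z \<le> (\<Sum>m<n. penalty i m z) + (\<Sum>m. w (m + n))" by simp
qed

end

section \<open>The variational principle\<close>

lemma smoothing_zero:
  assumes "conjugate_smoothing b R W (\<lambda>_. 0)"
  shows "smoothing b (\<lambda>_. 0) x = b x"
proof -
  interpret conjugate_smoothing b R 0 "\<lambda>_. 0"
    using assms by (simp add: conjugate_smoothing_def)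
  show ?thesis using smoothing_le[of x] smoothing_ge[of x] by simp
qed

text \<open>Successive differences of \<open>4 * A * (1/4)^n\<close> are
  \<open>3 * A * (1/4)^n\<close>, so the steps telescope.\<close>

lemma geometric_limit:
  fixes x :: "nat \<Rightarrow> 'a::banach"
  assumes "\<And>n. norm (x (Suc n) - x n) \<le> 3 * A * (1/4)^n"
  obtains l where "x \<longlonglongrightarrow> l" "\<And>n. norm (x n - l) \<le> 4 * A * (1/4)^n"
proof -
  have *: "norm (x (n + m) - x n) \<le> 4 * A * ((1/4)^n - (1/4)^(n + m))" for n m
  proof (induction m)
    case (Suc m)
    have "norm (x (n + Suc m) - x n) \<le> norm (x (Suc (n + m)) - x (n + m)) + norm (x (n + m) - x n)"
      using norm_triangle_ineq[of "x (Suc (n + m)) - x (n + m)" "x (n + m) - x n"] by simp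
    also have "\<dots> \<le> 3 * A * (1/4)^(n + m) + 4 * A * ((1/4)^n - (1/4)^(n + m))"
      using Suc assms by (intro add_mono)
    also have "\<dots> = 4 * A * ((1/4)^n - (1/4)^(n + Suc m))"
      by (simp add: algebra_simps)
    finally show ?case .
  qed simp
  have A: "A \<ge> 0" using order_trans[OF norm_ge_zero assms[of 0]] by simp
  have le: "norm (x (n + m) - x n) \<le> 4 * A * (1/4)^n" for n m
  proof -
    have "0 \<le> 4 * A * (1/4)^(n + m)" using A by simp
    then show ?thesis using *[of n m] unfolding right_diff_distrib by linarith
  qed
  have lim: "(\<lambda>n. 4 * A * (1/4)^n) \<longlonglongrightarrow> 0"
    by (intro tendsto_mult_right_zero LIMSEQ_power_zero) simp
  have "Cauchy x"
  proof (rule CauchyI')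
    fix e :: real assume "e > 0"
    then obtain N where N: "\<And>n. n \<ge> N \<Longrightarrow> 4 * A * (1/4)^n < e"
      using order_tendstoD(2)[OF lim] unfolding eventually_sequentially by blast
    show "\<exists>M. \<forall>m\<ge>M. \<forall>n>m. dist (x m) (x n) < e"
    proof (intro exI[of _ N] allI impI)
      fix m n assume "N \<le> m" "m < n"
      then show "dist (x m) (x n) < e"
        using le[of m "n - m"] N[of m] by (simp add: dist_norm norm_minus_commute)
    qed
  qed
  then obtain l where l: "x \<longlonglongrightarrow> l" by (auto simp: Cauchy_convergent_iff convergent_def)
  have "norm (x n - l) \<le> 4 * A * (1/4)^n" for n
  proof (rule Lim_bounded[OF tendsto_norm[OF tendsto_diff[OF tendsto_const l]], of n])
    show "\<forall>m\<ge>n. norm (x n - x m) \<le> 4 * A * (1/4)^n"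
      using le by (metis le_add_diff_inverse norm_minus_commute)
  qed
  with l show ?thesis using that by blast
qed

section \<open>Stagewise choice of approximate minimizers and nets\<close>

locale perturbed_min =
  fixes D :: "'a::banach set" and \<phi> k :: "'a \<Rightarrow> real" and L \<eta> \<tau> :: real and xh :: 'a
  assumes refl: "reflexive_space TYPE('a)"
    and k_convex: "convex_on UNIV k" and k_lip: "\<And>x y. k x - k y \<le> L * norm (x - y)" and L: "0 \<le> L"
    and \<eta>: "0 < \<eta>" and \<tau>: "0 < \<tau>"
    and xh: "xh \<in> D" and min: "\<And>y. y \<in> D \<Longrightarrow> \<phi> xh + k xh \<le> \<phi> y + k y"
    and lsc: "\<And>xs x c. (\<And>n. xs n \<in> D) \<Longrightarrow> xs \<longlonglongrightarrow> x \<Longrightarrow> (\<And>n. \<phi> (xs n) \<le> c) \<Longrightarrow> x \<in> D \<and> \<phi> x \<le> c"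
begin

definition R where "R = L + \<eta>"
text \<open>The ratios 1/16, 1/8 and 1/2 are tuned for \<open>step\<close>:
  \<open>n + 1 \<le> 2 ^ n\<close> gives \<open>(n + 1) * weight n \<le> tol n\<close>, so the
  errors at stage \<open>n\<close> add up to at most \<open>3 * tol n\<close>, and
  \<open>tol n / rate n = (\<tau> / \<eta>) * (1/4)^n\<close> is summable.\<close>

definition weight where "weight m = \<tau> * (1/16)^m"
definition tol where "tol n = \<tau> * (1/8)^n"
definition rate where "rate i = \<eta> * (1/2)^i"
definition rest where "rest n = (\<Sum>m. weight (m + n))"
text \<open>Merging \<open>k\<close> into the perturbation of index 0 lets both be smoothed
  together, so that \<open>k\<close> enters the final subgradient through its first term
  alone.\<close>

definition base where "base i c y = (if i = 0 then k y else 0) + rate i * norm (y - c)"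
definition part where "part F i n z = (\<Sum>m<n. delayed_penalty R weight F i m z)"

lemma R_pos: "R > 0" using L \<eta> by (simp add: R_def)
lemma rate_pos: "rate i > 0" using \<eta> by (simp add: rate_def)
lemma tol_pos: "tol n > 0" using \<tau> by (simp add: tol_def)
lemma weight_pos: "weight n > 0" using \<tau> by (simp add: weight_def)

lemma summable_weight: "summable weight"
  unfolding weight_def by (intro summable_mult summable_geometric) simp

lemma rest_eq: "rest n = (16/15) * \<tau> * (1/16)^n"
proof -
  have "rest n = (\<Sum>m. \<tau> * (1/16)^n * (1/16)^m)"
    unfolding rest_def weight_def by (simp add: power_add mult_ac)
  also have "\<dots> = \<tau> * (1/16)^n * (\<Sum>m. (1/16)^m)"
    by (rule suminf_mult) (simp add: summable_geometric)
  also have "\<dots> = (16/15) * \<tau> * (1/16)^n"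
    by (subst suminf_geometric) auto
  finally show ?thesis .
qed

lemma base_convex: "convex_on UNIV (base i c)"
proof -
  have "convex_on UNIV (\<lambda>y. rate i * norm (y - c))"
    using convex_on_dist[of UNIV c] rate_pos[of i]
    by (intro convex_on_cmul) (auto simp: dist_norm norm_minus_commute)
  moreover have "convex_on UNIV (\<lambda>y. if i = 0 then k y else 0)"
    using k_convex by (cases "i = 0") (simp_all add: convex_on_const)
  ultimately show ?thesis unfolding base_def[abs_def] by (intro convex_on_add)
qed

lemma base_lip:
  "base i c x - base i c y \<le> ((if i = 0 then L else 0) + rate i) * norm (x - y)"
proof -
  have "rate i * (norm (x - c) - norm (y - c)) \<le> rate i * norm (x - y)"
    using norm_triangle_ineq2[of "x - c" "y - c"] rate_pos[of i] by (intro mult_left_mono) auto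
  then show ?thesis using k_lip[of x y] by (cases "i = 0") (simp_all add: base_def algebra_simps)
qed

lemma rate_le: "(if i = 0 then L else 0) + rate i \<le> R"
proof (cases "i = 0")
  case False
  have "\<eta> * (1/2)^i \<le> \<eta> * 1" using \<eta> by (intro mult_left_mono power_le_one) auto
  then show ?thesis using False L by (simp add: R_def rate_def)
qed (simp add: R_def rate_def)

text \<open>Two Lipschitz constants for one function: the uniform \<open>R\<close> keeps all nets in
  one ball, while the sharp one, which is \<open>rate i\<close> for \<open>i > 0\<close>, later
  makes the slopes summable.\<close>

lemma base_smoothing:
  assumes "\<And>z. norm z \<le> R \<Longrightarrow> 0 \<le> H z" "\<And>z. norm z \<le> R \<Longrightarrow> H z \<le> W"
  shows "conjugate_smoothing (base i c) R W H"
    "conjugate_smoothing (base i c) ((if i = 0 then L else 0) + rate i) W H"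
proof -
  have lipR: "base i c x - base i c y \<le> R * norm (x - y)" for x y
    using base_lip[of i c x y] mult_right_mono[OF rate_le[of i], of "norm (x - y)"] by simp
  show "conjugate_smoothing (base i c) R W H"
    using lipR assms R_pos base_convex by unfold_locales auto
  show "conjugate_smoothing (base i c) ((if i = 0 then L else 0) + rate i) W H"
    using base_lip assms L rate_pos[of i] rate_le[of i] base_convex
    by unfold_locales (auto intro: order_trans)
qed

lemma net_penaltiesI:
  assumes "\<And>m. finite (F m) \<and> F m \<noteq> {} \<and> F m \<subseteq> cball 0 R"
  shows "net_penalties R weight F"
  using assms by unfold_locales (auto simp: R_pos weight_pos summable_weight)

lemma part_bounds:
  fixes F :: "nat \<Rightarrow> ('a \<Rightarrow>\<^sub>L real) set"
  assumes F: "\<And>m. m < n \<Longrightarrow> finite (F m) \<and> F m \<noteq> {} \<and> F m \<subseteq> cball 0 R" and z: "norm z \<le> R"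
  shows "0 \<le> part F i n z" "part F i n z \<le> rest 0"
proof -
  \<comment> \<open>The locale asks for a net at every index, but only those below \<open>n\<close>
    are known. The filler \<open>{0}\<close> does not enter \<open>part F i n\<close>.\<close>
  define F' where "F' m = (if m < n then F m else {0})" for m
  interpret N: net_penalties R weight F'
    using F R_pos by (intro net_penaltiesI) (auto simp: F'_def)
  have "N.penalty i m z = delayed_penalty R weight F i m z" if "m < n" for m
    using that by (simp add: delayed_penalty_def F'_def)
  then have eq: "part F i n z = (\<Sum>m<n. N.penalty i m z)"
    by (simp add: part_def)
  show "0 \<le> part F i n z" unfolding eq by (rule N.partial_penalty_bounds(1)[OF z])
  have "N.tail_penalty i z \<le> rest 0"
    using N.partial_penalty_bounds(3)[OF z, of i 0] by (simp add: rest_def)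
  then show "part F i n z \<le> rest 0"
    unfolding eq using N.partial_penalty_bounds(2)[OF z, of i n] by linarith
qed

lemma part_cong:
  assumes "\<And>m. m < n \<Longrightarrow> F m = F' m"
  shows "part F i n = part F' i n"
  using assms by (auto simp: part_def delayed_penalty_def fun_eq_iff intro!: sum.cong)

definition objective where
  "objective x F n y = \<phi> y + (\<Sum>i<n. smoothing (base i (x i)) (part F i n) y)"

text \<open>Step \<open>n\<close> records the near-minimizer \<open>x\<close>, near-maximizers \<open>\<zeta> i\<close> at \<open>x\<close> in the \<open>i\<close>-th smoothing for \<open>i < n\<close>,
  and a finite net \<open>F\<close> of the convex hull of all near-maximizers met so far, which defines the
  next penalty. Only \<open>f m\<close> with \<open>m < n\<close> matters.\<close>

definition stage where
  "stage f n = (\<lambda>(x, \<zeta>, F). x \<in> D \<and> (n = 0 \<longrightarrow> x = xh) \<and>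
     (n > 0 \<longrightarrow> (\<forall>y\<in>D. objective (fst \<circ> f) (snd \<circ> snd \<circ> f) n x \<le> objective (fst \<circ> f) (snd \<circ> snd \<circ> f) n y + tol n)) \<and>
     (\<forall>i<n. \<zeta> i \<in> near_max (base i (fst (f i))) (part (snd \<circ> snd \<circ> f) i n) x (tol n)) \<and>
     finite F \<and> F \<noteq> {} \<and> F \<subseteq> cball 0 R \<and>
     (\<forall>z\<in>convex hull ((\<Union>m<n. fst (snd (f m)) ` {..<m}) \<union> \<zeta> ` {..<n}). \<exists>e\<in>F. dist z e < 1 / real (Suc n)))"

text \<open>Well-founded dependent choice asks for this, since the admissible values at
  \<open>n\<close> depend on the whole past and not only on the preceding stage.\<close>

lemma stage_cong:
  assumes "\<And>m. m < n \<Longrightarrow> f m = g m"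
  shows "stage f n r = stage g n r"
proof -
  have *: "part (snd \<circ> snd \<circ> f) i n = part (snd \<circ> snd \<circ> g) i n" for i
    by (rule part_cong) (simp add: assms)
  have "objective (fst \<circ> f) (snd \<circ> snd \<circ> f) n = objective (fst \<circ> g) (snd \<circ> snd \<circ> g) n"
    using assms by (auto simp: objective_def fun_eq_iff * intro!: sum.cong)
  moreover have "(\<Union>m<n. fst (snd (f m)) ` {..<m}) = (\<Union>m<n. fst (snd (g m)) ` {..<m})"
    using assms by auto
  moreover have "(\<forall>i<n. \<zeta> i \<in> near_max (base i (fst (f i))) (part (snd \<circ> snd \<circ> f) i n) x (tol n)) \<longleftrightarrow>
      (\<forall>i<n. \<zeta> i \<in> near_max (base i (fst (g i))) (part (snd \<circ> snd \<circ> g) i n) x (tol n))" for \<zeta> x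
    using assms by (simp add: *)
  ultimately show ?thesis by (simp add: stage_def)
qed

lemma stage_exists:
  assumes prev: "\<And>m. m < n \<Longrightarrow> stage f m (f m)"
  shows "\<exists>r. stage f n r"
\<comment> \<open>For \<open>n = 0\<close> the sum in \<open>objective\<close> is empty and
  \<open>k\<close> is missing from it; the starting point is \<open>xh\<close>, an exact minimizer
  of \<open>\<phi> + k\<close>.\<close>
proof (cases "n = 0")
  case True
  have "stage f n (xh, (\<lambda>_. 0), {0})"
    using True xh R_pos by (simp add: stage_def)
  then show ?thesis by blast
next
  case False
  define x where "x = fst \<circ> f"
  define \<zeta>s where "\<zeta>s m = fst (snd (f m))" for m
  define F where "F = snd \<circ> snd \<circ> f"
  have P: "stage f m (x m, \<zeta>s m, F m)" if "m < n" for m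
    using prev[OF that] by (simp add: x_def \<zeta>s_def F_def)
  have Fm: "finite (F m) \<and> F m \<noteq> {} \<and> F m \<subseteq> cball 0 R" if "m < n" for m
    using P[OF that] by (simp add: stage_def)
  have cs: "conjugate_smoothing (base i (x i)) R (rest 0) (part F i n')" if "n' \<le> n" for i n'
    using part_bounds[of n' F _ i] Fm that by (intro base_smoothing) auto
  \<comment> \<open>Each smoothing is at most \<open>rest 0\<close> below its base function, and
    apart from \<open>k\<close> the base functions are nonnegative. Minimality of \<open>xh\<close>
    then bounds the objective from below on \<open>D\<close>.\<close>
  have lower: "\<phi> xh + k xh - real n * rest 0 \<le> objective x F n y" if "y \<in> D" for y
  proof -
    have "(\<Sum>i<n. (if i = 0 then k y else 0) - rest 0) \<le> (\<Sum>i<n. smoothing (base i (x i)) (part F i n) y)"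
    proof (rule sum_mono)
      fix i
      have "(if i = 0 then k y else 0) \<le> base i (x i) y"
        using rate_pos[of i] by (simp add: base_def)
      then show "(if i = 0 then k y else 0) - rest 0 \<le> smoothing (base i (x i)) (part F i n) y"
        using conjugate_smoothing.smoothing_ge[OF cs[of n i], of y] by simp
    qed
    moreover have "(\<Sum>i<n. (if i = 0 then k y else 0) - rest 0) = k y - real n * rest 0"
      using False by (simp add: sum_subtractf)
    ultimately show ?thesis using min[OF that] by (simp add: objective_def)
  qed
  have "\<exists>x'\<in>D. \<forall>y\<in>D. objective x F n x' \<le> objective x F n y + tol n"
  proof -
    let ?m = "Inf (objective x F n ` D)"
    have bdd: "bdd_below (objective x F n ` D)" using lower by (intro bdd_belowI2)
    have "?m < ?m + tol n" using tol_pos by simp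
    then obtain x' where "x' \<in> D" "objective x F n x' < ?m + tol n"
      using cInf_lessD[of "objective x F n ` D"] xh by blast
    moreover have "?m \<le> objective x F n y" if "y \<in> D" for y
      using cInf_lower[OF _ bdd] that by simp
    ultimately show ?thesis by force
  qed
  then obtain x' where x': "x' \<in> D" "\<And>y. y \<in> D \<Longrightarrow> objective x F n x' \<le> objective x F n y + tol n" by blast
  have "\<exists>z. z \<in> near_max (base i (x i)) (part F i n) x' (tol n)" for i
    by (rule conjugate_smoothing.smoothing_approx[OF cs[of n i] tol_pos[of n], of x']) (auto simp: near_max_def)
  then obtain \<zeta> where \<zeta>: "\<And>i. \<zeta> i \<in> near_max (base i (x i)) (part F i n) x' (tol n)" by metis
  define A where "A = (\<Union>m<n. \<zeta>s m ` {..<m}) \<union> \<zeta> ` {..<n}"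
  have nA: "norm z \<le> R" if "z \<in> A" for z
  proof -
    have *: "norm z \<le> R" if "z \<in> near_max (base i (x i)) (part F i n') y e" "n' \<le> n" for z i n' y e
      using that conjugate_smoothing.minorant_norm[OF cs[OF that(2)]] by (auto simp: near_max_def)
    have "norm (\<zeta>s m i) \<le> R" if "m < n" "i < m" for m i
      using P[OF that(1)] that *[of "\<zeta>s m i" i m] by (auto simp: stage_def x_def F_def)
    then show ?thesis using that *[OF \<zeta>] by (auto simp: A_def)
  qed
  have "finite (insert 0 A)" by (simp add: A_def)
  then obtain F' where F': "finite F'" "F' \<subseteq> convex hull (insert 0 A)"
    "\<And>z. z \<in> convex hull (insert 0 A) \<Longrightarrow> \<exists>y\<in>F'. dist z y < 1 / real (Suc n)"
    using finite_hull_net[of "insert 0 A" "1 / real (Suc n)"] by (metis of_nat_0_less_iff zero_less_Suc zero_less_divide_1_iff)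
  have "0 \<in> convex hull (insert 0 A)" by (simp add: hull_inc)
  then have "F' \<noteq> {}" using F'(3) by blast
  moreover have "convex hull (insert 0 A) \<subseteq> cball 0 R"
    by (rule hull_minimal) (use nA R_pos in auto)
  moreover have "convex hull A \<subseteq> convex hull (insert 0 A)" by (intro hull_mono) auto
  ultimately have "stage f n (x', \<zeta>, F')"
    using x' \<zeta> F' False by (auto simp: stage_def A_def x_def F_def \<zeta>s_def)
  then show ?thesis by blast
qed

lemma stages:
  obtains x :: "nat \<Rightarrow> 'a" and \<zeta> :: "nat \<Rightarrow> nat \<Rightarrow> ('a \<Rightarrow>\<^sub>L real)" and F where
    "\<And>n. x n \<in> D" "x 0 = xh"
    "\<And>n y. n > 0 \<Longrightarrow> y \<in> D \<Longrightarrow> objective x F n (x n) \<le> objective x F n y + tol n"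
    "\<And>n i. i < n \<Longrightarrow> \<zeta> n i \<in> near_max (base i (x i)) (part F i n) (x n) (tol n)"
    "\<And>n. finite (F n) \<and> F n \<noteq> {} \<and> F n \<subseteq> cball 0 R"
    "\<And>n z. z \<in> convex hull (\<Union>m\<le>n. \<zeta> m ` {..<m}) \<Longrightarrow> \<exists>e\<in>F n. dist z e < 1 / real (Suc n)"
proof -
  have "\<exists>f. \<forall>n. stage f n (f n)"
  proof (rule dependent_wf_choice[OF wf_less_than])
    fix f g :: "nat \<Rightarrow> 'a \<times> (nat \<Rightarrow> ('a \<Rightarrow>\<^sub>L real)) \<times> ('a \<Rightarrow>\<^sub>L real) set" and n r
    assume "\<And>m. (m, n) \<in> less_than \<Longrightarrow> f m = g m"
    then show "stage f n r = stage g n r" by (intro stage_cong) simp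
  next
    fix n and f :: "nat \<Rightarrow> 'a \<times> (nat \<Rightarrow> ('a \<Rightarrow>\<^sub>L real)) \<times> ('a \<Rightarrow>\<^sub>L real) set"
    assume "\<And>m. (m, n) \<in> less_than \<Longrightarrow> stage f m (f m)"
    then show "\<exists>r. stage f n r" by (intro stage_exists) simp
  qed
  then obtain f where f: "\<And>n. stage f n (f n)" by blast
  define x where "x = fst \<circ> f"
  define \<zeta> where "\<zeta> n = fst (snd (f n))" for n
  define F where "F = snd \<circ> snd \<circ> f"
  have P: "stage f n (x n, \<zeta> n, F n)" for n
    using f by (simp add: x_def \<zeta>_def F_def)
  have U: "(\<Union>m\<le>n. \<zeta> m ` {..<m}) = (\<Union>m<n. \<zeta> m ` {..<m}) \<union> \<zeta> n ` {..<n}" for n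
  proof -
    have "{..n} = insert n {..<n}" by auto
    then show ?thesis by (simp add: Un_commute)
  qed
  show ?thesis
  proof (rule that[of x F \<zeta>])
    show "\<And>n z. z \<in> convex hull (\<Union>m\<le>n. \<zeta> m ` {..<m}) \<Longrightarrow> \<exists>e\<in>F n. dist z e < 1 / real (Suc n)"
      using P unfolding U by (auto simp: stage_def \<zeta>_def[symmetric])
  qed (use P in \<open>auto simp: stage_def x_def F_def\<close>)
qed

end

section \<open>The limit of the stages and its subgradient\<close>

locale perturbed_stages = perturbed_min D \<phi> k L \<eta> \<tau> xh
  for D :: "'a::banach set" and \<phi> k :: "'a \<Rightarrow> real" and L \<eta> \<tau> :: real and xh :: 'a +
  fixes x :: "nat \<Rightarrow> 'a" and \<zeta> :: "nat \<Rightarrow> nat \<Rightarrow> ('a \<Rightarrow>\<^sub>L real)" and F :: "nat \<Rightarrow> ('a \<Rightarrow>\<^sub>L real) set"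
  assumes x_in: "\<And>n. x n \<in> D" and x_0: "x 0 = xh"
    and x_min: "\<And>n y. n > 0 \<Longrightarrow> y \<in> D \<Longrightarrow> objective x F n (x n) \<le> objective x F n y + tol n"
    and near: "\<And>n i. i < n \<Longrightarrow> \<zeta> n i \<in> near_max (base i (x i)) (part F i n) (x n) (tol n)"
    and F: "\<And>n. finite (F n) \<and> F n \<noteq> {} \<and> F n \<subseteq> cball 0 R"
    and net: "\<And>n z. z \<in> convex hull (\<Union>m\<le>n. \<zeta> m ` {..<m}) \<Longrightarrow> \<exists>e\<in>F n. dist z e < 1 / real (Suc n)"
begin

sublocale N: net_penalties R weight F
  by (rule net_penaltiesI) (rule F)

abbreviation b where "b i \<equiv> base i (x i)"
abbreviation H where "H i \<equiv> N.tail_penalty i"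
abbreviation qn where "qn i n \<equiv> smoothing (b i) (part F i n)"
abbreviation q where "q i \<equiv> smoothing (b i) (H i)"

lemma part_nonneg: "norm z \<le> R \<Longrightarrow> 0 \<le> part F i n z"
  and part_le: "norm z \<le> R \<Longrightarrow> part F i n z \<le> rest 0"
  using part_bounds[of n F z i] F by auto

lemma part_le_tail: "norm z \<le> R \<Longrightarrow> part F i n z \<le> H i z"
  unfolding part_def by (rule N.partial_penalty_bounds(2))

lemma tail_le_part: "norm z \<le> R \<Longrightarrow> H i z \<le> part F i n z + rest n"
  unfolding part_def rest_def by (rule N.partial_penalty_bounds(3))

lemma H_nonneg: "norm z \<le> R \<Longrightarrow> 0 \<le> H i z"
  using part_nonneg[of z i 0] part_le_tail[of z i 0] by simp

lemma H_le: "norm z \<le> R \<Longrightarrow> H i z \<le> rest 0"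
  using tail_le_part[of z i 0] by (simp add: part_def)

lemma cs_part: "conjugate_smoothing (b i) R (rest 0) (part F i n)"
  "conjugate_smoothing (b i) ((if i = 0 then L else 0) + rate i) (rest 0) (part F i n)"
  using base_smoothing[of "part F i n" "rest 0" i "x i"] part_nonneg part_le by auto

lemma cs_tail: "conjugate_smoothing (b i) R (rest 0) (H i)"
  "conjugate_smoothing (b i) ((if i = 0 then L else 0) + rate i) (rest 0) (H i)"
  using base_smoothing[of "H i" "rest 0" i "x i"] H_nonneg H_le by auto

lemma q_le_qn: "q i y \<le> qn i n y"
  using conjugate_smoothing.smoothing_mono[OF cs_part(1)[of i n] cs_tail(1), of 0 y] part_le_tail by simp

lemma qn_le_q: "qn i n y - rest n \<le> q i y"
  using conjugate_smoothing.smoothing_mono[OF cs_tail(1)[of i] cs_part(1), of n "rest n" y] tail_le_part by simp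

lemma q_lip: "q i y - q i y' \<le> R * norm (y - y')"
  by (rule conjugate_smoothing.smoothing_lip[OF cs_tail(1)])

lemma qn_rate_lip: "i > 0 \<Longrightarrow> qn i n y - qn i n y' \<le> rate i * norm (y - y')"
  using conjugate_smoothing.smoothing_lip[OF cs_part(2)[of i n], of y y'] by simp

lemma qn_Suc_le: "qn i (Suc n) y \<le> qn i n y"
  using conjugate_smoothing.smoothing_mono[OF cs_part(1)[of i n] cs_part(1)[of i "Suc n"], of 0 y]
    N.penalty_nonneg by (simp add: part_def)

lemma qn_Suc_ge: "qn i n y - weight n \<le> qn i (Suc n) y"
  using conjugate_smoothing.smoothing_mono[OF cs_part(1)[of i "Suc n"] cs_part(1)[of i n], of "weight n" y]
    N.penalty_le by (simp add: part_def)

text \<open>By the delay, no penalty of index below \<open>n\<close> acts on the \<open>n\<close>-th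
  smoothing. A new perturbation therefore enters unsmoothed, and its error stems only from the small
  penalties from index \<open>n\<close> on.\<close>

lemma qn_diag: "qn n n y = b n y"
proof -
  have *: "part F n n = (\<lambda>_. 0)" by (auto simp: part_def delayed_penalty_def fun_eq_iff)
  show ?thesis
    using smoothing_zero[of "b n" R "rest 0" y] cs_part(1)[of n n] unfolding * by simp
qed

definition obj where "obj n y = (if n = 0 then \<phi> y + k y else objective x F n y)"

lemma obj_min: "y \<in> D \<Longrightarrow> obj n (x n) \<le> obj n y + tol n"
  using x_min[of n y] min[of y] tol_pos[of 0] x_0 by (cases "n = 0") (auto simp: obj_def)

lemma obj_Suc_le: "obj (Suc n) y \<le> obj n y + rate n * norm (y - x n)"
proof (cases "n = 0")
  case True
  then show ?thesis
    using qn_Suc_le[of 0 0 y] qn_diag[of 0 y] by (simp add: obj_def objective_def base_def)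
next
  case False
  have "(\<Sum>i<n. qn i (Suc n) y) \<le> (\<Sum>i<n. qn i n y)" by (intro sum_mono qn_Suc_le)
  then show ?thesis
    using qn_Suc_le[of n n y] qn_diag[of n y] False by (simp add: obj_def objective_def base_def)
qed

text \<open>The factor \<open>Suc n\<close> counts the \<open>n\<close> smoothings already present
  and the new one; the penalty of index \<open>n\<close> lowers each by at most
  \<open>weight n\<close>.\<close>

lemma obj_Suc_ge: "obj n y + rate n * norm (y - x n) - real (Suc n) * weight n \<le> obj (Suc n) y"
proof (cases "n = 0")
  case True
  then show ?thesis
    using qn_Suc_ge[of 0 0 y] qn_diag[of 0 y] by (simp add: obj_def objective_def base_def)
next
  case False
  have "(\<Sum>i<n. qn i n y - weight n) \<le> (\<Sum>i<n. qn i (Suc n) y)" by (intro sum_mono qn_Suc_ge)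
  then show ?thesis
    using qn_Suc_ge[of n n y] qn_diag[of n y] False
    by (simp add: obj_def objective_def base_def sum_subtractf algebra_simps)
qed

text \<open>Near-minimality of \<open>x n\<close> at stage \<open>n\<close> is played against that
  of \<open>x (Suc n)\<close> at the next stage: the new term \<open>rate n * |y - x n|\<close>
  vanishes at \<open>x n\<close> but has to be paid at \<open>x (Suc n)\<close>.\<close>

lemma step: "norm (x (Suc n) - x n) \<le> 3 * (\<tau> / \<eta>) * (1/4)^n"
proof -
  have "obj n (x n) + rate n * norm (x (Suc n) - x n) - real (Suc n) * weight n \<le> obj (Suc n) (x (Suc n)) + tol n"
    using obj_Suc_ge[of n "x (Suc n)"] obj_min[OF x_in, of n "Suc n"] by linarith
  also have "\<dots> \<le> obj (Suc n) (x n) + tol (Suc n) + tol n"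
    using obj_min[OF x_in, of "Suc n" n] by simp
  also have "\<dots> \<le> obj n (x n) + tol (Suc n) + tol n"
    using obj_Suc_le[of n "x n"] by simp
  finally have 1: "rate n * norm (x (Suc n) - x n) \<le> real (Suc n) * weight n + tol (Suc n) + tol n"
    by simp
  have "real (Suc n) \<le> 2 ^ n"
    by (metis Suc_leI less_exp numeral_power_eq_of_nat_cancel_iff of_nat_le_iff of_nat_numeral of_nat_power)
  then have "real (Suc n) * weight n \<le> 2 ^ n * weight n"
    using weight_pos[of n] by (intro mult_right_mono) auto
  also have "\<dots> = tol n" by (simp add: weight_def tol_def power_mult_distrib[symmetric])
  finally have "rate n * norm (x (Suc n) - x n) \<le> 3 * tol n"
    using 1 tol_pos[of n] by (simp add: tol_def)
  moreover have "rate n * (3 * (\<tau> / \<eta>) * (1/4)^n) = 3 * tol n"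
    using \<eta> by (simp add: rate_def tol_def power_mult_distrib[symmetric])
  ultimately have "rate n * norm (x (Suc n) - x n) \<le> rate n * (3 * (\<tau> / \<eta>) * (1/4)^n)" by simp
  then show ?thesis using rate_pos[of n] by (simp only: mult_le_cancel_left_pos)
qed

lemma limit_exists: "\<exists>l. x \<longlonglongrightarrow> l \<and> (\<forall>n. norm (x n - l) \<le> 4 * (\<tau> / \<eta>) * (1/4)^n)"
  by (rule geometric_limit[OF step]) blast

definition xb where "xb = (SOME l. x \<longlonglongrightarrow> l \<and> (\<forall>n. norm (x n - l) \<le> 4 * (\<tau> / \<eta>) * (1/4)^n))"

lemma x_lim: "x \<longlonglongrightarrow> xb" and x_rate: "norm (x n - xb) \<le> 4 * (\<tau> / \<eta>) * (1/4)^n"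
  using someI_ex[OF limit_exists] unfolding xb_def[symmetric] by auto

lemma xb_near: "norm (xb - xh) \<le> 4 * (\<tau> / \<eta>)"
  using x_rate[of 0] by (simp add: x_0 norm_minus_commute)

lemma rest_lim: "rest \<longlonglongrightarrow> 0"
  unfolding rest_eq[abs_def] by (intro tendsto_mult_right_zero LIMSEQ_power_zero) simp

lemma tol_lim: "tol \<longlonglongrightarrow> 0"
  unfolding tol_def[abs_def] by (intro tendsto_mult_right_zero LIMSEQ_power_zero) simp

lemma dist_lim: "(\<lambda>n. norm (x n - xb)) \<longlonglongrightarrow> 0"
  using x_lim by (simp add: LIM_zero_iff tendsto_norm_zero_iff)

lemma sum_rate_le: "(\<Sum>i\<in>{N..<n}. rate i) \<le> 2 * rate N"
proof (cases "N \<le> n")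
  case True
  then have "(\<Sum>i\<in>{N..<n}. rate i) = 2 * rate N - 2 * rate n"
    by (induction rule: dec_induct) (simp_all add: rate_def)
  then show ?thesis using rate_pos[of n] by simp
qed (use rate_pos[of N] in simp)

text \<open>In substance \<open>xb\<close> minimizes \<open>\<phi>\<close> plus the sum of all
  \<open>q i\<close>. That series is never formed: its terms from \<open>N\<close> on are replaced
  by Lipschitz bounds, whose rates sum to at most \<open>2 * rate N\<close>.\<close>

lemma limit_min:
  assumes y: "y \<in> D" and N: "N > 0"
  shows "xb \<in> D" "\<phi> xb \<le> \<phi> y + (\<Sum>i<N. q i y - q i xb) + 2 * rate N * norm (y - xb)"
proof -
  define c where "c n = \<phi> y + tol n + (\<Sum>i<N. q i y - q i xb) + real N * (rest n + R * norm (x n - xb))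
    + 2 * rate N * (norm (y - xb) + norm (x n - xb))" for n
  let ?c = "\<phi> y + (\<Sum>i<N. q i y - q i xb) + 2 * rate N * norm (y - xb)"
  have "c \<longlonglongrightarrow> \<phi> y + 0 + (\<Sum>i<N. q i y - q i xb) + real N * (0 + R * 0) + 2 * rate N * (norm (y - xb) + 0)"
    unfolding c_def[abs_def] by (intro tendsto_intros rest_lim tol_lim dist_lim)
  then have c: "c \<longlonglongrightarrow> ?c" by simp
  have bound: "\<phi> (x n) \<le> c n" if n: "n \<ge> N" for n
  proof -
    have "\<phi> (x n) + (\<Sum>i<n. qn i n (x n)) \<le> \<phi> y + (\<Sum>i<n. qn i n y) + tol n"
      using x_min[OF _ y, of n] n N by (simp add: objective_def)
    moreover have "(\<Sum>i<n. qn i n y - qn i n (x n)) =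
        (\<Sum>i<N. qn i n y - qn i n (x n)) + (\<Sum>i\<in>{N..<n}. qn i n y - qn i n (x n))"
      using n by (simp add: sum.atLeastLessThan_concat[of 0 N n, symmetric] atLeast0LessThan[symmetric])
    moreover have "(\<Sum>i<N. qn i n y - qn i n (x n)) \<le> (\<Sum>i<N. q i y - q i xb + (rest n + R * norm (x n - xb)))"
    proof (rule sum_mono)
      fix i
      show "qn i n y - qn i n (x n) \<le> q i y - q i xb + (rest n + R * norm (x n - xb))"
        using qn_le_q[of i n y] q_le_qn[of i "x n" n] q_lip[of i xb "x n"] by (simp add: norm_minus_commute)
    qed
    moreover have "(\<Sum>i\<in>{N..<n}. qn i n y - qn i n (x n)) \<le> (\<Sum>i\<in>{N..<n}. rate i * norm (y - x n))"
      using N by (intro sum_mono qn_rate_lip) auto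
    moreover have "(\<Sum>i\<in>{N..<n}. rate i * norm (y - x n)) \<le> 2 * rate N * (norm (y - xb) + norm (x n - xb))"
    proof -
      have "(\<Sum>i\<in>{N..<n}. rate i * norm (y - x n)) = (\<Sum>i\<in>{N..<n}. rate i) * norm (y - x n)"
        by (simp add: sum_distrib_right)
      also have "\<dots> \<le> 2 * rate N * (norm (y - xb) + norm (x n - xb))"
        using norm_triangle_ineq4[of "y - xb" "x n - xb"] rate_pos[of N] sum_rate_le[of N n]
        by (intro mult_mono) auto
      finally show ?thesis .
    qed
    ultimately show ?thesis
      by (simp add: c_def sum.distrib sum_subtractf)
  qed
  have lim: "xb \<in> D \<and> \<phi> xb \<le> c'" if c': "c' > ?c" for c'
  proof -
    obtain M where M: "\<And>n. n \<ge> M \<Longrightarrow> c n < c'"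
      using order_tendstoD(2)[OF c c'] unfolding eventually_sequentially by blast
    show ?thesis
    proof (rule lsc[of "\<lambda>n. x (n + max M N)"])
      show "\<phi> (x (n + max M N)) \<le> c'" for n
      proof -
        have "M \<le> n + max M N" "N \<le> n + max M N" by auto
        then show ?thesis using M bound by (meson less_imp_le order_trans)
      qed
    qed (use x_in LIMSEQ_ignore_initial_segment[OF x_lim] in auto)
  qed
  show "xb \<in> D" using lim[of "?c + 1"] by simp
  show "\<phi> xb \<le> ?c" by (rule field_le_epsilon) (use lim in auto)
qed

text \<open>A point of the hull lies in the hull of finitely many recorded functionals, and all
  later nets approximate it with precision tending to 0. So the nets from index \<open>i\<close> on
  suffice, and these are the ones that the \<open>i\<close>-th smoothing contains.\<close>

lemma closure_net: 
  "closure (convex hull (range (\<lambda>n. \<zeta> (n + Suc i) i))) \<subseteq> closure (\<Union>m\<in>{i..}. F m)"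
proof (rule closure_minimal[OF _ closed_closure], rule subsetI)
  fix z assume z: "z \<in> convex hull (range (\<lambda>n. \<zeta> (n + Suc i) i))"
  define A where "A n = (\<Union>m\<le>n. \<zeta> m ` {..<m})" for n
  have "incseq A"
    unfolding A_def incseq_def by (intro allI impI UN_mono) auto
  moreover have "range (\<lambda>n. \<zeta> (n + Suc i) i) \<subseteq> (\<Union>n. A n)"
    by (force simp: A_def)
  then have "z \<in> convex hull (\<Union>n. A n)" using z hull_mono by blast
  ultimately obtain n0 where n0: "z \<in> convex hull (A n0)"
    using convex_hull_incseq by blast
  show "z \<in> closure (\<Union>m\<in>{i..}. F m)"
    unfolding closure_approachable
  proof (intro allI impI)
    fix e :: real assume "e > 0"
    then obtain n1 where n1: "1 / real (Suc n1) < e" using nat_approx_posE by blast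
    define n where "n = max (max n0 n1) i"
    have "A n0 \<subseteq> A n" using \<open>incseq A\<close> by (simp add: incseq_def n_def)
    then have "z \<in> convex hull (A n)" using n0 hull_mono by blast
    then obtain y where y: "y \<in> F n" "dist z y < 1 / real (Suc n)"
      using net unfolding A_def by blast
    have "1 / real (Suc n) \<le> 1 / real (Suc n1)"
      by (intro divide_left_mono) (auto simp: n_def)
    then show "\<exists>y\<in>\<Union>m\<in>{i..}. F m. dist y z < e"
      using y n1 by (intro bexI[of _ y]) (auto simp: dist_commute n_def)
  qed
qed

lemma maximizer_exists:
  "\<exists>g. g \<in> near_max (b i) (H i) xb 0 \<and>
    (\<forall>e>0. \<exists>d>0. \<forall>v. norm v < d \<longrightarrow> q i (xb + v) \<le> q i xb + blinfun_apply g v + e * norm v)"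
proof -
  interpret S: conjugate_smoothing "b i" R "rest 0" "H i" by (rule cs_tail)
  \<comment> \<open>Passing from the partial to the full penalty costs \<open>rest n\<close>. Moving
    from \<open>x n\<close> to \<open>xb\<close> costs \<open>R * |x n - xb|\<close> in the affine
    function and the same again in the smoothing.\<close>
  have c: "\<zeta> n i \<in> near_max (b i) (H i) xb (tol n + rest n + 2 * R * norm (x n - xb))" if i: "i < n" for n
  proof -
    obtain \<beta> where \<beta>: "(\<zeta> n i, \<beta>) \<in> minorants (b i)"
      "qn i n (x n) - tol n \<le> blinfun_apply (\<zeta> n i) (x n) + \<beta> - part F i n (\<zeta> n i)"
      using near[OF i] by (auto simp: near_max_def)
    have "H i (\<zeta> n i) \<le> part F i n (\<zeta> n i) + rest n"
      by (rule tail_le_part[OF S.minorant_norm[OF \<beta>(1)]])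
    moreover have "blinfun_apply (\<zeta> n i) (x n) - blinfun_apply (\<zeta> n i) xb \<le> R * norm (x n - xb)"
      using S.minorant_lip[OF \<beta>(1), of "x n - xb"] by (simp add: blinfun.diff_right)
    moreover have "q i xb - R * norm (x n - xb) \<le> qn i n (x n)"
      using q_le_qn[of i "x n" n] q_lip[of i xb "x n"] by (simp add: norm_minus_commute)
    ultimately have "q i xb - (tol n + rest n + 2 * R * norm (x n - xb)) \<le> blinfun_apply (\<zeta> n i) xb + \<beta> - H i (\<zeta> n i)"
      using \<beta>(2) by linarith
    then show ?thesis using \<beta>(1) by (auto simp: near_max_def)
  qed
  \<comment> \<open>Near-maximizers of the \<open>i\<close>-th smoothing are recorded only at stages
    after \<open>i\<close>; hence the shift.\<close>
  define u where "u n = \<zeta> (n + Suc i) i" for n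
  have bd: "norm (u n) \<le> R" for n
    using c[of "n + Suc i"] S.minorant_norm by (auto simp: u_def near_max_def)
  have ev: "\<forall>\<^sub>F n in sequentially. u n \<in> near_max (b i) (H i) xb e" if "e > 0" for e
  proof -
    have "(\<lambda>n. tol n + rest n + 2 * R * norm (x n - xb)) \<longlonglongrightarrow> 0 + 0 + 2 * R * 0"
      by (intro tendsto_intros tol_lim rest_lim dist_lim)
    then have "(\<lambda>n. tol (n + Suc i) + rest (n + Suc i) + 2 * R * norm (x (n + Suc i) - xb)) \<longlonglongrightarrow> 0"
      using LIMSEQ_ignore_initial_segment[of _ 0 "Suc i"] by fastforce
    then have "\<forall>\<^sub>F n in sequentially. tol (n + Suc i) + rest (n + Suc i) + 2 * R * norm (x (n + Suc i) - xb) < e"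
      using that by (rule order_tendstoD(2))
    then show ?thesis
    proof (rule eventually_mono)
      fix n assume "tol (n + Suc i) + rest (n + Suc i) + 2 * R * norm (x (n + Suc i) - xb) < e"
      then show "u n \<in> near_max (b i) (H i) xb e"
        using c[of "n + Suc i"] unfolding u_def near_max_def by fastforce
    qed
  qed
  obtain g where g: "g \<in> near_max (b i) (H i) xb 0" "\<And>n. g \<in> closure (convex hull (u ` {n..}))"
    using S.maximizer_in_tail_hulls[OF refl N.convex_on_tail_penalty N.continuous_on_tail_penalty bd ev] by blast
  have cl: "g \<in> closure (\<Union>m\<in>{i..}. F m)"
    using g(2)[of 0] closure_net[of i] by (auto simp: u_def[abs_def])
  have strong: "\<exists>d>0. \<forall>z'\<in>near_max (b i) (H i) xb d. norm (z' - g) < e" if "e > 0" for e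
    by (rule S.strong_maximizer[OF g(1) cl _ that]) (use N.tail_penalty_gap in auto)
  have "\<exists>d>0. \<forall>v. norm v < d \<longrightarrow> q i (xb + v) \<le> q i xb + blinfun_apply g v + e * norm v" if "e > 0" for e
    by (rule S.smoothing_frechet_upper[OF strong that]) auto
  with g(1) show ?thesis by blast
qed

definition g where "g i = (SOME g. g \<in> near_max (b i) (H i) xb 0 \<and>
    (\<forall>e>0. \<exists>d>0. \<forall>v. norm v < d \<longrightarrow> q i (xb + v) \<le> q i xb + blinfun_apply g v + e * norm v))"

lemma g_max: "g i \<in> near_max (b i) (H i) xb 0"
  and g_upper: "e > 0 \<Longrightarrow> \<exists>d>0. \<forall>v. norm v < d \<longrightarrow> q i (xb + v) \<le> q i xb + blinfun_apply (g i) v + e * norm v"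
  using someI_ex[OF maximizer_exists[of i]] unfolding g_def[symmetric] by auto

lemma norm_g: "i > 0 \<Longrightarrow> norm (g i) \<le> rate i"
  using conjugate_smoothing.minorant_norm[OF cs_tail(2)[of i]] g_max[of i] by (auto simp: near_max_def)

lemma norm_g_0: "norm (g 0) \<le> R"
  using conjugate_smoothing.minorant_norm[OF cs_tail(1)[of 0]] g_max[of 0] by (auto simp: near_max_def)

lemma summable_rate: "summable rate"
  unfolding rate_def[abs_def] by (intro summable_mult summable_geometric) simp

lemma summable_g: "summable g"
  by (rule summable_comparison_test'[OF summable_rate, of 1]) (use norm_g in auto)

text \<open>Formally the derivative at \<open>xb\<close> of the sum of all
  \<open>q i\<close>.\<close>

definition G where "G = suminf g"

lemma G_split:
  assumes "N > 0"
  shows "\<bar>blinfun_apply G v - (\<Sum>i<N. blinfun_apply (g i) v)\<bar> \<le> 2 * rate N * norm v"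
proof -
  have sr: "summable (\<lambda>i. rate (i + N))" by (rule summable_ignore_initial_segment[OF summable_rate])
  have "G = (\<Sum>i. g (i + N)) + (\<Sum>i<N. g i)"
    unfolding G_def by (rule suminf_split_initial_segment[OF summable_g])
  then have "blinfun_apply G v - (\<Sum>i<N. blinfun_apply (g i) v) = blinfun_apply (\<Sum>i. g (i + N)) v"
    by (simp add: blinfun.add_left blinfun.sum_left)
  moreover have "norm (\<Sum>i. g (i + N)) \<le> (\<Sum>i. rate (i + N))"
    by (rule norm_suminf_le[OF _ sr]) (use norm_g assms in auto)
  moreover have "(\<Sum>i. rate (i + N)) = 2 * rate N"
  proof -
    have "(\<Sum>i. rate (i + N)) = (\<Sum>i. rate N * (1/2)^i)"
      by (simp add: rate_def power_add mult_ac)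
    also have "\<dots> = rate N * (\<Sum>i. (1/2)^i)" by (rule suminf_mult) (simp add: summable_geometric)
    also have "\<dots> = 2 * rate N" by (subst suminf_geometric) auto
    finally show ?thesis .
  qed
  ultimately show ?thesis
    using norm_blinfun[of "\<Sum>i. g (i + N)" v] mult_right_mono[of "norm (\<Sum>i. g (i + N))" "2 * rate N" "norm v"]
    by simp
qed

text \<open>The first \<open>N\<close> smoothings are expanded with error \<open>e / (2 * N)\<close>
  each. The two tails, in \<open>limit_min\<close> and in \<open>G\<close>, cost
  \<open>2 * rate N\<close> each, and \<open>rate N < e / 8\<close> keeps them below
  \<open>e / 2\<close> together.\<close>

lemma frechet:
  assumes e: "e > 0"
  shows "\<exists>d>0. \<forall>v. norm v < d \<longrightarrow> xb + v \<in> D \<longrightarrow> \<phi> xb - blinfun_apply G v - e * norm v \<le> \<phi> (xb + v)"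
proof -
  have "rate \<longlonglongrightarrow> 0" by (rule summable_LIMSEQ_zero[OF summable_rate])
  then have "\<forall>\<^sub>F n in sequentially. rate n < e / 8" using e by (intro order_tendstoD(2)) auto
  then obtain N0 where "\<And>n. n \<ge> N0 \<Longrightarrow> rate n < e / 8" unfolding eventually_sequentially by blast
  then obtain N where N: "N > 0" "rate N < e / 8" by (meson lessI less_imp_le less_Suc_eq_le not_less_eq zero_less_Suc)
  have "\<exists>d>0. \<forall>v. norm v < d \<longrightarrow> q i (xb + v) \<le> q i xb + blinfun_apply (g i) v + e / (2 * real N) * norm v" for i
    using g_upper[of "e / (2 * real N)" i] e N by simp
  then obtain d where d: "\<And>i. d i > 0"
    "\<And>i v. norm v < d i \<Longrightarrow> q i (xb + v) \<le> q i xb + blinfun_apply (g i) v + e / (2 * real N) * norm v"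
    by metis
  define d' where "d' = Min (d ` {..<N})"
  have "d' > 0" using d(1) N by (simp add: d'_def lessThan_empty_iff)
  moreover have "\<phi> xb - blinfun_apply G v - e * norm v \<le> \<phi> (xb + v)" if v: "norm v < d'" "xb + v \<in> D" for v
  proof -
    have "\<phi> xb \<le> \<phi> (xb + v) + (\<Sum>i<N. q i (xb + v) - q i xb) + 2 * rate N * norm v"
      using limit_min(2)[OF v(2) N(1)] by simp
    also have "(\<Sum>i<N. q i (xb + v) - q i xb) \<le> (\<Sum>i<N. blinfun_apply (g i) v + e / (2 * real N) * norm v)"
    proof (rule sum_mono)
      fix i assume "i \<in> {..<N}"
      then have "norm v < d i" using v(1) N unfolding d'_def by (subst (asm) Min_gr_iff) (auto simp: lessThan_empty_iff)
      then show "q i (xb + v) - q i xb \<le> blinfun_apply (g i) v + e / (2 * real N) * norm v"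
        using d(2)[of v i] by simp
    qed
    also have "\<dots> = (\<Sum>i<N. blinfun_apply (g i) v) + e / 2 * norm v"
      using N by (simp add: sum.distrib)
    also have "\<dots> \<le> blinfun_apply G v + 2 * rate N * norm v + e / 2 * norm v"
      using G_split[OF N(1), of v] by simp
    finally have "\<phi> xb \<le> \<phi> (xb + v) + blinfun_apply G v + (4 * rate N) * norm v + e / 2 * norm v"
      by (simp add: algebra_simps)
    moreover have "(4 * rate N) * norm v \<le> e / 2 * norm v"
      using N by (intro mult_right_mono) auto
    ultimately show ?thesis by simp
  qed
  ultimately show ?thesis by blast
qed

lemma q_0_bounds: "k y - rest 0 \<le> q 0 y" "q 0 y \<le> k y + \<eta> * norm (y - xh)"
proof -
  have "b 0 y = k y + \<eta> * norm (y - xh)" by (simp add: base_def rate_def x_0)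
  moreover have "0 \<le> \<eta> * norm (y - xh)" using \<eta> by simp
  ultimately show "k y - rest 0 \<le> q 0 y" "q 0 y \<le> k y + \<eta> * norm (y - xh)"
    using conjugate_smoothing.smoothing_ge[OF cs_tail(1)[of 0], of y]
      conjugate_smoothing.smoothing_le[OF cs_tail(1)[of 0], of y] by linarith+
qed

lemma k_near: "\<bar>k xb - k xh\<bar> \<le> L * (4 * (\<tau> / \<eta>))"
  using k_lip[of xb xh] k_lip[of xh xb] mult_left_mono[OF xb_near L] by (simp add: norm_minus_commute)

lemma \<phi>_near: "\<bar>\<phi> xb - \<phi> xh\<bar> \<le> 4 * L * \<tau> / \<eta> + 6 * \<tau>"
proof -
  \<comment> \<open>The constant 6 arises from \<open>N = 1\<close>: the tail contributes at most
    \<open>4 * \<tau>\<close>, and the smoothing error of \<open>q 0\<close> at most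
    \<open>2 * \<tau>\<close>.\<close>
  have "\<phi> xb \<le> \<phi> xh + (q 0 xh - q 0 xb) + 2 * rate 1 * norm (xh - xb)"
    using limit_min(2)[OF xh, of 1] by simp
  moreover have "2 * rate 1 * norm (xh - xb) \<le> 4 * \<tau>"
    using mult_left_mono[OF xb_near, of \<eta>] \<eta> by (simp add: rate_def norm_minus_commute)
  moreover have "q 0 xh \<le> k xh" "k xb - rest 0 \<le> q 0 xb"
    using q_0_bounds(2)[of xh] q_0_bounds(1)[of xb] by simp_all
  moreover have "rest 0 \<le> 2 * \<tau>" using \<tau> by (simp add: rest_eq)
  moreover have "\<phi> xh + k xh \<le> \<phi> xb + k xb" by (rule min[OF limit_min(1)[OF xh zero_less_one]])
  moreover have "L * (4 * (\<tau> / \<eta>)) = 4 * L * \<tau> / \<eta>" by simp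
  ultimately show ?thesis using k_near \<tau> by linarith
qed

text \<open>\<open>g 0\<close> is the slope of an affine minorant of
  \<open>k y + \<eta> |y - xh|\<close> that nearly touches it at \<open>xb\<close>. The other slopes
  add a second \<open>\<eta>\<close>, since \<open>2 * rate 1 = \<eta>\<close>. The constant terms
  come from the smoothing error and from moving the point of contact from \<open>xb\<close> to
  \<open>xh\<close>.\<close>

lemma G_subgradient:
  "blinfun_apply G (y - xh) \<le> k y - k xh + 2 * \<eta> * norm (y - xh) + 6 * \<tau> + 8 * L * \<tau> / \<eta>"
proof -
  obtain \<beta> where \<beta>: "(g 0, \<beta>) \<in> minorants (b 0)" "q 0 xb \<le> blinfun_apply (g 0) xb + \<beta> - H 0 (g 0)"
    using g_max[of 0] by (auto simp: near_max_def)
  define a where "a = L * (4 * (\<tau> / \<eta>))"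
  have "blinfun_apply (g 0) y + \<beta> \<le> k y + \<eta> * norm (y - xh)"
    using \<beta>(1) by (auto simp: minorants_def base_def rate_def x_0)
  moreover have "k xb - rest 0 \<le> blinfun_apply (g 0) xb + \<beta>"
    using \<beta>(2) q_0_bounds(1)[of xb] H_nonneg[OF norm_g_0, of 0] by linarith
  moreover have "blinfun_apply (g 0) xb - blinfun_apply (g 0) xh \<le> a + 4 * \<tau>"
  proof -
    have "blinfun_apply (g 0) (xb - xh) \<le> R * (4 * (\<tau> / \<eta>))"
      using norm_blinfun[of "g 0" "xb - xh"] mult_mono[OF norm_g_0 xb_near] R_pos by simp
    also have "\<dots> = a + 4 * \<tau>" using \<eta> by (simp add: R_def a_def field_simps)
    finally show ?thesis by (simp add: blinfun.diff_right)
  qed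
  moreover have "rest 0 \<le> 2 * \<tau>" using \<tau> by (simp add: rest_eq)
  moreover have "\<bar>k xb - k xh\<bar> \<le> a" using k_near by (simp add: a_def)
  ultimately have "blinfun_apply (g 0) y - blinfun_apply (g 0) xh \<le> k y - k xh + \<eta> * norm (y - xh) + 6 * \<tau> + 2 * a"
    by linarith
  moreover have "2 * a = 8 * L * \<tau> / \<eta>" by (simp add: a_def)
  ultimately have "blinfun_apply (g 0) (y - xh) \<le> k y - k xh + \<eta> * norm (y - xh) + 6 * \<tau> + 8 * L * \<tau> / \<eta>"
    by (simp add: blinfun.diff_right)
  moreover have "blinfun_apply G (y - xh) \<le> blinfun_apply (g 0) (y - xh) + \<eta> * norm (y - xh)"
    using G_split[of 1 "y - xh"] by (simp add: rate_def)
  ultimately show ?thesis by simp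
qed

end

text \<open>A fuzzy sum rule: \<open>- G\<close> is a Frechet subgradient of \<open>\<phi>\<close>
  near \<open>xh\<close>, and \<open>G\<close> is an approximate subgradient of \<open>k\<close> at
  \<open>xh\<close> itself. All errors vanish as \<open>\<eta>\<close> and
  \<open>\<tau> / \<eta>\<close> tend to 0.\<close>

theorem (in perturbed_min) approximate_subgradients:
  "\<exists>x\<in>D. \<exists>G. norm (x - xh) \<le> 4 * (\<tau> / \<eta>) \<and> \<bar>\<phi> x - \<phi> xh\<bar> \<le> 4 * L * \<tau> / \<eta> + 6 * \<tau> \<and>
    (\<forall>e>0. \<exists>d>0. \<forall>v. norm v < d \<longrightarrow> x + v \<in> D \<longrightarrow> \<phi> x - blinfun_apply G v - e * norm v \<le> \<phi> (x + v)) \<and>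
    (\<forall>y. blinfun_apply G (y - xh) \<le> k y - k xh + 2 * \<eta> * norm (y - xh) + 6 * \<tau> + 8 * L * \<tau> / \<eta>)"
proof -
  have "\<exists>x \<zeta> F. perturbed_stages D \<phi> k L \<eta> \<tau> xh x \<zeta> F"
    by (rule stages, intro exI perturbed_stages.intro perturbed_stages_axioms.intro perturbed_min_axioms)
  then obtain x \<zeta> F where "perturbed_stages D \<phi> k L \<eta> \<tau> xh x \<zeta> F" by blast
  then interpret S: perturbed_stages D \<phi> k L \<eta> \<tau> xh x \<zeta> F .
  show ?thesis
    by (intro bexI[of _ S.xb] exI[of _ S.G] conjI allI impI S.xb_near S.\<phi>_near S.frechet S.G_subgradient
        S.limit_min(1)[OF xh zero_less_one])
qed

section \<open>Limiting sum rule and Ekeland's principle\<close>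

text \<open>Points \<open>x + v\<close> with infinite value may be left out of \<open>est\<close>,
  because there the difference quotient is infinite.\<close>

lemma frechet_subdiffI:
  fixes \<nu> :: "'a::real_normed_vector \<Rightarrow> ereal"
  assumes nonneg: "\<And>y. 0 \<le> \<nu> y" and fin: "\<nu> x \<noteq> \<infinity>"
    and est: "\<And>e. e > 0 \<Longrightarrow> \<exists>d>0. \<forall>v. norm v < d \<longrightarrow> \<nu> (x + v) \<noteq> \<infinity> \<longrightarrow>
      real_of_ereal (\<nu> x) + blinfun_apply u v - e * norm v \<le> real_of_ereal (\<nu> (x + v))"
  shows "u \<in> frechet_subdiff \<nu> x"
proof -
  obtain r where r: "\<nu> x = ereal r" using nonneg[of x] fin by (cases "\<nu> x") auto
  have "0 \<le> Liminf (at 0) (\<lambda>v. (\<nu> (x + v) - \<nu> x - ereal (blinfun_apply u v)) / ereal (norm v))"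
    unfolding le_Liminf_iff
  proof (intro allI impI)
    fix y :: ereal assume "y < 0"
    then obtain s where s: "y < ereal s" "s < 0"
      using ereal_dense2[of y 0] by auto
    then obtain d where d: "d > 0" "\<And>v. norm v < d \<Longrightarrow> \<nu> (x + v) \<noteq> \<infinity> \<Longrightarrow>
        real_of_ereal (\<nu> x) + blinfun_apply u v - (- s) * norm v \<le> real_of_ereal (\<nu> (x + v))"
      using est[of "- s"] by auto
    have "y < (\<nu> (x + v) - \<nu> x - ereal (blinfun_apply u v)) / ereal (norm v)" if v: "v \<noteq> 0" "norm v < d" for v
    proof (cases "\<nu> (x + v)")
      case (real t)
      have "s * norm v \<le> t - r - blinfun_apply u v"
        using d(2)[OF v(2)] by (simp add: real r)
      then have "s \<le> (t - r - blinfun_apply u v) / norm v"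
        using v(1) by (simp add: pos_le_divide_eq)
      then show ?thesis
        using s(1) v(1) by (simp add: real r) (meson ereal_less_eq(3) less_le_trans)
    next
      case PInf
      then show ?thesis using s(1) v(1) by (auto simp: r)
    next
      case MInf
      then show ?thesis using nonneg[of "x + v"] by simp
    qed
    then show "\<forall>\<^sub>F v in at 0. y < (\<nu> (x + v) - \<nu> x - ereal (blinfun_apply u v)) / ereal (norm v)"
      unfolding eventually_at using d(1) by (auto simp: dist_norm intro!: exI[of _ d])
  qed
  then show ?thesis using r by (simp add: frechet_subdiff_def)
qed

theorem limiting_sum_rule:
  fixes \<nu> :: "'a::banach \<Rightarrow> ereal" and k :: "'a \<Rightarrow> real"
  assumes refl: "reflexive_space TYPE('a)"
    and nonneg: "\<And>y. 0 \<le> \<nu> y" and fin: "\<nu> xh \<noteq> \<infinity>"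
    and lsc: "\<And>xs x c. xs \<longlonglongrightarrow> x \<Longrightarrow> (\<And>n. \<nu> (xs n) \<le> ereal c) \<Longrightarrow> \<nu> x \<le> ereal c"
    and k: "convex_on UNIV k" and k_lip: "\<And>x y. k x - k y \<le> L * norm (x - y)" and L: "0 \<le> L"
    and min: "\<And>y. \<nu> y \<noteq> \<infinity> \<Longrightarrow> real_of_ereal (\<nu> xh) + k xh \<le> real_of_ereal (\<nu> y) + k y"
  obtains u where "u \<in> mordukhovich_subdiff \<nu> xh" "\<And>y. k xh \<le> k y + blinfun_apply u (y - xh)"
proof -
  \<comment> \<open>\<open>real_of_ereal\<close> sends infinity to 0, so \<open>\<phi>\<close>
    represents \<open>\<nu>\<close> only on \<open>D\<close>. Membership in \<open>D\<close> is
    therefore part of every statement about \<open>\<phi>\<close>, lower semicontinuity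
    included.\<close>
  define D where "D = {y. \<nu> y \<noteq> \<infinity>}"
  define \<phi> where "\<phi> y = real_of_ereal (\<nu> y)" for y
  have \<nu>: "\<nu> y = ereal (\<phi> y)" if "y \<in> D" for y
    using nonneg[of y] that by (cases "\<nu> y") (auto simp: D_def \<phi>_def)
  have lscD: "x \<in> D \<and> \<phi> x \<le> c" if "\<And>n. xs n \<in> D" "xs \<longlonglongrightarrow> x" "\<And>n. \<phi> (xs n) \<le> c" for xs x c
  proof -
    have "\<nu> x \<le> ereal c" using lsc[OF that(2), of c] that(3) by (simp add: \<nu>[OF that(1)])
    moreover from this have "x \<in> D" by (auto simp: D_def)
    ultimately show ?thesis using \<nu> by simp
  qed
  have ex: "\<exists>x G. x \<in> D \<and> norm (x - xh) \<le> \<delta> \<and> \<bar>\<phi> x - \<phi> xh\<bar> \<le> \<delta> \<and> - G \<in> frechet_subdiff \<nu> x \<and>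
      (\<forall>y. blinfun_apply G (y - xh) \<le> k y - k xh + \<delta> * norm (y - xh) + \<delta>)" if \<delta>: "\<delta> > 0" for \<delta>
  proof -
    define \<eta> where "\<eta> = \<delta> / 2"
    \<comment> \<open>The errors are multiples of \<open>\<tau> / \<eta> = \<delta> / M\<close> with
      coefficients 4, \<open>4 * L + 6 * \<eta>\<close> and \<open>8 * L + 6 * \<eta>\<close>. As
      \<open>M\<close> exceeds all three, each error is at most \<open>\<delta>\<close>.\<close>
    define M where "M = 8 * L + 10 * \<eta> + 4"
    define \<tau> where "\<tau> = \<delta> * \<eta> / M"
    have \<eta>: "\<eta> > 0" using \<delta> by (simp add: \<eta>_def)
    have M: "M > 0" using L \<eta> by (simp add: M_def)
    have \<tau>: "\<tau> > 0" using \<delta> \<eta> M by (simp add: \<tau>_def)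
    have "perturbed_min D \<phi> k L \<eta> \<tau> xh"
    proof (rule perturbed_min.intro)
      show "xh \<in> D" using fin by (simp add: D_def)
      show "\<phi> xh + k xh \<le> \<phi> y + k y" if "y \<in> D" for y
        using min that by (simp add: D_def \<phi>_def)
      show "x \<in> D \<and> \<phi> x \<le> c" if "\<And>n. xs n \<in> D" "xs \<longlonglongrightarrow> x" "\<And>n. \<phi> (xs n) \<le> c" for xs x c
        using that by (rule lscD)
    qed (fact refl k k_lip L \<eta> \<tau>)+
    then interpret perturbed_min D \<phi> k L \<eta> \<tau> xh .
    obtain x G where xG: "x \<in> D" "norm (x - xh) \<le> 4 * (\<tau> / \<eta>)" "\<bar>\<phi> x - \<phi> xh\<bar> \<le> 4 * L * \<tau> / \<eta> + 6 * \<tau>"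
      "\<And>e. e > 0 \<Longrightarrow> \<exists>d>0. \<forall>v. norm v < d \<longrightarrow> x + v \<in> D \<longrightarrow> \<phi> x - blinfun_apply G v - e * norm v \<le> \<phi> (x + v)"
      "\<And>y. blinfun_apply G (y - xh) \<le> k y - k xh + 2 * \<eta> * norm (y - xh) + 6 * \<tau> + 8 * L * \<tau> / \<eta>"
      using approximate_subgradients by metis
    have t: "\<tau> / \<eta> = \<delta> / M" using \<eta> by (simp add: \<tau>_def)
    have small: "a * (\<tau> / \<eta>) \<le> \<delta>" if "a \<le> M" for a
      using that M \<delta> unfolding t by (simp add: pos_divide_le_eq mult.commute mult_left_mono)
    have "4 * (\<tau> / \<eta>) \<le> \<delta>" using L \<eta> by (intro small) (simp add: M_def)
    moreover have "4 * L * \<tau> / \<eta> + 6 * \<tau> \<le> \<delta>"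
    proof -
      have "4 * L * \<tau> / \<eta> + 6 * \<tau> = (4 * L + 6 * \<eta>) * (\<tau> / \<eta>)" using \<eta> by (simp add: field_simps)
      also have "\<dots> \<le> \<delta>" using L \<eta> by (intro small) (simp add: M_def)
      finally show ?thesis .
    qed
    moreover have 8: "6 * \<tau> + 8 * L * \<tau> / \<eta> \<le> \<delta>"
    proof -
      have "6 * \<tau> + 8 * L * \<tau> / \<eta> = (8 * L + 6 * \<eta>) * (\<tau> / \<eta>)" using \<eta> by (simp add: field_simps)
      also have "\<dots> \<le> \<delta>" using L \<eta> by (intro small) (simp add: M_def)
      finally show ?thesis .
    qed
    moreover have "- G \<in> frechet_subdiff \<nu> x"
    proof (rule frechet_subdiffI[OF nonneg])
      show "\<nu> x \<noteq> \<infinity>" using xG(1) by (simp add: D_def)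
      show "\<exists>d>0. \<forall>v. norm v < d \<longrightarrow> \<nu> (x + v) \<noteq> \<infinity> \<longrightarrow>
          real_of_ereal (\<nu> x) + blinfun_apply (- G) v - e * norm v \<le> real_of_ereal (\<nu> (x + v))" if "e > 0" for e
        using xG(4)[OF that] by (simp add: D_def \<phi>_def blinfun.minus_left)
    qed
    moreover have "blinfun_apply G (y - xh) \<le> k y - k xh + \<delta> * norm (y - xh) + \<delta>" for y
    proof -
      have "2 * \<eta> = \<delta>" by (simp add: \<eta>_def)
      then show ?thesis using xG(5)[of y] 8 by simp
    qed
    ultimately show ?thesis using xG(1-3) by (meson order_trans)
  qed
  define \<delta> where "\<delta> n = 1 / real (Suc n)" for n
  have \<delta>: "\<delta> n > 0" "\<delta> n \<le> 1" for n by (simp_all add: \<delta>_def)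
  have \<delta>_lim: "\<delta> \<longlonglongrightarrow> 0" unfolding \<delta>_def[abs_def] by (rule LIMSEQ_Suc[OF lim_1_over_n])
  obtain x G where xG: "\<And>n. x n \<in> D" "\<And>n. norm (x n - xh) \<le> \<delta> n" "\<And>n. \<bar>\<phi> (x n) - \<phi> xh\<bar> \<le> \<delta> n"
    "\<And>n. - G n \<in> frechet_subdiff \<nu> (x n)"
    "\<And>n y. blinfun_apply (G n) (y - xh) \<le> k y - k xh + \<delta> n * norm (y - xh) + \<delta> n"
    using ex[OF \<delta>(1)] by metis
  have "norm (G n) \<le> L + 1" for n
  proof (rule norm_le_of_affine_bound[where B = 1])
    fix v :: 'a
    have "\<delta> n * norm v \<le> norm v" using \<delta>[of n] mult_right_mono[of "\<delta> n" 1 "norm v"] by simp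
    then show "blinfun_apply (G n) v \<le> (L + 1) * norm v + 1"
      using xG(5)[of n "xh + v"] k_lip[of "xh + v" xh] \<delta>(2)[of n] by (simp add: algebra_simps)
  qed (use L in simp)
  then obtain r z where r: "strict_mono r" "\<And>v. (\<lambda>n. blinfun_apply (G (r n)) v) \<longlonglongrightarrow> blinfun_apply z v"
    using reflexive_weak_star_subsequence[OF refl, of G "L + 1"] by blast
  have \<delta>r: "(\<lambda>n. \<delta> (r n)) \<longlonglongrightarrow> 0" using LIMSEQ_subseq_LIMSEQ[OF \<delta>_lim r(1)] by (simp add: o_def)
  show ?thesis
  proof (rule that[of "- z"])
    have "(\<lambda>n. norm (x (r n) - xh)) \<longlonglongrightarrow> 0"
      by (rule tendsto_sandwich[OF _ _ tendsto_const \<delta>r]) (use xG(2) in \<open>auto intro!: always_eventually\<close>)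
    then have 1: "(\<lambda>n. x (r n)) \<longlonglongrightarrow> xh" by (simp add: LIM_zero_iff tendsto_norm_zero_iff)
    have "(\<lambda>n. \<bar>\<phi> (x (r n)) - \<phi> xh\<bar>) \<longlonglongrightarrow> 0"
      by (rule tendsto_sandwich[OF _ _ tendsto_const \<delta>r]) (use xG(3) in \<open>auto intro!: always_eventually\<close>)
    then have "(\<lambda>n. \<phi> (x (r n))) \<longlonglongrightarrow> \<phi> xh" by (simp add: LIM_zero_iff tendsto_rabs_zero_iff)
    then have 2: "(\<lambda>n. \<nu> (x (r n))) \<longlonglongrightarrow> \<nu> xh"
      using \<nu>[OF xG(1)] \<nu>[of xh] fin by (simp add: D_def)
    have 3: "(\<lambda>n. blinfun_apply (- G (r n)) v) \<longlonglongrightarrow> blinfun_apply (- z) v" for v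
      using tendsto_minus[OF r(2)[of v]] by (simp add: blinfun.minus_left)
    show "- z \<in> mordukhovich_subdiff \<nu> xh"
      unfolding mordukhovich_subdiff_def mem_Collect_eq
    proof (intro conjI exI allI)
      show "\<bar>\<nu> xh\<bar> \<noteq> \<infinity>" using fin nonneg[of xh] by auto
      show "(\<lambda>n. x (r n)) \<longlonglongrightarrow> xh" by (rule 1)
      show "(\<lambda>n. \<nu> (x (r n))) \<longlonglongrightarrow> \<nu> xh" by (rule 2)
      show "- G (r n) \<in> frechet_subdiff \<nu> (x (r n))" for n by (rule xG(4))
      show "(\<lambda>n. blinfun_apply (- G (r n)) v) \<longlonglongrightarrow> blinfun_apply (- z) v" for v by (rule 3)
    qed
    fix y
    have "(\<lambda>n. k y - k xh + \<delta> (r n) * norm (y - xh) + \<delta> (r n)) \<longlonglongrightarrow> k y - k xh + 0 * norm (y - xh) + 0"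
      by (intro tendsto_intros \<delta>r)
    then have "blinfun_apply z (y - xh) \<le> k y - k xh + 0 * norm (y - xh) + 0"
      by (rule LIMSEQ_le[OF r(2)]) (use xG(5) in auto)
    then show "k xh \<le> k y + blinfun_apply (- z) (y - xh)" by (simp add: blinfun.minus_left)
  qed
qed

text \<open>\<open>S x\<close> collects the points that improve on \<open>x\<close> by at least the
  price of the distance. Each new point nearly minimizes \<open>g\<close> over the set of its
  predecessor, with errors tending to 0, and the sequence is Cauchy because the decrease of
  \<open>g\<close> pays for the distances.\<close>

theorem ekeland_variational_principle:
  fixes g :: "'a::banach \<Rightarrow> real"
  assumes nonneg: "\<And>x. x \<in> D \<Longrightarrow> 0 \<le> g x" and c: "c > 0" and x0: "x0 \<in> D"
    and lsc: "\<And>xs x a. (\<And>n. xs n \<in> D) \<Longrightarrow> xs \<longlonglongrightarrow> x \<Longrightarrow> (\<And>n. g (xs n) \<le> a) \<Longrightarrow> x \<in> D \<and> g x \<le> a"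
  obtains x where "x \<in> D" "g x + c * norm (x - x0) \<le> g x0" "\<And>y. y \<in> D \<Longrightarrow> g x \<le> g y + c * norm (y - x)"
proof -
  define S where "S x = {y \<in> D. g y + c * norm (y - x) \<le> g x}" for x
  have next_point: "\<exists>y. y \<in> S x \<and> (\<forall>w\<in>S x. g y \<le> g w + (1/2)^n)" if "x \<in> D" for x n
  proof -
    have ne: "g ` S x \<noteq> {}" using that by (auto simp: S_def)
    have bdd: "bdd_below (g ` S x)" by (rule bdd_belowI2[where m = 0]) (use nonneg in \<open>auto simp: S_def\<close>)
    have "Inf (g ` S x) < Inf (g ` S x) + (1/2)^n" by simp
    then obtain y where "y \<in> S x" "g y < Inf (g ` S x) + (1/2)^n"
      using cInf_lessD[OF ne] by blast
    moreover have "Inf (g ` S x) \<le> g w" if "w \<in> S x" for w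
      using cInf_lower[OF _ bdd] that by simp
    ultimately show ?thesis by force
  qed
  have "\<exists>xs. xs 0 = x0 \<and> (\<forall>n. xs n \<in> D \<and> (xs (Suc n) \<in> S (xs n) \<and> (\<forall>w\<in>S (xs n). g (xs (Suc n)) \<le> g w + (1/2)^n)))"
  proof -
    have "\<exists>xs. \<forall>n. (xs n \<in> D \<and> (n = 0 \<longrightarrow> xs n = x0)) \<and>
        (xs (Suc n) \<in> S (xs n) \<and> (\<forall>w\<in>S (xs n). g (xs (Suc n)) \<le> g w + (1/2)^n))"
    proof (rule dependent_nat_choice[where P = "\<lambda>n x. x \<in> D \<and> (n = 0 \<longrightarrow> x = x0)"
          and Q = "\<lambda>n x y. y \<in> S x \<and> (\<forall>w\<in>S x. g y \<le> g w + (1/2)^n)"])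
      show "\<exists>x. x \<in> D \<and> (0 = (0::nat) \<longrightarrow> x = x0)" using x0 by blast
      show "\<exists>y. (y \<in> D \<and> (Suc n = 0 \<longrightarrow> y = x0)) \<and> y \<in> S x \<and> (\<forall>w\<in>S x. g y \<le> g w + (1/2)^n)"
        if "x \<in> D \<and> (n = 0 \<longrightarrow> x = x0)" for x n
        using next_point[of x n] that by (auto simp: S_def)
    qed
    then show ?thesis by blast
  qed
  then obtain xs where xs: "xs 0 = x0" "\<And>n. xs n \<in> D" "\<And>n. xs (Suc n) \<in> S (xs n)"
    "\<And>n w. w \<in> S (xs n) \<Longrightarrow> g (xs (Suc n)) \<le> g w + (1/2)^n" by blast
  have chain: "g (xs (n + m)) + c * norm (xs (n + m) - xs n) \<le> g (xs n)" for n m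
  proof (induction m)
    case (Suc m)
    have "g (xs (n + Suc m)) + c * norm (xs (n + Suc m) - xs (n + m)) \<le> g (xs (n + m))"
      using xs(3)[of "n + m"] by (simp add: S_def)
    moreover have "c * norm (xs (n + Suc m) - xs n) \<le> c * (norm (xs (n + Suc m) - xs (n + m)) + norm (xs (n + m) - xs n))"
      using c norm_triangle_ineq[of "xs (n + Suc m) - xs (n + m)" "xs (n + m) - xs n"] by (intro mult_left_mono) auto
    ultimately show ?case using Suc by (simp add: distrib_left)
  qed simp
  have dec: "decseq (\<lambda>n. g (xs n))"
  proof (rule decseq_SucI)
    show "g (xs (Suc n)) \<le> g (xs n)" for n
    proof -
      have "0 \<le> c * norm (xs (Suc n) - xs n)" using c by simp
      then show ?thesis using chain[of n 1] by simp
    qed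
  qed
  obtain l where l: "(\<lambda>n. g (xs n)) \<longlonglongrightarrow> l"
    using decseq_convergent[OF dec, of 0] nonneg xs(2) by blast
  have l_le: "l \<le> g (xs n)" for n by (rule decseq_ge[OF dec l])
  have "Cauchy xs"
  proof (rule CauchyI')
    fix e :: real assume e: "e > 0"
    then have "l < l + c * e" using c by simp
    then obtain N where N: "\<And>n. n \<ge> N \<Longrightarrow> g (xs n) < l + c * e"
      using order_tendstoD(2)[OF l] unfolding eventually_sequentially by blast
    show "\<exists>M. \<forall>m\<ge>M. \<forall>n>m. dist (xs m) (xs n) < e"
    proof (intro exI[of _ N] allI impI)
      fix m n assume "N \<le> m" "m < n"
      then have "c * norm (xs n - xs m) < c * e"
        using chain[of m "n - m"] N[of m] l_le[of n] by simp
      then show "dist (xs m) (xs n) < e" using c by (simp add: dist_norm norm_minus_commute)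
    qed
  qed
  then obtain x where x: "xs \<longlonglongrightarrow> x" by (auto simp: Cauchy_convergent_iff convergent_def)
  have xS: "x \<in> D \<and> g x + c * norm (x - xs n) \<le> g (xs n)" for n
  proof -
    have lim: "(\<lambda>m. c * norm (xs m - xs n)) \<longlonglongrightarrow> c * norm (x - xs n)"
      by (intro tendsto_intros x)
    have *: "x \<in> D \<and> g x \<le> g (xs n) - c * norm (x - xs n) + e" if "e > 0" for e
    proof -
      have "c * norm (x - xs n) - e < c * norm (x - xs n)" using that by simp
      then obtain M where M: "\<And>m. m \<ge> M \<Longrightarrow> c * norm (x - xs n) - e < c * norm (xs m - xs n)"
        using order_tendstoD(1)[OF lim] unfolding eventually_sequentially by blast
      show ?thesis
      proof (rule lsc[of "\<lambda>m. xs (n + (m + M))"])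
        show "g (xs (n + (m + M))) \<le> g (xs n) - c * norm (x - xs n) + e" for m
          using chain[of n "m + M"] M[of "n + (m + M)"] by simp
        show "(\<lambda>m. xs (n + (m + M))) \<longlonglongrightarrow> x"
          using LIMSEQ_ignore_initial_segment[OF x, of "n + M"] by (simp add: add_ac)
      qed (rule xs(2))
    qed
    have "g x \<le> g (xs n) - c * norm (x - xs n)" by (rule field_le_epsilon) (use * in blast)
    then show ?thesis using *[of 1] by simp
  qed
  show ?thesis
  proof (rule that[of x])
    show "x \<in> D" using xS by blast
    show "g x + c * norm (x - x0) \<le> g x0" using xS[of 0] xs(1) by simp
    fix y assume y: "y \<in> D"
    show "g x \<le> g y + c * norm (y - x)"
    proof (rule ccontr)
      assume neg: "\<not> ?thesis"
      \<comment> \<open>A violating \<open>y\<close> would belong to every \<open>S (xs n)\<close>.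
        Near-minimality of the successors then gives \<open>l \<le> g y\<close>, although
        \<open>g y < g x \<le> l\<close>.\<close>
      have yS: "y \<in> S (xs n)" for n
      proof -
        have "c * norm (y - xs n) \<le> c * (norm (y - x) + norm (x - xs n))"
          using c norm_triangle_ineq[of "y - x" "x - xs n"] by (intro mult_left_mono) auto
        then show ?thesis using neg xS[of n] y by (simp add: S_def distrib_left)
      qed
      have "(\<lambda>n. g y + (1/2)^n) \<longlonglongrightarrow> g y + 0"
        by (intro tendsto_intros LIMSEQ_power_zero) simp
      then have "l \<le> g y + 0"
        by (rule LIMSEQ_le[OF LIMSEQ_Suc[OF l]]) (use xs(4)[OF yS] in auto)
      moreover have "g x \<le> l"
      proof (rule LIMSEQ_le_const[OF l])
        have "g x \<le> g (xs n)" for n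
        proof -
          have "0 \<le> c * norm (x - xs n)" using c by simp
          then show ?thesis using xS[of n] by linarith
        qed
        then show "\<exists>N. \<forall>n\<ge>N. g x \<le> g (xs n)" by blast
      qed
      moreover have "0 \<le> c * norm (y - x)" using c by simp
      ultimately show False using neg by linarith
    qed
  qed
qed

text \<open>Outside \<open>K\<close>, the inequality at a projection \<open>w\<close> gives
  \<open>|x - w| \<le> v (x - w)\<close>, so \<open>v\<close> has norm exactly 1. Then
  \<open>v (x - w) \<le> |x - w|\<close>, added to the inequality at a point \<open>y\<close> of
  \<open>K\<close>, gives normality at \<open>w\<close>.\<close>

lemma subgradient_infdist_in_hatB:
  assumes K: "closed K" "K \<noteq> {}" and v: "\<And>y. infdist x K + blinfun_apply v (y - x) \<le> infdist y K"
  shows "v \<in> hatB K x"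
proof -
  have "norm v \<le> 1"
  proof (rule norm_le_of_affine_bound[where B = 0])
    show "blinfun_apply v y \<le> 1 * norm y + 0" for y
      using v[of "x + y"] infdist_triangle[of "x + y" K x] by (simp add: dist_norm)
  qed simp
  show ?thesis
  proof (cases "x \<in> K")
    case True
    have "blinfun_apply v (y - x) \<le> 0" if "y \<in> K" for y
      using v[of y] that True by simp
    then show ?thesis using True \<open>norm v \<le> 1\<close> by (simp add: hatB_def normal_cone_def)
  next
    case False
    have "v \<in> normal_cone w K \<inter> sphere 0 1" if "w \<in> metric_proj x K" for w
    proof -
      have w: "w \<in> K" using that by (simp add: metric_proj_def)
      have "norm (x - w) \<le> norm (x - s)" if "s \<in> K" for s
      proof -
        have "ereal (norm (x - w)) \<le> ereal (norm (x - s))"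
          using \<open>w \<in> metric_proj x K\<close> that by (auto simp: metric_proj_def edist_def intro: INF_lower)
        then show ?thesis by simp
      qed
      then have "norm (x - w) \<le> infdist x K"
        unfolding infdist_notempty[OF K(2)] dist_norm by (intro cINF_greatest K(2))
      then have d: "infdist x K = norm (x - w)"
        using infdist_le[OF w, of x] by (simp add: dist_norm)
      have xw: "norm (x - w) > 0" using False w by auto
      have vw: "norm (x - w) \<le> blinfun_apply v (x - w)"
        using v[of w] w by (simp add: d blinfun.diff_right)
      have "norm (x - w) \<le> norm v * norm (x - w)"
        using vw norm_blinfun[of v "x - w"] by simp
      then have "norm v = 1" using xw \<open>norm v \<le> 1\<close> by simp
      moreover have "blinfun_apply v (y - w) \<le> 0" if "y \<in> K" for y
        using v[of y] that norm_blinfun[of v "x - w"] \<open>norm v = 1\<close> by (simp add: d blinfun.diff_right)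
      ultimately show ?thesis by (simp add: normal_cone_def)
    qed
    then show ?thesis unfolding hatB_def using False by (simp only: if_False) blast
  qed
qed

section \<open>The merit function\<close>

lemma edist_infdist: "S \<noteq> {} \<Longrightarrow> edist x S = ereal (infdist x S)"
proof (rule antisym)
  assume S: "S \<noteq> {}"
  show "ereal (infdist x S) \<le> edist x S"
    unfolding edist_def by (intro INF_greatest) (simp add: infdist_le dist_norm[symmetric])
  show "edist x S \<le> ereal (infdist x S)"
  proof (rule ereal_le_epsilon2)
    fix e :: real assume "0 < e"
    then obtain u where "u \<in> S" "dist x u < infdist x S + e"
      using infdist_less_obtain[OF S, of x "infdist x S + e"] by auto
    then show "edist x S \<le> ereal (infdist x S) + ereal e"
      unfolding edist_def by (intro INF_lower2[of u]) (auto simp: dist_norm)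
  qed
qed

lemma edist_nonneg: "0 \<le> edist x S"
  unfolding edist_def by (intro INF_greatest) simp

text \<open>Subtracting an element \<open>d\<close> of \<open>C\<close> cannot bring a point closer
  to \<open>C\<close>, because \<open>C + d\<close> is contained in \<open>C\<close>. So near
  \<open>x\<close> the distance of \<open>g\<close> to \<open>C\<close> is at least that of some
  point in a small ball around \<open>g x\<close>.\<close>

lemma cone_usc_infdist_lsc:
  assumes C: "convex C" "cone C" "C \<noteq> {}" and g: "cone_usc C g"
    and xs: "xs \<longlonglongrightarrow> x" "\<And>n. infdist (g (xs n)) C \<le> c"
  shows "infdist (g x) C \<le> c"
proof (rule field_le_epsilon)
  fix e :: real assume e: "e > 0"
  have "open (ball (g x) e) \<and> g x \<in> ball (g x) e" using e by simp
  then obtain U where U: "open U" "x \<in> U" "\<And>y. y \<in> U \<Longrightarrow> g y \<in> {v - c |v c. v \<in> ball (g x) e \<and> c \<in> C}"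
    using g unfolding cone_usc_def cone_usc_at_def by meson
  obtain n where "xs n \<in> U"
    using topological_tendstoD[OF xs(1) U(1,2)] unfolding eventually_sequentially by blast
  then obtain v d where v: "g (xs n) = v - d" "v \<in> ball (g x) e" "d \<in> C" using U(3) by blast
  have "infdist v C \<le> infdist (g (xs n)) C"
    unfolding infdist_notempty[OF C(3)]
  proof (rule cINF_greatest[OF C(3)])
    fix s assume "s \<in> C"
    then have "s + d \<in> C" using C(1,2) v(3) convex_cone[of C] by blast
    then have "(INF a\<in>C. dist v a) \<le> dist v (s + d)" by (intro cINF_lower) (auto intro: bdd_belowI2[where m = 0])
    also have "\<dots> = dist (g (xs n)) s" by (simp add: v dist_norm algebra_simps)
    finally show "(INF a\<in>C. dist v a) \<le> dist (g (xs n)) s" .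
  qed
  then show "infdist (g x) C \<le> c + e"
    using infdist_triangle[of "g x" C v] v(2) xs(2)[of n] by simp
qed

lemma merit_nonneg: "K \<noteq> {} \<Longrightarrow> 0 \<le> merit C K f x"
  unfolding merit_def by (meson SUP_upper2 edist_nonneg ex_in_conv)

lemma merit_le_iff: "C \<noteq> {} \<Longrightarrow> merit C K f x \<le> ereal c \<longleftrightarrow> (\<forall>z\<in>K. infdist (f x z) C \<le> c)"
  unfolding merit_def by (simp add: SUP_le_iff edist_infdist)

lemma merit_lsc:
  assumes "convex C" "cone C" "C \<noteq> {}" "\<And>z. z \<in> K \<Longrightarrow> cone_usc C (\<lambda>x. f x z)"
    and "xs \<longlonglongrightarrow> x" "\<And>n. merit C K f (xs n) \<le> ereal c"
  shows "merit C K f x \<le> ereal c"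
  using assms(6) unfolding merit_le_iff[OF assms(3)]
  by (intro ballI cone_usc_infdist_lsc[OF assms(1-3) assms(4) assms(5)]) auto

lemma merit_eq_0_iff:
  assumes "closed C" "C \<noteq> {}" "K \<noteq> {}"
  shows "merit C K f x = 0 \<longleftrightarrow> (\<forall>z\<in>K. f x z \<in> C)"
proof -
  have "merit C K f x = 0 \<longleftrightarrow> merit C K f x \<le> ereal 0"
    using merit_nonneg[OF assms(3), of C f x] by (auto simp: zero_ereal_def)
  also have "\<dots> \<longleftrightarrow> (\<forall>z\<in>K. f x z \<in> C)"
    unfolding merit_le_iff[OF assms(2)]
    by (metis assms(1,2) in_closed_iff_infdist_zero infdist_nonneg order_antisym order_refl)
  finally show ?thesis .
qed

section \<open>Error bound, existence and closedness\<close>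

theorem theorem3p14:
  fixes C :: "'b::banach set"
    and K :: "'a::banach set"
    and f :: "'a \<Rightarrow> 'a \<Rightarrow> 'b"
    and \<gamma> :: real
  assumes "reflexive_space TYPE('a)"
    and "closed C" "convex C" "cone C" "C \<noteq> {}" "C \<noteq> {0}" "C \<noteq> UNIV"
    and "K \<noteq> {}" "closed K"
    and "convex K"
    and "\<And>z. z \<in> K \<Longrightarrow> cone_usc C (\<lambda>x. f x z)"
    and "\<exists>x0\<in>K. cone_bounded C (f x0 ` K)"
    and "\<gamma> > 0"
    and "\<And>x. x \<notin> strong_equilibria C K f \<Longrightarrow>
      {u + v |u v. u \<in> mordukhovich_subdiff (merit C K f) x \<and> v \<in> hatB K x} \<inter> cball 0 \<gamma> = {}"
  shows "strong_equilibria C K f \<noteq> {} \<and> closed (strong_equilibria C K f) \<and>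
    (\<forall>x. edist x (strong_equilibria C K f) \<le> merit_plus C K f x / ereal \<gamma>)"
proof -
  let ?\<nu> = "merit C K f" and ?SE = "strong_equilibria C K f"
  have nonneg: "0 \<le> ?\<nu> x" for x by (rule merit_nonneg[OF assms(8)])
  have lsc: "?\<nu> x \<le> ereal c" if "xs \<longlonglongrightarrow> x" "\<And>n. ?\<nu> (xs n) \<le> ereal c" for xs x c
    by (rule merit_lsc[OF assms(3,4,5,11) that])
  have SE: "x \<in> ?SE \<longleftrightarrow> x \<in> K \<and> ?\<nu> x = 0" for x
    using merit_eq_0_iff[OF assms(2,5,8), of f x] by (auto simp: strong_equilibria_def)
  have bound: "edist x ?SE \<le> merit_plus C K f x / ereal \<gamma>" for x
  proof (rule ccontr)
    assume "\<not> ?thesis"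
    then have far: "merit_plus C K f x / ereal \<gamma> < edist x ?SE" by simp
    have plus: "merit_plus C K f x = ?\<nu> x + ereal (infdist x K)"
      by (simp add: merit_plus_def edist_infdist[OF assms(8)])
    have fin: "?\<nu> x \<noteq> \<infinity>" using far assms(13) by (auto simp: plus)
    define D where "D = {y. ?\<nu> y \<noteq> \<infinity>}"
    define \<phi> where "\<phi> y = real_of_ereal (?\<nu> y)" for y
    have \<nu>: "?\<nu> y = ereal (\<phi> y)" if "y \<in> D" for y
      using nonneg[of y] that by (cases "?\<nu> y") (auto simp: D_def \<phi>_def)
    have \<phi>0: "0 \<le> \<phi> y" for y using nonneg[of y] by (simp add: \<phi>_def real_of_ereal_pos)
    have xD: "x \<in> D" using fin by (simp add: D_def)
    define m where "m = \<phi> x + infdist x K"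
    have "ereal (m / \<gamma>) < edist x ?SE"
      using far assms(13) by (simp add: plus \<nu>[OF xD] m_def)
    \<comment> \<open>With slope \<open>\<gamma>' = m / \<rho>\<close>, which is below
      \<open>\<gamma>\<close>, Ekeland's point lies within \<open>m / \<gamma>' = \<rho>\<close> of
      \<open>x\<close>. As \<open>\<rho>\<close> is less than the distance to \<open>?SE\<close>,
      that point is outside \<open>?SE\<close>.\<close>
    then obtain \<rho> where \<rho>: "m / \<gamma> < \<rho>" "ereal \<rho> < edist x ?SE"
      using ereal_dense2 by (metis ereal_less(2) less_ereal.simps(1))
    have "m > 0"
    proof (rule ccontr)
      assume "\<not> m > 0"
      then have "\<phi> x = 0" "infdist x K = 0"
        using \<phi>0[of x] infdist_nonneg[of x K] by (auto simp: m_def)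
      then have "x \<in> ?SE"
        using \<nu>[OF xD] in_closed_iff_infdist_zero[OF assms(9,8)] by (simp add: SE)
      then have "edist x ?SE \<le> 0" unfolding edist_def by (intro INF_lower2[of x]) auto
      moreover have "0 \<le> m / \<gamma>" using \<open>\<phi> x = 0\<close> \<open>infdist x K = 0\<close> by (simp add: m_def)
      ultimately show False
        using less_le_trans[OF \<open>ereal (m / \<gamma>) < edist x ?SE\<close>, of 0] by simp
    qed
    then have \<rho>0: "\<rho> > 0" using \<rho>(1) assms(13) by (meson divide_pos_pos less_trans)
    define \<gamma>' where "\<gamma>' = m / \<rho>"
    have \<gamma>': "0 < \<gamma>'" "\<gamma>' < \<gamma>"
      using \<open>m > 0\<close> \<rho>0 \<rho>(1) assms(13) by (simp_all add: \<gamma>'_def field_simps)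
    have lip: "infdist y K - infdist y' K \<le> norm (y - y')" for y y'
      using infdist_triangle[of y K y'] by (simp add: dist_norm)
    have lscg: "y \<in> D \<and> \<phi> y + infdist y K \<le> a"
      if ys: "\<And>n. ys n \<in> D" "ys \<longlonglongrightarrow> y" "\<And>n. \<phi> (ys n) + infdist (ys n) K \<le> a" for ys y a
    proof -
      have lim: "(\<lambda>n. infdist (ys n) K) \<longlonglongrightarrow> infdist y K" by (intro tendsto_intros ys(2))
      have *: "?\<nu> y \<le> ereal (a - infdist y K + e)" if "e > 0" for e
      proof -
        have "infdist y K - e < infdist y K" using that by simp
        then obtain N where N: "\<And>n. n \<ge> N \<Longrightarrow> infdist y K - e < infdist (ys n) K"
          using order_tendstoD(1)[OF lim] unfolding eventually_sequentially by blast
        show ?thesis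
        proof (rule lsc[OF LIMSEQ_ignore_initial_segment[OF ys(2), of N]])
          show "?\<nu> (ys (n + N)) \<le> ereal (a - infdist y K + e)" for n
            using ys(3)[of "n + N"] N[of "n + N"] by (simp add: \<nu>[OF ys(1)])
        qed
      qed
      have yD: "y \<in> D" using *[of 1] by (auto simp: D_def)
      have "\<phi> y \<le> a - infdist y K"
        by (rule field_le_epsilon) (use * \<nu>[OF yD] in auto)
      then show ?thesis using yD by simp
    qed
    obtain xh where xh: "xh \<in> D" "\<phi> xh + infdist xh K + \<gamma>' * norm (xh - x) \<le> \<phi> x + infdist x K"
      "\<And>y. y \<in> D \<Longrightarrow> \<phi> xh + infdist xh K \<le> \<phi> y + infdist y K + \<gamma>' * norm (y - xh)"
    proof (rule ekeland_variational_principle[of D "\<lambda>y. \<phi> y + infdist y K" \<gamma>' x])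
      show "0 \<le> \<phi> y + infdist y K" for y using \<phi>0 infdist_nonneg[of y K] by simp
      show "y \<in> D \<and> \<phi> y + infdist y K \<le> a"
        if "\<And>n. ys n \<in> D" "ys \<longlonglongrightarrow> y" "\<And>n. \<phi> (ys n) + infdist (ys n) K \<le> a" for ys y a
        by (rule lscg[OF that])
    qed (use \<gamma>' xD in \<open>assumption | auto\<close>)+
    have "\<gamma>' * norm (xh - x) \<le> \<gamma>' * \<rho>"
      using xh(2) \<phi>0[of xh] infdist_nonneg[of xh K] \<rho>0 by (simp add: \<gamma>'_def m_def)
    then have "norm (x - xh) \<le> \<rho>" using \<gamma>' by (simp add: norm_minus_commute)
    have notSE: "xh \<notin> ?SE"
    proof
      assume "xh \<in> ?SE"
      then have "edist x ?SE \<le> ereal (norm (x - xh))" unfolding edist_def by (rule INF_lower)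
      also have "\<dots> \<le> ereal \<rho>" using \<open>norm (x - xh) \<le> \<rho>\<close> by simp
      finally show False using \<rho>(2) by simp
    qed
    define k where "k y = infdist y K + \<gamma>' * norm (y - xh)" for y
    have conv_d: "convex_on UNIV (\<lambda>y. infdist y K)" by (rule convex_on_infdist[OF assms(10,8)])
    have "convex_on UNIV (\<lambda>y. \<gamma>' * norm (y - xh))"
      using convex_on_dist[of UNIV xh] \<gamma>' by (intro convex_on_cmul) (auto simp: dist_norm norm_minus_commute)
    then have k: "convex_on UNIV k" unfolding k_def[abs_def] using conv_d by (intro convex_on_add)
    have k_lip: "k y - k y' \<le> (1 + \<gamma>') * norm (y - y')" for y y'
    proof -
      have "\<gamma>' * (norm (y - xh) - norm (y' - xh)) \<le> \<gamma>' * norm (y - y')"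
        using norm_triangle_ineq2[of "y - xh" "y' - xh"] \<gamma>' by (intro mult_left_mono) auto
      then show ?thesis using lip[of y y'] by (simp add: k_def algebra_simps)
    qed
    obtain u where u: "u \<in> mordukhovich_subdiff ?\<nu> xh" "\<And>y. k xh \<le> k y + blinfun_apply u (y - xh)"
    proof (rule limiting_sum_rule[OF assms(1) nonneg _ lsc k k_lip])
      show "?\<nu> xh \<noteq> \<infinity>" using xh(1) by (simp add: D_def)
      show "real_of_ereal (?\<nu> xh) + k xh \<le> real_of_ereal (?\<nu> y) + k y" if "?\<nu> y \<noteq> \<infinity>" for y
        using xh(3)[of y] that by (simp add: D_def \<phi>_def k_def)
    qed (use \<gamma>' in auto)
    have "infdist xh K \<le> infdist y K + \<gamma>' * norm (y - xh) + blinfun_apply u (y - xh)" for y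
      using u(2)[of y] by (simp add: k_def)
    then obtain v where v: "\<And>y. infdist xh K + blinfun_apply v (y - xh) \<le> infdist y K" "norm (u + v) \<le> \<gamma>'"
      using convex_sum_rule[OF conv_d less_imp_le[OF \<gamma>'(1)]] by blast
    have "v \<in> hatB K xh" by (rule subgradient_infdist_in_hatB[OF assms(9,8) v(1)])
    then have "u + v \<in> {u + v |u v. u \<in> mordukhovich_subdiff ?\<nu> xh \<and> v \<in> hatB K xh} \<inter> cball 0 \<gamma>"
      using u(1) v(2) \<gamma>'(2) by auto
    then show False using assms(14)[OF notSE] by blast
  qed
  \<comment> \<open>Existence is read off the error bound: without a solution the distance at
    \<open>x0\<close> would be infinite, whereas \<open>?\<nu> x0\<close> is at most
    \<open>m\<close>, as \<open>0\<close> lies in \<open>C\<close>.\<close>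
  moreover have "?SE \<noteq> {}"
  proof
    assume empty: "?SE = {}"
    obtain x0 m where x0: "x0 \<in> K" "0 \<le> m" "f x0 ` K - C \<subseteq> cball 0 m"
      using assms(12) by (auto simp: cone_bounded_def)
    have 0: "0 \<in> C" using assms(4,5) cone_contains_0 by blast
    have "infdist (f x0 z) C \<le> m" if "z \<in> K" for z
    proof (cases "f x0 z \<in> C")
      case False
      then have "norm (f x0 z) \<le> m" using x0(3) that by (auto simp: subset_iff)
      then show ?thesis using infdist_le[OF 0, of "f x0 z"] by simp
    qed (use x0(2) in simp)
    then have "?\<nu> x0 \<le> ereal m" by (simp add: merit_le_iff[OF assms(5)])
    then have "?\<nu> x0 \<noteq> \<infinity>" by auto
    moreover have "merit_plus C K f x0 = ?\<nu> x0 + ereal 0"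
      using x0(1) by (simp add: merit_plus_def edist_infdist[OF assms(8)])
    moreover have "edist x0 ?SE = \<infinity>" by (simp add: empty edist_def top_ereal_def)
    ultimately show False
      using bound[of x0] nonneg[of x0] assms(13) by (cases "?\<nu> x0") auto
  qed
  moreover have "closed ?SE"
  proof (unfold closed_sequential_limits, intro allI impI, elim conjE)
    fix xs x assume xs: "\<forall>n. xs n \<in> ?SE" "xs \<longlonglongrightarrow> x"
    have "x \<in> K"
      using closed_sequentially[OF assms(9) _ xs(2)] xs(1) SE by blast
    moreover have "?\<nu> x \<le> ereal 0"
      by (rule lsc[OF xs(2)]) (use xs(1) SE in \<open>auto simp: zero_ereal_def\<close>)
    then have "?\<nu> x = 0" using nonneg[of x] by (simp add: zero_ereal_def[symmetric] antisym)
    ultimately show "x \<in> ?SE" by (simp add: SE)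
  qed
  ultimately show ?thesis by blast
qed

end
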